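(* Let $d,L\in\mathbb{N}$, $A,B_1,\dots,B_L\in\mathbb{R}^{d\times d}$ and, for $x\in\mathbb{R}^d$, let $(X_t(x))_{t\ge 0}$ be the unique strong solution of the Stratonovich SDE $$dX_t(x)=AX_t(x)\,dt+\sum_{j=1}^{L}B_jX_t(x)\circ dW_j(t),\quad t\ge 0,\qquad X_0(x)=x.$$ Assume that there is an invertible $P\in\mathbb{C}^{d\times d}$ such that $PAP^{-1}=\mathrm{diag}(\alpha_1,\dots,\alpha_d)$ and $PB_jP^{-1}=\mathrm{diag}(\beta_{1,j},\dots,\beta_{d,j})$ for all $j\in\{1,\dots,L\}$ (possibly complex entries). Let $\Gamma:=(P^{-1})^*P^{-1}$, and for $i,k\in\{1,\dots,d\}$ $$R_{i,k}:=\mathrm{Re}\Big(\overline{\alpha}_i+\alpha_k+\frac12\sum_{j=1}^{L}(\overline{\beta}_{i,j}+\beta_{k,j})^2\Big),$$ and assume that $\max_{1\le i\le k\le d}R_{i,k}<0$. Let $x\in\mathbb{R}^d$, $x\ne0$, $y:=Px$, $$q:=q(x):=\min\{-R_{i,k}:(i,k)\in\{1,\dots,d\}^2,\ \overline{y}_i\Gamma_{i,k}y_k\ne0\}>0,$$ $$I:=I(x):=\{(i,k)\in\{1,\dots,d\}^2: -R_{i,k}=q,\ \overline{y}_i\Gamma_{i,k}y_k\neq0\}.$$ Define $t_\varepsilon:=\frac1q\ln(1/\varepsilon)$ for $\varepsilon\in(0,1]$ and let $(w_\varepsilon)_{\varepsilon\in(0,1]}$ be positive numbers such that $w_\varepsilon\to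 w>0$ as $\varepsilon\to0$. Then there exist $l_{i,k},u_{i,k}\in\mathbb{R}$ such that for every $r\in\mathbb{R}$ $$\liminf_{\varepsilon\to0}\frac{\mathbb{E}[\|X_{t_\varepsilon+r\cdot w_\varepsilon}(x)\|^2]}{\varepsilon}=e^{-qr\cdot w}\sum_{(i,k)\in I;\,i\le k}2\,\mathrm{Re}\big(\overline{y}_i\Gamma_{i,k}y_k\exp(\mathsf{i}\,l_{i,k})\big)>0,$$ $$\limsup_{\varepsilon\to0}\frac{\mathbb{E}[\|X_{t_\varepsilon+r\cdot w_\varepsilon}(x)\|^2]}{\varepsilon}=e^{-qr\cdot w}\sum_{(i,k)\in I;\,i\le k}2\,\mathrm{Re}\big(\overline{y}_i\Gamma_{i,k}y_k\exp(\mathsf{i}\,u_{i,k})\big)<\infty.$$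
   Context: $W_1,\dots,W_L$ are independent standard one-dimensional Brownian motions on a filtered complete probability space satisfying the usual conditions, and $\circ$ denotes Stratonovich integration. $\|\cdot\|$ is the Euclidean norm, $M^*$ is the conjugate transpose of $M$, and $\mathsf{i}$ is the imaginary unit. *)

theory Defs
  imports "HOL-Probability.Probability"
begin

section \<open>Filtered probability spaces and Brownian motion\<close>

text \<open>
  Time is of type \<open>real\<close> so that the library notions \<open>filtration\<close> and \<open>stopping_time\<close> apply. Only
  times \<open>t \<ge> 0\<close> matter: a filtration indexed by \<open>t \<ge> 0\<close> is extended by \<open>F t = F 0\<close> for \<open>t < 0\<close>.
\<close>

locale usual_filtered_prob_space =
  prob_space M + complete_measure M + filtration "space M" F
  for M :: "'a measure" and F :: "real \<Rightarrow> 'a measure" +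
  assumes sets_F_subset: "\<And>t. sets (F t) \<subseteq> sets M"
    and null_sets_F: "null_sets M \<subseteq> sets (F 0)"
    and right_continuous_F: "\<And>t. 0 \<le> t \<Longrightarrow> sets (F t) = (\<Inter>s\<in>{t<..}. sets (F s))"

definition adapted :: "(real \<Rightarrow> 'a measure) \<Rightarrow> (real \<Rightarrow> 'a \<Rightarrow> 'b::topological_space) \<Rightarrow> bool" where
  "adapted F Y \<longleftrightarrow> (\<forall>t\<ge>0. Y t \<in> borel_measurable (F t))"

definition continuous_paths :: "'a measure \<Rightarrow> (real \<Rightarrow> 'a \<Rightarrow> 'b::topological_space) \<Rightarrow> bool" where
  "continuous_paths M Y \<longleftrightarrow> (AE \<omega> in M. continuous_on {0..} (\<lambda>t. Y t \<omega>))"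

definition brownian_motion ::
    "'a measure \<Rightarrow> (real \<Rightarrow> 'a measure) \<Rightarrow> (real \<Rightarrow> 'a \<Rightarrow> real) \<Rightarrow> bool" where
  "brownian_motion M F W \<longleftrightarrow>
     adapted F W \<and> continuous_paths M W \<and> (AE \<omega> in M. W 0 \<omega> = 0) \<and>
     (\<forall>s t. 0 \<le> s \<and> s < t \<longrightarrow>
        distributed M lborel (\<lambda>\<omega>. W t \<omega> - W s \<omega>) (normal_density 0 (sqrt (t - s))) \<and>
        prob_space.indep_set M (sets (F s))
          (sets (vimage_algebra (space M) (\<lambda>\<omega>. W t \<omega> - W s \<omega>) borel)))"

text \<open>Independence of the processes is independence of the path-valued random variables
  in \<open>\<real>\<^bsup>[0,\<infinity>)\<^esup>\<close> with its product \<open>\<sigma>\<close>-algebra.\<close>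

definition independent_brownian_motions ::
    "'a measure \<Rightarrow> (real \<Rightarrow> 'a measure) \<Rightarrow> ('l \<Rightarrow> real \<Rightarrow> 'a \<Rightarrow> real) \<Rightarrow> bool" where
  "independent_brownian_motions M F W \<longleftrightarrow>
     (\<forall>j. brownian_motion M F (W j)) \<and>
     prob_space.indep_vars M (\<lambda>_. PiM {0..} (\<lambda>_. borel)) (\<lambda>j \<omega>. \<lambda>t\<in>{0..}. W j t \<omega>) UNIV"

section \<open>Continuous semimartingales\<close>

definition martingale ::
    "'a measure \<Rightarrow> (real \<Rightarrow> 'a measure) \<Rightarrow> (real \<Rightarrow> 'a \<Rightarrow> real) \<Rightarrow> bool" where
  "martingale M F N \<longleftrightarrow>
     adapted F N \<and> (\<forall>t\<ge>0. integrable M (N t)) \<and>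
     (\<forall>s t. 0 \<le> s \<and> s \<le> t \<longrightarrow> (AE \<omega> in M. real_cond_exp M (F s) (N t) \<omega> = N s \<omega>))"

text \<open>Taking the localizing stopping times finite is no restriction: replace \<open>T n\<close> by \<open>min (T n) n\<close>.\<close>

definition continuous_local_martingale ::
    "'a measure \<Rightarrow> (real \<Rightarrow> 'a measure) \<Rightarrow> (real \<Rightarrow> 'a \<Rightarrow> real) \<Rightarrow> bool" where
  "continuous_local_martingale M F N \<longleftrightarrow>
     adapted F N \<and> continuous_paths M N \<and> (AE \<omega> in M. N 0 \<omega> = 0) \<and>
     (\<exists>T :: nat \<Rightarrow> 'a \<Rightarrow> real.
        (\<forall>n. stopping_time F (T n) \<and> (\<forall>\<omega>\<in>space M. 0 \<le> T n \<omega>)) \<and>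
        (AE \<omega> in M. incseq (\<lambda>n. T n \<omega>) \<and> filterlim (\<lambda>n. T n \<omega>) at_top sequentially) \<and>
        (\<forall>n. martingale M F (\<lambda>t \<omega>. N (min t (T n \<omega>)) \<omega>)))"

definition continuous_increasing_process ::
    "'a measure \<Rightarrow> (real \<Rightarrow> 'a measure) \<Rightarrow> (real \<Rightarrow> 'a \<Rightarrow> real) \<Rightarrow> bool" where
  "continuous_increasing_process M F V \<longleftrightarrow>
     adapted F V \<and> continuous_paths M V \<and> (AE \<omega> in M. V 0 \<omega> = 0) \<and>
     (AE \<omega> in M. mono_on {0..} (\<lambda>t. V t \<omega>))"

definition continuous_semimartingale ::
    "'a measure \<Rightarrow> (real \<Rightarrow> 'a measure) \<Rightarrow> (real \<Rightarrow> 'a \<Rightarrow> real) \<Rightarrow> bool" where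
  "continuous_semimartingale M F Y \<longleftrightarrow>
     adapted F Y \<and>
     (\<exists>N V1 V2. continuous_local_martingale M F N \<and>
        continuous_increasing_process M F V1 \<and> continuous_increasing_process M F V2 \<and>
        (AE \<omega> in M. \<forall>t\<ge>0. Y t \<omega> = Y 0 \<omega> + N t \<omega> + (V1 t \<omega> - V2 t \<omega>)))"

section \<open>Stratonovich integrals and linear Stratonovich equations\<close>

definition interval_partition :: "real \<Rightarrow> nat \<Rightarrow> (nat \<Rightarrow> real) \<Rightarrow> bool" where
  "interval_partition t n p \<longleftrightarrow> p 0 = 0 \<and> p n = t \<and> (\<forall>i<n. p i \<le> p (Suc i))"

definition stratonovich_sum ::
    "(real \<Rightarrow> 'a \<Rightarrow> 'b::real_vector) \<Rightarrow> (real \<Rightarrow> 'a \<Rightarrow> real) \<Rightarrow> nat \<Rightarrow> (nat \<Rightarrow> real) \<Rightarrow> 'a \<Rightarrow> 'b" where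
  "stratonovich_sum Y W n p \<omega> =
     (\<Sum>i<n. (W (p (Suc i)) \<omega> - W (p i) \<omega>) *\<^sub>R ((1/2) *\<^sub>R (Y (p i) \<omega> + Y (p (Suc i)) \<omega>)))"

text \<open>The Fisk-Stratonovich integral \<open>\<integral>\<^sub>0\<^sup>t Y \<circ> dW\<close> of a continuous semimartingale \<open>Y\<close>: the limit in
  probability of the trapezoidal sums as the mesh of the partition of \<open>[0,t]\<close> tends to \<open>0\<close>.
  It is determined up to a null set.\<close>

definition has_stratonovich_integral ::
    "'a measure \<Rightarrow> (real \<Rightarrow> 'a \<Rightarrow> 'b::euclidean_space) \<Rightarrow> (real \<Rightarrow> 'a \<Rightarrow> real) \<Rightarrow> real \<Rightarrow>
     ('a \<Rightarrow> 'b) \<Rightarrow> bool" where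
  "has_stratonovich_integral M Y W t S \<longleftrightarrow>
     S \<in> borel_measurable M \<and>
     (\<forall>\<eta>>0. \<forall>\<epsilon>>0. \<exists>\<delta>>0. \<forall>n p.
        interval_partition t n p \<and> (\<forall>i<n. p (Suc i) - p i < \<delta>) \<longrightarrow>
        measure M {\<omega>\<in>space M. \<eta> \<le> norm (stratonovich_sum Y W n p \<omega> - S \<omega>)} < \<epsilon>)"

text \<open>\<open>X\<close> solves \<open>dX = A X dt + \<Sum>\<^sub>j B\<^sub>j X \<circ> dW\<^sub>j\<close>, \<open>X\<^sub>0 = x\<close>.\<close>

definition stratonovich_solution ::
    "'a measure \<Rightarrow> (real \<Rightarrow> 'a measure) \<Rightarrow> ('l::finite \<Rightarrow> real \<Rightarrow> 'a \<Rightarrow> real) \<Rightarrow>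
     real^'d^'d \<Rightarrow> ('l \<Rightarrow> real^'d^'d) \<Rightarrow> real^'d \<Rightarrow> (real \<Rightarrow> 'a \<Rightarrow> real^'d) \<Rightarrow> bool" where
  "stratonovich_solution M F W A B x X \<longleftrightarrow>
     adapted F X \<and> continuous_paths M X \<and>
     (\<forall>i. continuous_semimartingale M F (\<lambda>t \<omega>. X t \<omega> $ i)) \<and>
     (\<exists>S :: 'l \<Rightarrow> real \<Rightarrow> 'a \<Rightarrow> real^'d.
        (\<forall>j. \<forall>t\<ge>0. has_stratonovich_integral M (\<lambda>s \<omega>. B j *v X s \<omega>) (W j) t (S j t)) \<and>
        (\<forall>t\<ge>0. AE \<omega> in M.
           X t \<omega> = x + integral {0..t} (\<lambda>s. A *v X s \<omega>) + (\<Sum>j\<in>UNIV. S j t \<omega>)))"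

section \<open>Simultaneous diagonalization and decay rates\<close>

definition complex_vec :: "real^'n \<Rightarrow> complex^'n" where
  "complex_vec x = (\<chi> i. complex_of_real (x $ i))"

abbreviation complex_mat :: "real^'n^'m \<Rightarrow> complex^'n^'m" where
  "complex_mat A \<equiv> map_matrix complex_of_real A"

definition conjugate_transpose :: "complex^'n^'m \<Rightarrow> complex^'m^'n" where
  "conjugate_transpose A = (\<chi> i k. cnj (A $ k $ i))"

definition diag_mat :: "('n \<Rightarrow> complex) \<Rightarrow> complex^'n^'n" where
  "diag_mat a = (\<chi> i k. if i = k then a i else 0)"

definition Gram :: "complex^'d^'d \<Rightarrow> complex^'d^'d" where
  "Gram P = conjugate_transpose (matrix_inv P) ** matrix_inv P"

definition rate :: "('d \<Rightarrow> complex) \<Rightarrow> ('d \<Rightarrow> 'l::finite \<Rightarrow> complex) \<Rightarrow> 'd \<Rightarrow> 'd \<Rightarrow> real" where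
  "rate \<alpha> \<beta> i k = Re (cnj (\<alpha> i) + \<alpha> k + (1/2) * (\<Sum>j\<in>UNIV. (cnj (\<beta> i j) + \<beta> k j)\<^sup>2))"

definition pair_coeff :: "complex^'d^'d \<Rightarrow> real^'d \<Rightarrow> 'd \<Rightarrow> 'd \<Rightarrow> complex" where
  "pair_coeff P x i k =
     (let y = P *v complex_vec x in cnj (y $ i) * Gram P $ i $ k * y $ k)"

definition decay_rate ::
    "complex^'d^'d \<Rightarrow> ('d \<Rightarrow> complex) \<Rightarrow> ('d \<Rightarrow> 'l::finite \<Rightarrow> complex) \<Rightarrow> real^'d \<Rightarrow> real" where
  "decay_rate P \<alpha> \<beta> x = Min {- rate \<alpha> \<beta> i k |i k. pair_coeff P x i k \<noteq> 0}"

definition leading_pairs ::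
    "complex^'d^'d \<Rightarrow> ('d \<Rightarrow> complex) \<Rightarrow> ('d \<Rightarrow> 'l::finite \<Rightarrow> complex) \<Rightarrow> real^'d \<Rightarrow> ('d \<times> 'd) set" where
  "leading_pairs P \<alpha> \<beta> x =
     {(i, k). - rate \<alpha> \<beta> i k = decay_rate P \<alpha> \<beta> x \<and> pair_coeff P x i k \<noteq> 0}"

definition time_scale :: "real \<Rightarrow> real \<Rightarrow> real" where
  "time_scale q \<epsilon> = (1 / q) * ln (1 / \<epsilon>)"

end

theory Submission
  imports Defs "HOL-Real_Asymp.Real_Asymp"
begin

text \<open>
  Every component \<open>Y\<close> of \<open>P X\<close> solves a scalar equation \<open>dY = a Y dt + \<Sum>\<^sub>j b\<^sub>j Y \<circ> dW\<^sub>j\<close>, so that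
  \<open>Y\<^sub>t = y exp (a t + \<Sum>\<^sub>j b\<^sub>j W\<^sub>j(t))\<close>. Gaussian moments then turn \<open>\<parallel>X\<^sub>t\<parallel>\<^sup>2\<close> into a finite sum of complex
  exponentials in \<open>t\<close>. After multiplication by \<open>exp (q t)\<close> only the leading pairs survive, as a
  bounded oscillation whose lower and upper limits along \<open>t\<^sub>\<epsilon> + r w\<^sub>\<epsilon>\<close> do not depend on \<open>r\<close>; any value
  of modulus at most twice the sum of the moduli of the coefficients is realized by suitable phases.
  The lower limit is positive because \<open>\<parallel>X\<parallel> \<ge> c \<bar>(P X)\<^sub>i\<bar>\<close> and the slowest rate is attained on the
  diagonal: \<open>2 R\<^sub>i\<^sub>k \<le> R\<^sub>i\<^sub>i + R\<^sub>k\<^sub>k\<close>.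

  The explicit formula for \<open>Y\<close> is obtained without stochastic calculus, from the convergence of the
  trapezoidal sums alone. Along a uniform grid, \<open>Y\<close> satisfies the trapezoidal recursion up to
  defects \<open>\<rho>\<^sub>i\<close>. As convergence holds along all partitions, sums of defects over arbitrary subsets of
  the grid are uniformly small in probability (Henstock's lemma); averaging over random signs gives
  \<open>\<Sum> \<bar>\<rho>\<^sub>i\<bar>\<^sup>2 \<rightarrow> 0\<close>. Multiplying by the inverse flow \<open>exp (- a t - \<Sum>\<^sub>j b\<^sub>j W\<^sub>j(t))\<close> and summing by parts leaves
  sums of defects against its increments: a martingale part, small by the isometry for adapted
  sums, and a quadratic part, small by the Cauchy-Schwarz inequality.
\<close>

section \<open>Convergence and boundedness in probability\<close>

text \<open>The sums defining the integral converge in probability without any rate, so no single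
  defect can be estimated by itself. Increments of the inverse flow are of the order of the square
  root of the step; pairing them with defects needs
  \<open>\<Sum> \<bar>\<rho>\<^sub>i\<bar>\<^sup>2 \<rightarrow> 0\<close>, while their own square
  sum is merely tight. The partial sums of defects are adapted and small in probability at each grid
  point, uniformly in the point, but for their maximum only tightness is at hand. Tightness allows
  truncation, and after it the isometry asks for no more than the pointwise smallness. No Ito
  correction appears because the trapezoidal rule fits the exponential up to third order, and a sum
  of cubes of increments is at most the largest increment times the sum of squares. In the final
  formula the sum over pairs i \<le> k with the factor 2 counts the diagonal twice. The phases are
  therefore not read off from the oscillation: they are fitted to the two limits once these are
  known to lie in the attainable range.\<close>

context prob_space
begin

text \<open>Convergence to 0 in probability. Measurability is part of the notion, so that the
  closure rules carry it along.\<close>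

definition vanishes_in_prob :: "(nat \<Rightarrow> 'a \<Rightarrow> real) \<Rightarrow> bool" where
  "vanishes_in_prob f \<longleftrightarrow> (\<forall>k. f k \<in> borel_measurable M) \<and>
     (\<forall>\<eta>>0. (\<lambda>k. prob {\<omega>\<in>space M. \<eta> \<le> \<bar>f k \<omega>\<bar>}) \<longlonglongrightarrow> 0)"

text \<open>Tightness. The bound is asked for only eventually in k, and K may have any sign;
  \<open>bounded_in_prob_common\<close> supplies a positive one.\<close>

definition bounded_in_prob :: "(nat \<Rightarrow> 'a \<Rightarrow> real) \<Rightarrow> bool" where
  "bounded_in_prob f \<longleftrightarrow> (\<forall>k. f k \<in> borel_measurable M) \<and>
     (\<forall>\<epsilon>>0. \<exists>K. \<forall>\<^sub>F k in sequentially. prob {\<omega>\<in>space M. K \<le> \<bar>f k \<omega>\<bar>} \<le> \<epsilon>)"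

lemma vanishes_in_prob_measurable: "vanishes_in_prob f \<Longrightarrow> f k \<in> borel_measurable M"
  by (simp add: vanishes_in_prob_def)

lemma bounded_in_prob_measurable: "bounded_in_prob f \<Longrightarrow> f k \<in> borel_measurable M"
  by (simp add: bounded_in_prob_def)

lemma vanishes_in_probI:
  assumes "\<And>k. f k \<in> borel_measurable M"
    and "\<And>\<eta> \<epsilon>. 0 < \<eta> \<Longrightarrow> 0 < \<epsilon> \<Longrightarrow>
      \<forall>\<^sub>F k in sequentially. prob {\<omega>\<in>space M. \<eta> \<le> \<bar>f k \<omega>\<bar>} \<le> \<epsilon>"
  shows "vanishes_in_prob f"
  unfolding vanishes_in_prob_def
proof (intro conjI allI impI)
  fix \<eta> :: real assume \<eta>: "0 < \<eta>"
  show "(\<lambda>k. prob {\<omega>\<in>space M. \<eta> \<le> \<bar>f k \<omega>\<bar>}) \<longlonglongrightarrow> 0"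
  proof (rule tendstoI)
    fix e :: real assume "0 < e"
    with assms(2)[OF \<eta>, of "e / 2"]
    have "\<forall>\<^sub>F k in sequentially. prob {\<omega>\<in>space M. \<eta> \<le> \<bar>f k \<omega>\<bar>} \<le> e / 2" by simp
    then show "\<forall>\<^sub>F k in sequentially. dist (prob {\<omega>\<in>space M. \<eta> \<le> \<bar>f k \<omega>\<bar>}) 0 < e"
      by eventually_elim (use \<open>0 < e\<close> in auto)
  qed
qed (use assms(1) in auto)

lemma vanishes_in_probD:
  assumes "vanishes_in_prob f" "0 < \<eta>" "0 < \<epsilon>"
  shows "\<forall>\<^sub>F k in sequentially. prob {\<omega>\<in>space M. \<eta> \<le> \<bar>f k \<omega>\<bar>} \<le> \<epsilon>"
proof -
  have "(\<lambda>k. prob {\<omega>\<in>space M. \<eta> \<le> \<bar>f k \<omega>\<bar>}) \<longlonglongrightarrow> 0"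
    using assms by (simp add: vanishes_in_prob_def)
  from order_tendstoD(2)[OF this \<open>0 < \<epsilon>\<close>] show ?thesis
    by eventually_elim simp
qed

text \<open>Monotonicity of the measure asks for measurability of the larger set alone, so this
  union bound spares a proof that A is an event.\<close>

lemma prob_subset_Un_le:
  assumes "A \<subseteq> B \<union> C" "B \<in> events" "C \<in> events" "prob B \<le> b" "prob C \<le> c"
  shows "prob A \<le> b + c"
proof -
  have "prob A \<le> prob (B \<union> C)" using assms by (intro finite_measure_mono) auto
  also have "\<dots> \<le> prob B + prob C" using assms by (intro measure_Un_le) auto
  finally show ?thesis using assms by simp
qed

text \<open>Meant for estimates that hold only on an event of probability tending to 1: the Taylor
  bounds below need increments of size at most 1, and d will be the largest increment.\<close>

lemma vanishes_in_prob_mono_on: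
  assumes g: "vanishes_in_prob g" and d: "vanishes_in_prob d"
    and f: "\<And>k. f k \<in> borel_measurable M"
    and le: "\<And>k \<omega>. \<omega> \<in> space M \<Longrightarrow> \<bar>d k \<omega>\<bar> < 1 \<Longrightarrow> \<bar>f k \<omega>\<bar> \<le> \<bar>g k \<omega>\<bar>"
  shows "vanishes_in_prob f"
proof (rule vanishes_in_probI[OF f])
  fix \<eta> \<epsilon> :: real assume e: "0 < \<eta>" "0 < \<epsilon>"
  note [measurable] = vanishes_in_prob_measurable[OF g] vanishes_in_prob_measurable[OF d]
  have "0 < \<epsilon> / 2" using e by simp
  from vanishes_in_probD[OF g e(1) this] vanishes_in_probD[OF d zero_less_one this]
  show "\<forall>\<^sub>F k in sequentially. prob {\<omega> \<in> space M. \<eta> \<le> \<bar>f k \<omega>\<bar>} \<le> \<epsilon>"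
  proof eventually_elim
    case (elim k)
    have "{\<omega> \<in> space M. \<eta> \<le> \<bar>f k \<omega>\<bar>} \<subseteq> {\<omega> \<in> space M. \<eta> \<le> \<bar>g k \<omega>\<bar>} \<union> {\<omega> \<in> space M. 1 \<le> \<bar>d k \<omega>\<bar>}"
      using le[of _ k] by force
    from prob_subset_Un_le[OF this _ _ elim] show ?case by simp
  qed
qed

lemma vanishes_in_prob_zero: "vanishes_in_prob (\<lambda>k \<omega>. 0)"
  by (rule vanishes_in_probI) auto

lemma vanishes_in_prob_mono:
  assumes "vanishes_in_prob g" "\<And>k. f k \<in> borel_measurable M"
    and "\<And>k \<omega>. \<omega> \<in> space M \<Longrightarrow> \<bar>f k \<omega>\<bar> \<le> \<bar>g k \<omega>\<bar>"
  shows "vanishes_in_prob f"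
  using vanishes_in_prob_mono_on[OF assms(1) vanishes_in_prob_zero assms(2)] assms(3) by auto

lemma vanishes_in_prob_add:
  assumes f: "vanishes_in_prob f" and g: "vanishes_in_prob g"
  shows "vanishes_in_prob (\<lambda>k \<omega>. f k \<omega> + g k \<omega>)"
proof (rule vanishes_in_probI)
  note [measurable] = vanishes_in_prob_measurable[OF f] vanishes_in_prob_measurable[OF g]
  show "(\<lambda>\<omega>. f k \<omega> + g k \<omega>) \<in> borel_measurable M" for k by measurable
  fix \<eta> \<epsilon> :: real assume "0 < \<eta>" "0 < \<epsilon>"
  then have e: "0 < \<eta> / 2" "0 < \<epsilon> / 2" by auto
  from vanishes_in_probD[OF f e] vanishes_in_probD[OF g e]
  show "\<forall>\<^sub>F k in sequentially. prob {\<omega> \<in> space M. \<eta> \<le> \<bar>f k \<omega> + g k \<omega>\<bar>} \<le> \<epsilon>"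
  proof eventually_elim
    case (elim k)
    have "{\<omega> \<in> space M. \<eta> \<le> \<bar>f k \<omega> + g k \<omega>\<bar>} \<subseteq>
        {\<omega> \<in> space M. \<eta> / 2 \<le> \<bar>f k \<omega>\<bar>} \<union> {\<omega> \<in> space M. \<eta> / 2 \<le> \<bar>g k \<omega>\<bar>}"
      by auto
    from prob_subset_Un_le[OF this _ _ elim] show ?case by simp
  qed
qed

lemma vanishes_in_prob_sum:
  "finite I \<Longrightarrow> (\<And>i. i \<in> I \<Longrightarrow> vanishes_in_prob (f i)) \<Longrightarrow>
   vanishes_in_prob (\<lambda>k \<omega>. \<Sum>i\<in>I. f i k \<omega>)"
  by (induction I rule: finite_induct) (auto intro: vanishes_in_prob_zero vanishes_in_prob_add)

lemma bounded_in_prob_vanishes: "vanishes_in_prob f \<Longrightarrow> bounded_in_prob f"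
  unfolding bounded_in_prob_def
  using vanishes_in_probD[of f 1] by (auto simp: vanishes_in_prob_def intro!: exI[of _ 1])

lemma bounded_in_prob_mono:
  assumes g: "bounded_in_prob g" and f: "\<And>k. f k \<in> borel_measurable M"
    and le: "\<And>k \<omega>. \<omega> \<in> space M \<Longrightarrow> \<bar>f k \<omega>\<bar> \<le> \<bar>g k \<omega>\<bar>"
  shows "bounded_in_prob f"
  unfolding bounded_in_prob_def
proof (intro conjI allI impI)
  note [measurable] = bounded_in_prob_measurable[OF g]
  fix \<epsilon> :: real assume "0 < \<epsilon>"
  then obtain K where "\<forall>\<^sub>F k in sequentially. prob {\<omega>\<in>space M. K \<le> \<bar>g k \<omega>\<bar>} \<le> \<epsilon>"
    using g by (auto simp: bounded_in_prob_def)
  then have "\<forall>\<^sub>F k in sequentially. prob {\<omega>\<in>space M. K \<le> \<bar>f k \<omega>\<bar>} \<le> \<epsilon>"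
  proof eventually_elim
    case (elim k)
    have "prob {\<omega>\<in>space M. K \<le> \<bar>f k \<omega>\<bar>} \<le> prob {\<omega>\<in>space M. K \<le> \<bar>g k \<omega>\<bar>}"
      using le[of _ k] by (intro finite_measure_mono) (force, simp)
    with elim show ?case by simp
  qed
  then show "\<exists>K. \<forall>\<^sub>F k in sequentially. prob {\<omega>\<in>space M. K \<le> \<bar>f k \<omega>\<bar>} \<le> \<epsilon>" ..
qed (use f in auto)

text \<open>Also applied with f = g, just to obtain a positive bound.\<close>

lemma bounded_in_prob_common:
  assumes f: "bounded_in_prob f" and g: "bounded_in_prob g" and "0 < \<epsilon>"
  obtains K where "0 < K" "\<forall>\<^sub>F k in sequentially.
    prob ({\<omega>\<in>space M. K \<le> \<bar>f k \<omega>\<bar>} \<union> {\<omega>\<in>space M. K \<le> \<bar>g k \<omega>\<bar>}) \<le> \<epsilon>"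
proof -
  note [measurable] = bounded_in_prob_measurable[OF f] bounded_in_prob_measurable[OF g]
  have e: "0 < \<epsilon> / 2" using \<open>0 < \<epsilon>\<close> by simp
  obtain K1 where K1: "\<forall>\<^sub>F k in sequentially. prob {\<omega>\<in>space M. K1 \<le> \<bar>f k \<omega>\<bar>} \<le> \<epsilon> / 2"
    using f e unfolding bounded_in_prob_def by blast
  obtain K2 where K2: "\<forall>\<^sub>F k in sequentially. prob {\<omega>\<in>space M. K2 \<le> \<bar>g k \<omega>\<bar>} \<le> \<epsilon> / 2"
    using g e unfolding bounded_in_prob_def by blast
  define K where "K = max 1 (max K1 K2)"
  from K1 K2 have "\<forall>\<^sub>F k in sequentially.
    prob ({\<omega>\<in>space M. K \<le> \<bar>f k \<omega>\<bar>} \<union> {\<omega>\<in>space M. K \<le> \<bar>g k \<omega>\<bar>}) \<le> \<epsilon>"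
  proof eventually_elim
    case (elim k)
    have "{\<omega>\<in>space M. K \<le> \<bar>f k \<omega>\<bar>} \<union> {\<omega>\<in>space M. K \<le> \<bar>g k \<omega>\<bar>} \<subseteq>
        {\<omega>\<in>space M. K1 \<le> \<bar>f k \<omega>\<bar>} \<union> {\<omega>\<in>space M. K2 \<le> \<bar>g k \<omega>\<bar>}"
      by (auto simp: K_def)
    from prob_subset_Un_le[OF this _ _ elim] show ?case by simp
  qed
  moreover have "0 < K" by (simp add: K_def)
  ultimately show thesis by (rule that[rotated])
qed

lemma bounded_in_prob_add:
  assumes f: "bounded_in_prob f" and g: "bounded_in_prob g"
  shows "bounded_in_prob (\<lambda>k \<omega>. f k \<omega> + g k \<omega>)"
  unfolding bounded_in_prob_def
proof (intro conjI allI impI)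
  note [measurable] = bounded_in_prob_measurable[OF f] bounded_in_prob_measurable[OF g]
  show "(\<lambda>\<omega>. f k \<omega> + g k \<omega>) \<in> borel_measurable M" for k by measurable
  fix \<epsilon> :: real assume "0 < \<epsilon>"
  from bounded_in_prob_common[OF f g this] obtain K where "0 < K"
    and K: "\<forall>\<^sub>F k in sequentially.
    prob ({\<omega>\<in>space M. K \<le> \<bar>f k \<omega>\<bar>} \<union> {\<omega>\<in>space M. K \<le> \<bar>g k \<omega>\<bar>}) \<le> \<epsilon>" .
  from K have "\<forall>\<^sub>F k in sequentially. prob {\<omega>\<in>space M. 2 * K \<le> \<bar>f k \<omega> + g k \<omega>\<bar>} \<le> \<epsilon>"
  proof eventually_elim
    case (elim k)
    have "prob {\<omega>\<in>space M. 2 * K \<le> \<bar>f k \<omega> + g k \<omega>\<bar>} \<le>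
        prob ({\<omega>\<in>space M. K \<le> \<bar>f k \<omega>\<bar>} \<union> {\<omega>\<in>space M. K \<le> \<bar>g k \<omega>\<bar>})"
      by (intro finite_measure_mono) (auto, measurable)
    with elim show ?case by simp
  qed
  then show "\<exists>K. \<forall>\<^sub>F k in sequentially. prob {\<omega>\<in>space M. K \<le> \<bar>f k \<omega> + g k \<omega>\<bar>} \<le> \<epsilon>" ..
qed

lemma bounded_in_prob_mult:
  assumes f: "bounded_in_prob f" and g: "bounded_in_prob g"
  shows "bounded_in_prob (\<lambda>k \<omega>. f k \<omega> * g k \<omega>)"
  unfolding bounded_in_prob_def
proof (intro conjI allI impI)
  note [measurable] = bounded_in_prob_measurable[OF f] bounded_in_prob_measurable[OF g]
  show "(\<lambda>\<omega>. f k \<omega> * g k \<omega>) \<in> borel_measurable M" for k by measurable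
  fix \<epsilon> :: real assume "0 < \<epsilon>"
  from bounded_in_prob_common[OF f g this] obtain K where "0 < K"
    and K: "\<forall>\<^sub>F k in sequentially.
    prob ({\<omega>\<in>space M. K \<le> \<bar>f k \<omega>\<bar>} \<union> {\<omega>\<in>space M. K \<le> \<bar>g k \<omega>\<bar>}) \<le> \<epsilon>" .
  from K have "\<forall>\<^sub>F k in sequentially. prob {\<omega>\<in>space M. K * K \<le> \<bar>f k \<omega> * g k \<omega>\<bar>} \<le> \<epsilon>"
  proof eventually_elim
    case (elim k)
    have "K \<le> \<bar>f k \<omega>\<bar> \<or> K \<le> \<bar>g k \<omega>\<bar>" if "K * K \<le> \<bar>f k \<omega> * g k \<omega>\<bar>" for \<omega>
      using that mult_strict_mono[of "\<bar>f k \<omega>\<bar>" K "\<bar>g k \<omega>\<bar>" K] \<open>0 < K\<close>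
      by (auto simp: abs_mult not_le intro: ccontr)
    then have "prob {\<omega>\<in>space M. K * K \<le> \<bar>f k \<omega> * g k \<omega>\<bar>} \<le>
        prob ({\<omega>\<in>space M. K \<le> \<bar>f k \<omega>\<bar>} \<union> {\<omega>\<in>space M. K \<le> \<bar>g k \<omega>\<bar>})"
      by (intro finite_measure_mono) (auto, measurable)
    with elim show ?case by simp
  qed
  then show "\<exists>K. \<forall>\<^sub>F k in sequentially. prob {\<omega>\<in>space M. K \<le> \<bar>f k \<omega> * g k \<omega>\<bar>} \<le> \<epsilon>" ..
qed

lemma vanishes_in_prob_mult:
  assumes f: "vanishes_in_prob f" and g: "bounded_in_prob g"
  shows "vanishes_in_prob (\<lambda>k \<omega>. f k \<omega> * g k \<omega>)"
proof (rule vanishes_in_probI)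
  note [measurable] = vanishes_in_prob_measurable[OF f] bounded_in_prob_measurable[OF g]
  show "(\<lambda>\<omega>. f k \<omega> * g k \<omega>) \<in> borel_measurable M" for k by measurable
  fix \<eta> \<epsilon> :: real assume "0 < \<eta>" "0 < \<epsilon>"
  then have e: "0 < \<epsilon> / 2" by auto
  from bounded_in_prob_common[OF g g this] obtain K where K: "0 < K" "\<forall>\<^sub>F k in sequentially.
    prob {\<omega>\<in>space M. K \<le> \<bar>g k \<omega>\<bar>} \<le> \<epsilon> / 2" by auto
  have "0 < \<eta> / K" using \<open>0 < \<eta>\<close> K by simp
  from vanishes_in_probD[OF f this e] K(2)
  show "\<forall>\<^sub>F k in sequentially. prob {\<omega> \<in> space M. \<eta> \<le> \<bar>f k \<omega> * g k \<omega>\<bar>} \<le> \<epsilon>"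
  proof eventually_elim
    case (elim k)
    have "\<eta> / K \<le> \<bar>f k \<omega>\<bar> \<or> K \<le> \<bar>g k \<omega>\<bar>" if "\<eta> \<le> \<bar>f k \<omega> * g k \<omega>\<bar>" for \<omega>
    proof (rule ccontr)
      assume "\<not> ?thesis"
      then have "\<bar>f k \<omega>\<bar> * \<bar>g k \<omega>\<bar> < \<eta> / K * K"
        by (intro mult_strict_mono) (use \<open>0 < K\<close> \<open>0 < \<eta> / K\<close> in auto)
      with that \<open>0 < K\<close> show False by (simp add: abs_mult)
    qed
    then have "{\<omega> \<in> space M. \<eta> \<le> \<bar>f k \<omega> * g k \<omega>\<bar>} \<subseteq>
        {\<omega> \<in> space M. \<eta> / K \<le> \<bar>f k \<omega>\<bar>} \<union> {\<omega> \<in> space M. K \<le> \<bar>g k \<omega>\<bar>}"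
      by auto
    from prob_subset_Un_le[OF this _ _ elim] show ?case by simp
  qed
qed

lemma bounded_in_prob_fixed:
  assumes [measurable]: "X \<in> borel_measurable M"
  shows "bounded_in_prob (\<lambda>k. X)"
  unfolding bounded_in_prob_def
proof (intro conjI allI impI)
  fix \<epsilon> :: real assume "0 < \<epsilon>"
  have "(\<lambda>n. prob {\<omega>\<in>space M. real n \<le> \<bar>X \<omega>\<bar>}) \<longlonglongrightarrow> prob (\<Inter>n. {\<omega>\<in>space M. real n \<le> \<bar>X \<omega>\<bar>})"
    by (rule finite_Lim_measure_decseq) (auto simp: decseq_def)
  moreover have "(\<Inter>n. {\<omega>\<in>space M. real n \<le> \<bar>X \<omega>\<bar>}) = {}"
    by (auto simp: not_le) (meson reals_Archimedean2 not_le)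
  ultimately have "(\<lambda>n. prob {\<omega>\<in>space M. real n \<le> \<bar>X \<omega>\<bar>}) \<longlonglongrightarrow> 0" by simp
  from order_tendstoD(2)[OF this \<open>0 < \<epsilon>\<close>] obtain n where
    "prob {\<omega>\<in>space M. real n \<le> \<bar>X \<omega>\<bar>} < \<epsilon>"
    by (auto simp: eventually_sequentially)
  then show "\<exists>K. \<forall>\<^sub>F k in sequentially. prob {\<omega> \<in> space M. K \<le> \<bar>X \<omega>\<bar>} \<le> \<epsilon>"
    by (intro exI[of _ "real n"]) auto
qed simp

text \<open>The bound B may depend on \<omega>: the events that some member of the sequence reaches
  n decrease to a null set.\<close>

lemma bounded_in_prob_AE:
  assumes [measurable]: "\<And>k. f k \<in> borel_measurable M"
    and AE: "AE \<omega> in M. \<exists>B. \<forall>k. \<bar>f k \<omega>\<bar> \<le> B"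
  shows "bounded_in_prob f"
  unfolding bounded_in_prob_def
proof (intro conjI allI impI)
  fix \<epsilon> :: real assume "0 < \<epsilon>"
  define A where "A n = {\<omega>\<in>space M. \<exists>k. real n \<le> \<bar>f k \<omega>\<bar>}" for n
  have A[measurable]: "A n \<in> events" for n unfolding A_def by measurable
  have "(\<lambda>n. prob (A n)) \<longlonglongrightarrow> prob (\<Inter>n. A n)"
  proof (rule finite_Lim_measure_decseq)
    show "decseq A" by (fastforce simp: decseq_def A_def intro: order_trans[rotated])
  qed (use A in auto)
  moreover have "prob (\<Inter>n. A n) = 0"
  proof -
    have "AE \<omega> in M. \<omega> \<notin> (\<Inter>n. A n)"
      using AE
    proof eventually_elim
      case (elim \<omega>)
      then obtain B where "\<forall>k. \<bar>f k \<omega>\<bar> \<le> B" by blast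
      moreover obtain n where "B < real n" using reals_Archimedean2 by blast
      ultimately have "\<omega> \<notin> A n" by (auto simp: A_def not_le intro: le_less_trans)
      then show ?case by blast
    qed
    then show ?thesis by (subst prob_eq_0) auto
  qed
  ultimately have "(\<lambda>n. prob (A n)) \<longlonglongrightarrow> 0" by simp
  from order_tendstoD(2)[OF this \<open>0 < \<epsilon>\<close>] obtain n where n: "prob (A n) < \<epsilon>"
    by (auto simp: eventually_sequentially)
  have "prob {\<omega> \<in> space M. real n \<le> \<bar>f k \<omega>\<bar>} \<le> \<epsilon>" for k
  proof -
    have "prob {\<omega> \<in> space M. real n \<le> \<bar>f k \<omega>\<bar>} \<le> prob (A n)"
      by (intro finite_measure_mono) (auto simp: A_def)
    with n show ?thesis by simp
  qed
  then show "\<exists>K. \<forall>\<^sub>F k in sequentially. prob {\<omega> \<in> space M. K \<le> \<bar>f k \<omega>\<bar>} \<le> \<epsilon>"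
    by (intro exI[of _ "real n"]) auto
qed simp

text \<open>Dominated convergence for the indicators of the exceptional sets.\<close>

lemma vanishes_in_prob_AE:
  assumes [measurable]: "\<And>k. f k \<in> borel_measurable M"
    and AE: "AE \<omega> in M. (\<lambda>k. f k \<omega>) \<longlonglongrightarrow> 0"
  shows "vanishes_in_prob f"
  unfolding vanishes_in_prob_def
proof (intro conjI allI impI)
  fix \<eta> :: real assume "0 < \<eta>"
  let ?A = "\<lambda>k. {\<omega>\<in>space M. \<eta> \<le> \<bar>f k \<omega>\<bar>}"
  have "(\<lambda>k. \<integral>\<omega>. indicator (?A k) \<omega> \<partial>M) \<longlonglongrightarrow> (\<integral>\<omega>. (0::real) \<partial>M)"
  proof (rule integral_dominated_convergence[where w = "\<lambda>_. 1"])
    show "AE \<omega> in M. (\<lambda>k. indicator (?A k) \<omega> :: real) \<longlonglongrightarrow> 0"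
      using AE
    proof eventually_elim
      case (elim \<omega>)
      have "\<forall>\<^sub>F k in sequentially. \<bar>f k \<omega>\<bar> < \<eta>"
        using tendstoD[OF elim \<open>0 < \<eta>\<close>] by (simp add: dist_real_def)
      then have "\<forall>\<^sub>F k in sequentially. indicator (?A k) \<omega> = (0::real)"
        by eventually_elim (auto simp: indicator_def)
      then show ?case by (rule tendsto_eventually)
    qed
  qed (auto simp: indicator_def)
  then show "(\<lambda>k. prob (?A k)) \<longlonglongrightarrow> 0" by simp
qed simp

lemma vanishes_in_prob_expectation:
  assumes int: "\<And>k. integrable M (f k)" and nonneg: "\<And>k \<omega>. \<omega> \<in> space M \<Longrightarrow> 0 \<le> f k \<omega>"
    and lim: "(\<lambda>k. expectation (f k)) \<longlonglongrightarrow> 0"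
  shows "vanishes_in_prob f"
proof (rule vanishes_in_probI)
  fix \<eta> \<epsilon> :: real assume e: "0 < \<eta>" "0 < \<epsilon>"
  then have "0 < \<eta> * \<epsilon>" by simp
  from order_tendstoD(2)[OF lim this]
  show "\<forall>\<^sub>F k in sequentially. prob {\<omega> \<in> space M. \<eta> \<le> \<bar>f k \<omega>\<bar>} \<le> \<epsilon>"
  proof eventually_elim
    case (elim k)
    have "prob {\<omega> \<in> space M. \<eta> \<le> \<bar>f k \<omega>\<bar>} = prob {\<omega> \<in> space M. \<eta> \<le> f k \<omega>}"
      using nonneg by (intro arg_cong[of _ _ prob]) auto
    also have "\<dots> \<le> expectation (f k) / \<eta>"
      by (intro integral_Markov_inequality_measure[of _ _ "{}"]) (use int nonneg e in auto)
    also have "\<dots> \<le> \<epsilon>" using elim e by (simp add: field_simps)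
    finally show ?case .
  qed
qed (use int in auto)

lemma bounded_in_prob_expectation:
  assumes int: "\<And>k. integrable M (f k)" and nonneg: "\<And>k \<omega>. \<omega> \<in> space M \<Longrightarrow> 0 \<le> f k \<omega>"
    and bound: "\<And>k. expectation (f k) \<le> C"
  shows "bounded_in_prob f"
  unfolding bounded_in_prob_def
proof (intro conjI allI impI)
  fix \<epsilon> :: real assume e: "0 < \<epsilon>"
  \<comment> \<open>The level at which the Markov bound equals \<epsilon>; the added 1 keeps K
    positive when C is not.\<close>
  define K where "K = (max C 0 + 1) / \<epsilon>"
  have K: "0 < K" using e by (auto simp: K_def)
  have "prob {\<omega> \<in> space M. K \<le> \<bar>f k \<omega>\<bar>} \<le> \<epsilon>" for k
  proof -
    have "prob {\<omega> \<in> space M. K \<le> \<bar>f k \<omega>\<bar>} = prob {\<omega> \<in> space M. K \<le> f k \<omega>}"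
      using nonneg by (intro arg_cong[of _ _ prob]) auto
    also have "\<dots> \<le> expectation (f k) / K"
      by (intro integral_Markov_inequality_measure[of _ _ "{}"]) (use int nonneg K in auto)
    also have "\<dots> \<le> (max C 0 + 1) / K" using K bound[of k] by (intro divide_right_mono) auto
    also have "\<dots> = \<epsilon>" using e by (simp add: K_def)
    finally show ?thesis .
  qed
  then show "\<exists>K. \<forall>\<^sub>F k in sequentially. prob {\<omega> \<in> space M. K \<le> \<bar>f k \<omega>\<bar>} \<le> \<epsilon>"
    by (intro exI[of _ K] always_eventually allI)
qed (use int in auto)

lemma vanishes_in_prob_sqrt:
  assumes "vanishes_in_prob f"
  shows "vanishes_in_prob (\<lambda>k \<omega>. sqrt \<bar>f k \<omega>\<bar>)"
proof (rule vanishes_in_probI)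
  note [measurable] = vanishes_in_prob_measurable[OF assms]
  show "(\<lambda>\<omega>. sqrt \<bar>f k \<omega>\<bar>) \<in> borel_measurable M" for k by measurable
  fix \<eta> \<epsilon> :: real assume e: "0 < \<eta>" "0 < \<epsilon>"
  have "\<eta> \<le> \<bar>sqrt \<bar>f k \<omega>\<bar>\<bar> \<longleftrightarrow> \<eta>\<^sup>2 \<le> \<bar>f k \<omega>\<bar>" for k \<omega>
    using e by (simp add: real_le_rsqrt real_le_lsqrt) (metis abs_ge_zero real_le_rsqrt real_sqrt_abs real_sqrt_le_iff abs_of_pos)
  with vanishes_in_probD[OF assms, of "\<eta>\<^sup>2" \<epsilon>] e
  show "\<forall>\<^sub>F k in sequentially. prob {\<omega> \<in> space M. \<eta> \<le> \<bar>sqrt \<bar>f k \<omega>\<bar>\<bar>} \<le> \<epsilon>" by simp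
qed

lemma bounded_in_prob_sqrt:
  assumes "bounded_in_prob f"
  shows "bounded_in_prob (\<lambda>k \<omega>. sqrt \<bar>f k \<omega>\<bar>)"
proof (rule bounded_in_prob_mono)
  note [measurable] = bounded_in_prob_measurable[OF assms]
  show "(\<lambda>\<omega>. sqrt \<bar>f k \<omega>\<bar>) \<in> borel_measurable M" for k by measurable
  show "bounded_in_prob (\<lambda>k \<omega>. \<bar>f k \<omega>\<bar> + 1)"
    by (intro bounded_in_prob_add bounded_in_prob_fixed bounded_in_prob_mono[OF assms]) auto
  have "sqrt \<bar>a\<bar> \<le> \<bar>a\<bar> + 1" for a :: real
    by (rule real_le_lsqrt) (auto simp: power2_eq_square algebra_simps)
  then show "\<bar>sqrt \<bar>f k \<omega>\<bar>\<bar> \<le> \<bar>\<bar>f k \<omega>\<bar> + 1\<bar>" for k \<omega> by simp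
qed

text \<open>Localization: the replacement g may depend on \<epsilon>, as a truncation at an
  \<epsilon>-dependent level does.\<close>

lemma vanishes_in_prob_local:
  assumes [measurable]: "\<And>k. f k \<in> borel_measurable M"
    and local: "\<And>\<epsilon>. 0 < \<epsilon> \<Longrightarrow> \<exists>g. vanishes_in_prob g \<and>
      (\<forall>\<^sub>F k in sequentially. prob {\<omega>\<in>space M. f k \<omega> \<noteq> g k \<omega>} \<le> \<epsilon>)"
  shows "vanishes_in_prob f"
proof (rule vanishes_in_probI)
  fix \<eta> \<epsilon> :: real assume e: "0 < \<eta>" "0 < \<epsilon>"
  then have e2: "0 < \<epsilon> / 2" by simp
  from local[OF this] obtain g where g: "vanishes_in_prob g"
    and fg: "\<forall>\<^sub>F k in sequentially. prob {\<omega>\<in>space M. f k \<omega> \<noteq> g k \<omega>} \<le> \<epsilon> / 2" by blast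
  note [measurable] = vanishes_in_prob_measurable[OF g]
  from vanishes_in_probD[OF g e(1) e2] fg
  show "\<forall>\<^sub>F k in sequentially. prob {\<omega> \<in> space M. \<eta> \<le> \<bar>f k \<omega>\<bar>} \<le> \<epsilon>"
  proof eventually_elim
    case (elim k)
    have "{\<omega> \<in> space M. \<eta> \<le> \<bar>f k \<omega>\<bar>} \<subseteq>
        {\<omega> \<in> space M. \<eta> \<le> \<bar>g k \<omega>\<bar>} \<union> {\<omega>\<in>space M. f k \<omega> \<noteq> g k \<omega>}"
      by auto
    from prob_subset_Un_le[OF this _ _ elim] show ?case by simp
  qed
qed simp

text \<open>The exit from limits in probability: a random variable that is independent of k but
  bounded by a vanishing sequence must be 0 almost surely.\<close>

lemma vanishes_in_prob_fixed_imp_AE_zero: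
  assumes "vanishes_in_prob (\<lambda>k. X)"
  shows "AE \<omega> in M. X \<omega> = 0"
proof -
  note [measurable] = vanishes_in_prob_measurable[OF assms]
  have "AE \<omega> in M. \<not> inverse (real (Suc n)) \<le> \<bar>X \<omega>\<bar>" for n
  proof -
    have "(\<lambda>k::nat. prob {\<omega>\<in>space M. inverse (real (Suc n)) \<le> \<bar>X \<omega>\<bar>}) \<longlonglongrightarrow> 0"
      using assms by (simp add: vanishes_in_prob_def del: of_nat_Suc)
    then have "prob {\<omega>\<in>space M. inverse (real (Suc n)) \<le> \<bar>X \<omega>\<bar>} = 0"
      by (simp only: LIMSEQ_const_iff)
    then show ?thesis by (subst (asm) prob_Collect_eq_0) auto
  qed
  then have "AE \<omega> in M. \<forall>n. \<not> inverse (real (Suc n)) \<le> \<bar>X \<omega>\<bar>" by (simp add: AE_all_countable)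
  then show ?thesis
  proof eventually_elim
    case (elim \<omega>)
    show ?case
    proof (rule ccontr)
      assume "X \<omega> \<noteq> 0"
      then obtain n where "inverse (real (Suc n)) < \<bar>X \<omega>\<bar>" using reals_Archimedean[of "\<bar>X \<omega>\<bar>"] by auto
      with elim show False by (meson less_imp_le)
    qed
  qed
qed

end

section \<open>Discrete stochastic integrals against Brownian motion\<close>

definition incr :: "real \<Rightarrow> (real \<Rightarrow> 'a \<Rightarrow> real) \<Rightarrow> nat \<Rightarrow> 'a \<Rightarrow> real" where
  "incr h W i \<omega> = W (real (Suc i) * h) \<omega> - W (real i * h) \<omega>"

text \<open>Over the n + 1 indices up to n inclusive: the end point of a grid with n cells is
  covered and the maximum is never over the empty set.\<close>

definition running_max :: "nat \<Rightarrow> (nat \<Rightarrow> 'a \<Rightarrow> real) \<Rightarrow> 'a \<Rightarrow> real" where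
  "running_max n f \<omega> = Max ((\<lambda>i. \<bar>f i \<omega>\<bar>) ` {..n})"

lemma running_max_ge: "i \<le> n \<Longrightarrow> \<bar>f i \<omega>\<bar> \<le> running_max n f \<omega>"
  by (auto simp: running_max_def)

lemma running_max_nonneg: "0 \<le> running_max n f \<omega>"
  using running_max_ge[of 0 n f \<omega>] by simp

lemma running_max_le_iff: "running_max n f \<omega> \<le> K \<longleftrightarrow> (\<forall>i\<le>n. \<bar>f i \<omega>\<bar> \<le> K)"
  by (auto simp: running_max_def)

lemma running_max_less_iff: "running_max n f \<omega> < K \<longleftrightarrow> (\<forall>i\<le>n. \<bar>f i \<omega>\<bar> < K)"
  by (auto simp: running_max_def)

lemma running_max_measurable:
  "(\<And>i. i \<le> n \<Longrightarrow> f i \<in> borel_measurable M) \<Longrightarrow> running_max n f \<in> borel_measurable M"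
  unfolding running_max_def[abs_def] by (intro borel_measurable_Max borel_measurable_abs) auto

context usual_filtered_prob_space
begin

lemma measurable_F_mono:
  "f \<in> borel_measurable (F s) \<Longrightarrow> s \<le> t \<Longrightarrow> f \<in> borel_measurable (F t)"
  by (rule borel_measurable_subalgebra[OF sets_F_mono]) (auto simp: space_F)

lemma measurable_F_M: "f \<in> borel_measurable (F s) \<Longrightarrow> f \<in> borel_measurable M"
  by (rule borel_measurable_subalgebra[OF sets_F_subset]) (auto simp: space_F)

lemma brownian_motion_measurable:
  "brownian_motion M F W \<Longrightarrow> 0 \<le> s \<Longrightarrow> s \<le> t \<Longrightarrow> W s \<in> borel_measurable (F t)"
  by (rule measurable_F_mono[of _ s]) (auto simp: brownian_motion_def adapted_def)

text \<open>The \<sigma>-algebra generated by a lies in F s, from which the increment is independent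
  by definition.\<close>

lemma indep_increment:
  assumes W: "brownian_motion M F W" and st: "0 \<le> s" "s < t"
    and a: "a \<in> borel_measurable (F s)"
  shows "indep_var borel a borel (\<lambda>\<omega>. W t \<omega> - W s \<omega>)"
proof -
  let ?D = "\<lambda>\<omega>. W t \<omega> - W s \<omega>"
  have ind: "indep_set (sets (F s)) (sets (vimage_algebra (space M) ?D borel))"
    using W st by (auto simp: brownian_motion_def)
  have D: "?D \<in> borel_measurable M"
    using brownian_motion_measurable[OF W, of s s] brownian_motion_measurable[OF W, of t t] st
    by (auto intro!: borel_measurable_diff intro: measurable_F_M)
  have "sigma_sets (space M) {a -` A \<inter> space M |A. A \<in> sets borel} \<subseteq> sets (F s)"
    using measurable_sets[OF a] sets.sigma_sets_subset[of "{a -` A \<inter> space M |A. A \<in> sets borel}" "F s"]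
    by (auto simp: space_F)
  then show ?thesis
    using ind a D unfolding indep_var_eq
    by (auto simp: indep_sets2_eq sets_vimage_algebra intro: measurable_F_M)
qed

lemma increment_moments:
  assumes W: "brownian_motion M F W" and st: "0 \<le> s" "s < t"
  shows "integrable M (\<lambda>\<omega>. W t \<omega> - W s \<omega>)"
    "integrable M (\<lambda>\<omega>. (W t \<omega> - W s \<omega>)\<^sup>2)"
    "expectation (\<lambda>\<omega>. W t \<omega> - W s \<omega>) = 0"
    "expectation (\<lambda>\<omega>. (W t \<omega> - W s \<omega>)\<^sup>2) = t - s"
proof -
  let ?D = "\<lambda>\<omega>. W t \<omega> - W s \<omega>"
  have D: "distributed M lborel ?D (normal_density 0 (sqrt (t - s)))"
    using W st by (auto simp: brownian_motion_def)
  have \<sigma>: "0 < sqrt (t - s)" using st by simp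
  show "integrable M ?D"
    using distributed_integrable[OF D, of "\<lambda>x. x"] integrable_normal_moment[of "sqrt (t - s)" 0 1] st by simp
  show "integrable M (\<lambda>\<omega>. (?D \<omega>)\<^sup>2)"
    using distributed_integrable[OF D, of "\<lambda>x. x\<^sup>2"] integrable_normal_moment[of "sqrt (t - s)" 0 2] st by simp
  show E: "expectation ?D = 0" by (rule normal_distributed_expectation[OF \<sigma> D])
  show "expectation (\<lambda>\<omega>. (?D \<omega>)\<^sup>2) = t - s"
    using normal_distributed_variance[OF \<sigma> D] E st by simp
qed

text \<open>Martingale property and isometry for a single cell: independence factors the expectation
  and leaves the Gaussian moments 0 and t - s.\<close>

lemma increment_times_past:
  assumes W: "brownian_motion M F W" and st: "0 \<le> s" "s < t"
    and a: "a \<in> borel_measurable (F s)" "integrable M a"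
  shows "integrable M (\<lambda>\<omega>. a \<omega> * (W t \<omega> - W s \<omega>))"
    "expectation (\<lambda>\<omega>. a \<omega> * (W t \<omega> - W s \<omega>)) = 0"
    "integrable M (\<lambda>\<omega>. a \<omega> * (W t \<omega> - W s \<omega>)\<^sup>2)"
    "expectation (\<lambda>\<omega>. a \<omega> * (W t \<omega> - W s \<omega>)\<^sup>2) = (t - s) * expectation a"
proof -
  note mom = increment_moments[OF W st]
  have ind: "indep_var borel a borel (\<lambda>\<omega>. W t \<omega> - W s \<omega>)"
    by (rule indep_increment[OF W st a(1)])
  have ind2: "indep_var borel a borel (\<lambda>\<omega>. (W t \<omega> - W s \<omega>)\<^sup>2)"
    using indep_var_compose[OF ind, of "\<lambda>x. x" borel "\<lambda>x. x\<^sup>2" borel] by (simp add: comp_def)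
  show "integrable M (\<lambda>\<omega>. a \<omega> * (W t \<omega> - W s \<omega>))"
    by (rule indep_var_integrable[OF ind a(2) mom(1)])
  show "expectation (\<lambda>\<omega>. a \<omega> * (W t \<omega> - W s \<omega>)) = 0"
    by (subst indep_var_lebesgue_integral[OF ind a(2) mom(1)]) (simp add: mom)
  show "integrable M (\<lambda>\<omega>. a \<omega> * (W t \<omega> - W s \<omega>)\<^sup>2)"
    by (rule indep_var_integrable[OF ind2 a(2) mom(2)])
  show "expectation (\<lambda>\<omega>. a \<omega> * (W t \<omega> - W s \<omega>)\<^sup>2) = (t - s) * expectation a"
    by (subst indep_var_lebesgue_integral[OF ind2 a(2) mom(2)]) (simp add: mom)
qed

section \<open>Discrete integrals along one uniform grid\<close>

context
  fixes W :: "real \<Rightarrow> 'a \<Rightarrow> real" and h :: real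
  assumes W: "brownian_motion M F W" and h: "0 < h"
begin

lemma incr_measurable: "incr h W i \<in> borel_measurable (F (real (Suc i) * h))"
  unfolding incr_def[abs_def] using h
  by (intro borel_measurable_diff brownian_motion_measurable[OF W]) (auto simp: mult_right_mono)

lemma incr_times_past:
  assumes "a \<in> borel_measurable (F (real i * h))" "integrable M a"
  shows "integrable M (\<lambda>\<omega>. a \<omega> * incr h W i \<omega>)"
    "expectation (\<lambda>\<omega>. a \<omega> * incr h W i \<omega>) = 0"
    "integrable M (\<lambda>\<omega>. a \<omega> * (incr h W i \<omega>)\<^sup>2)"
    "expectation (\<lambda>\<omega>. a \<omega> * (incr h W i \<omega>)\<^sup>2) = h * expectation a"
proof -
  have st: "0 \<le> real i * h" "real i * h < real (Suc i) * h" using h by auto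
  have "real (Suc i) * h - real i * h = h" by (simp add: algebra_simps)
  with increment_times_past[OF W st assms]
  show "integrable M (\<lambda>\<omega>. a \<omega> * incr h W i \<omega>)"
    "expectation (\<lambda>\<omega>. a \<omega> * incr h W i \<omega>) = 0"
    "integrable M (\<lambda>\<omega>. a \<omega> * (incr h W i \<omega>)\<^sup>2)"
    "expectation (\<lambda>\<omega>. a \<omega> * (incr h W i \<omega>)\<^sup>2) = h * expectation a"
    unfolding incr_def by simp_all
qed

lemma transform_measurable:
  assumes "\<And>i. c i \<in> borel_measurable (F (real i * h))"
  shows "(\<lambda>\<omega>. \<Sum>i<n. c i \<omega> * incr h W i \<omega>) \<in> borel_measurable (F (real n * h))"
proof (intro borel_measurable_sum borel_measurable_times)
  fix i assume i: "i \<in> {..<n}"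
  show "c i \<in> borel_measurable (F (real n * h))"
    using i h by (intro measurable_F_mono[OF assms]) (auto intro!: mult_right_mono)
  show "incr h W i \<in> borel_measurable (F (real n * h))"
    using i h by (intro measurable_F_mono[OF incr_measurable]) (auto intro!: mult_right_mono)
qed

text \<open>Discrete Ito isometry. In the induction the square of the new sum has a cross term whose
  factor before the last increment depends on the past only, so its expectation is 0; the bound K
  makes that factor integrable.\<close>

lemma transform_isometry:
  assumes c: "\<And>i. c i \<in> borel_measurable (F (real i * h))"
    and K: "\<And>i \<omega>. \<omega> \<in> space M \<Longrightarrow> \<bar>c i \<omega>\<bar> \<le> K"
  shows "integrable M (\<lambda>\<omega>. (\<Sum>i<n. c i \<omega> * incr h W i \<omega>)\<^sup>2)"
    "expectation (\<lambda>\<omega>. (\<Sum>i<n. c i \<omega> * incr h W i \<omega>)\<^sup>2) = h * (\<Sum>i<n. expectation (\<lambda>\<omega>. (c i \<omega>)\<^sup>2))"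
proof (induction n)
  case (Suc n)
  let ?I = "\<lambda>\<omega>. \<Sum>i<n. c i \<omega> * incr h W i \<omega>" and ?D = "incr h W n"
  have K0: "0 \<le> K" if "\<omega> \<in> space M" for \<omega> using K[OF that, of 0] by linarith
  have cM[measurable]: "c i \<in> borel_measurable M" for i by (rule measurable_F_M[OF c])
  have IM[measurable]: "?I \<in> borel_measurable M" by (rule measurable_F_M[OF transform_measurable[OF c]])
  have Ic: "(\<lambda>\<omega>. 2 * ?I \<omega> * c n \<omega>) \<in> borel_measurable (F (real n * h))"
    using transform_measurable[OF c, of n] c[of n] by measurable
  \<comment> \<open>Square integrability of the old sum suffices, through
    \<open>2 * a \<le> 1 + a\<^sup>2\<close>.\<close>
  have Icint: "integrable M (\<lambda>\<omega>. 2 * ?I \<omega> * c n \<omega>)"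
  proof (rule Bochner_Integration.integrable_bound)
    show "integrable M (\<lambda>\<omega>. (1 + (?I \<omega>)\<^sup>2) * K)" using Suc.IH(1) by auto
    have ab: "2 * a \<le> 1 + a\<^sup>2" for a :: real
      using zero_le_power2[of "a - 1"] by (simp add: power2_diff)
    have "norm (2 * ?I \<omega> * c n \<omega>) \<le> norm ((1 + (?I \<omega>)\<^sup>2) * K)" if "\<omega> \<in> space M" for \<omega>
    proof -
      have "2 * \<bar>?I \<omega>\<bar> * \<bar>c n \<omega>\<bar> \<le> (1 + (?I \<omega>)\<^sup>2) * K"
        using ab[of "\<bar>?I \<omega>\<bar>"] K[OF that, of n] by (intro mult_mono) auto
      then show ?thesis using K0[OF that] by (simp add: abs_mult)
    qed
    then show "AE \<omega> in M. norm (2 * ?I \<omega> * c n \<omega>) \<le> norm ((1 + (?I \<omega>)\<^sup>2) * K)" by simp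
  qed measurable
  have c2: "(\<lambda>\<omega>. (c n \<omega>)\<^sup>2) \<in> borel_measurable (F (real n * h))" using c[of n] by measurable
  have c2int: "integrable M (\<lambda>\<omega>. (c n \<omega>)\<^sup>2)"
  proof (rule integrable_const_bound)
    have "norm ((c n \<omega>)\<^sup>2) \<le> K\<^sup>2" if "\<omega> \<in> space M" for \<omega>
      using power_mono[OF K[OF that, of n], of 2] by simp
    then show "AE \<omega> in M. norm ((c n \<omega>)\<^sup>2) \<le> K\<^sup>2" by simp
  qed measurable
  have eq: "(\<Sum>i<Suc n. c i \<omega> * incr h W i \<omega>)\<^sup>2 =
      (?I \<omega>)\<^sup>2 + 2 * ?I \<omega> * c n \<omega> * ?D \<omega> + (c n \<omega>)\<^sup>2 * (?D \<omega>)\<^sup>2" for \<omega>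
    by (simp add: power2_eq_square algebra_simps)
  note i1 = incr_times_past(1,2)[OF Ic Icint] and i2 = incr_times_past(3,4)[OF c2 c2int]
  show "integrable M (\<lambda>\<omega>. (\<Sum>i<Suc n. c i \<omega> * incr h W i \<omega>)\<^sup>2)"
    unfolding eq using Suc.IH(1) i1(1) i2(1) by (intro Bochner_Integration.integrable_add)
  show "expectation (\<lambda>\<omega>. (\<Sum>i<Suc n. c i \<omega> * incr h W i \<omega>)\<^sup>2) =
      h * (\<Sum>i<Suc n. expectation (\<lambda>\<omega>. (c i \<omega>)\<^sup>2))"
    unfolding eq using Suc.IH i1 i2 by (simp add: algebra_simps)
qed auto

text \<open>Doob's inequality by stopping: coefficients are switched off once a partial sum has
  reached \<kappa>. The stopped sum is again a transform with bounded adapted coefficients, so the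
  isometry and the Markov inequality apply to its square.\<close>

lemma transform_maximal:
  assumes c: "\<And>i. c i \<in> borel_measurable (F (real i * h))"
    and K: "\<And>i \<omega>. \<omega> \<in> space M \<Longrightarrow> \<bar>c i \<omega>\<bar> \<le> K" and \<kappa>: "0 < \<kappa>"
  shows "prob {\<omega>\<in>space M. \<kappa> \<le> running_max n (\<lambda>i \<omega>. \<Sum>m<i. c m \<omega> * incr h W m \<omega>) \<omega>}
    \<le> K\<^sup>2 * (real n * h) / \<kappa>\<^sup>2"
proof -
  let ?I = "\<lambda>i \<omega>. \<Sum>m<i. c m \<omega> * incr h W m \<omega>"
  \<comment> \<open>The partial sum with index m contains increments up to m - 1 only, so the
    decision to keep \<open>c m\<close> is known at the left end of cell m.\<close>
  define b where "b m \<omega> = (if \<forall>l\<le>m. \<bar>?I l \<omega>\<bar> < \<kappa> then c m \<omega> else 0)" for m \<omega>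
  let ?S = "\<lambda>\<omega>. \<Sum>m<n. b m \<omega> * incr h W m \<omega>"
  have b: "b m \<in> borel_measurable (F (real m * h))" for m
  proof -
    have [measurable]: "?I l \<in> borel_measurable (F (real m * h))" if "l \<in> {..m}" for l
      using that h by (intro measurable_F_mono[OF transform_measurable[OF c]]) (auto intro!: mult_right_mono)
    note c[measurable]
    have "b m = (\<lambda>\<omega>. if \<forall>l\<in>{..m}. \<bar>?I l \<omega>\<bar> < \<kappa> then c m \<omega> else 0)" by (auto simp: b_def)
    also have "\<dots> \<in> borel_measurable (F (real m * h))" by measurable
    finally show ?thesis .
  qed
  have bK: "\<bar>b m \<omega>\<bar> \<le> K" if "\<omega> \<in> space M" for m \<omega>
    using K[OF that, of m] by (auto simp: b_def)
  note iso = transform_isometry[of b K, OF b bK]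
  have stop: "\<kappa>\<^sup>2 \<le> (?S \<omega>)\<^sup>2" if "\<kappa> \<le> running_max n ?I \<omega>" for \<omega>
  proof -
    from that obtain i where i: "i \<le> n" "\<kappa> \<le> \<bar>?I i \<omega>\<bar>"
      using running_max_less_iff[of n ?I \<omega> \<kappa>] by (auto simp: not_less)
    \<comment> \<open>From the first passage on every coefficient is 0, which freezes the full sum
      at its value there.\<close>
    define \<tau> where "\<tau> = (LEAST i. \<kappa> \<le> \<bar>?I i \<omega>\<bar>)"
    have \<tau>: "\<kappa> \<le> \<bar>?I \<tau> \<omega>\<bar>" unfolding \<tau>_def by (rule LeastI[of _ i]) (rule i)
    have less: "\<bar>?I l \<omega>\<bar> < \<kappa>" if "l < \<tau>" for l
      using not_less_Least[of l "\<lambda>i. \<kappa> \<le> \<bar>?I i \<omega>\<bar>"] that unfolding \<tau>_def by simp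
    have "\<tau> \<le> n" using i Least_le[of "\<lambda>i. \<kappa> \<le> \<bar>?I i \<omega>\<bar>" i] unfolding \<tau>_def by simp
    then have "?S \<omega> = (\<Sum>m<\<tau>. b m \<omega> * incr h W m \<omega>) + (\<Sum>m\<in>{\<tau>..<n}. b m \<omega> * incr h W m \<omega>)"
      by (subst sum.union_disjoint[symmetric]) (auto intro!: sum.cong)
    also have "(\<Sum>m<\<tau>. b m \<omega> * incr h W m \<omega>) = ?I \<tau> \<omega>"
      using less by (intro sum.cong) (auto simp: b_def)
    also have "(\<Sum>m\<in>{\<tau>..<n}. b m \<omega> * incr h W m \<omega>) = 0"
    proof (intro sum.neutral ballI)
      fix m assume "m \<in> {\<tau>..<n}"
      then have "b m \<omega> = 0" using \<tau> by (auto simp: b_def not_less intro!: exI[of _ \<tau>])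
      then show "b m \<omega> * incr h W m \<omega> = 0" by simp
    qed
    finally have "\<kappa> \<le> \<bar>?S \<omega>\<bar>" using \<tau> by simp
    then show ?thesis using \<kappa> by (metis power2_abs power_mono less_imp_le)
  qed
  have bM[measurable]: "b m \<in> borel_measurable M" for m by (rule measurable_F_M[OF b])
  have DM[measurable]: "incr h W m \<in> borel_measurable M" for m by (rule measurable_F_M[OF incr_measurable])
  have "prob {\<omega>\<in>space M. \<kappa> \<le> running_max n ?I \<omega>} \<le> prob {\<omega>\<in>space M. \<kappa>\<^sup>2 \<le> (?S \<omega>)\<^sup>2}"
    using stop by (intro finite_measure_mono) auto
  also have "\<dots> \<le> expectation (\<lambda>\<omega>. (?S \<omega>)\<^sup>2) / \<kappa>\<^sup>2"
    by (intro integral_Markov_inequality_measure[of _ _ "{}"]) (use iso(1) \<kappa> in auto)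
  also have "expectation (\<lambda>\<omega>. (?S \<omega>)\<^sup>2) \<le> K\<^sup>2 * (real n * h)"
  proof -
    have "expectation (\<lambda>\<omega>. (b i \<omega>)\<^sup>2) \<le> K\<^sup>2" for i
    proof (rule integral_le_const)
      have "norm ((b i \<omega>)\<^sup>2) \<le> K\<^sup>2" if "\<omega> \<in> space M" for \<omega>
        using power_mono[OF bK[OF that, of i], of 2] by simp
      then show "integrable M (\<lambda>\<omega>. (b i \<omega>)\<^sup>2)" "AE x in M. (b i x)\<^sup>2 \<le> K\<^sup>2"
        by (auto intro!: integrable_const_bound[of _ "K\<^sup>2"])
    qed
    then have "h * (\<Sum>i<n. expectation (\<lambda>\<omega>. (b i \<omega>)\<^sup>2)) \<le> h * (\<Sum>i<n. K\<^sup>2)"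
      using h by (intro mult_left_mono sum_mono) auto
    then show ?thesis by (simp add: iso(2) algebra_simps)
  qed
  finally show ?thesis using \<kappa> by (simp add: divide_right_mono)
qed

end

section \<open>Discrete integrals along the grids of [0, T] with k + 1 cells, as k grows\<close>

context
  fixes W :: "real \<Rightarrow> 'a \<Rightarrow> real" and T :: real and c :: "nat \<Rightarrow> nat \<Rightarrow> 'a \<Rightarrow> real"
    and h :: "nat \<Rightarrow> real"
  assumes W: "brownian_motion M F W" and T: "0 < T"
    and c: "\<And>k i. c k i \<in> borel_measurable (F (real i * h k))"
    and cmax: "bounded_in_prob (\<lambda>k. running_max (Suc k) (c k))"
    and h_def: "h = (\<lambda>k. T / real (Suc k))"
begin

lemma step_pos: "0 < h k" using T by (simp add: h_def)

lemma step_total: "real (Suc k) * h k = T" by (simp add: h_def)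

lemma c_measurable_M: "c k i \<in> borel_measurable M"
  by (rule measurable_F_M[OF c])

lemma incr_measurable_M: "incr (h k) W i \<in> borel_measurable M"
  by (rule measurable_F_M[OF incr_measurable[OF W step_pos]])

text \<open>Each coefficient is cut off by its own value, which preserves adaptedness; by tightness
  of the maximum the cut is felt only with probability at most \<epsilon>.\<close>

lemma truncation:
  assumes "0 < \<epsilon>"
  obtains K where "0 < K"
    "\<forall>\<^sub>F k in sequentially. prob {\<omega>\<in>space M. K \<le> running_max (Suc k) (c k) \<omega>} \<le> \<epsilon>"
    "\<And>k i. (\<lambda>\<omega>. if \<bar>c k i \<omega>\<bar> \<le> K then c k i \<omega> else 0) \<in> borel_measurable (F (real i * h k))"
proof -
  from bounded_in_prob_common[OF cmax cmax assms] obtain K where K: "0 < K"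
    "\<forall>\<^sub>F k in sequentially. prob {\<omega>\<in>space M. K \<le> \<bar>running_max (Suc k) (c k) \<omega>\<bar>} \<le> \<epsilon>"
    by auto
  show thesis
  proof (rule that[OF K(1)])
    show "\<forall>\<^sub>F k in sequentially. prob {\<omega>\<in>space M. K \<le> running_max (Suc k) (c k) \<omega>} \<le> \<epsilon>"
      using K(2) by (simp add: running_max_nonneg)
    note c[measurable]
    show "(\<lambda>\<omega>. if \<bar>c k i \<omega>\<bar> \<le> K then c k i \<omega> else 0) \<in> borel_measurable (F (real i * h k))" for k i
      by measurable
  qed
qed

text \<open>The maximal inequality for the truncated coefficients. Its bound is free of k because
  the total time is always T, and \<kappa> is the level at which it equals half of
  \<epsilon>.\<close>

lemma transform_max_bounded:
  "bounded_in_prob (\<lambda>k. running_max (Suc k) (\<lambda>i \<omega>. \<Sum>m<i. c k m \<omega> * incr (h k) W m \<omega>))"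
  unfolding bounded_in_prob_def
proof (intro conjI allI impI)
  note [measurable] = c_measurable_M incr_measurable_M
  show "running_max (Suc k) (\<lambda>i \<omega>. \<Sum>m<i. c k m \<omega> * incr (h k) W m \<omega>) \<in> borel_measurable M" for k
    by (rule running_max_measurable) measurable
  fix \<epsilon> :: real assume "0 < \<epsilon>"
  then have "0 < \<epsilon> / 2" by simp
  from truncation[OF this] obtain K where K: "0 < K"
    "\<forall>\<^sub>F k in sequentially. prob {\<omega>\<in>space M. K \<le> running_max (Suc k) (c k) \<omega>} \<le> \<epsilon> / 2"
    "\<And>k i. (\<lambda>\<omega>. if \<bar>c k i \<omega>\<bar> \<le> K then c k i \<omega> else 0) \<in> borel_measurable (F (real i * h k))"
    by blast
  define c' where "c' k i \<omega> = (if \<bar>c k i \<omega>\<bar> \<le> K then c k i \<omega> else 0)" for k i \<omega>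
  have c': "c' k i \<in> borel_measurable (F (real i * h k))" for k i
    using K(3)[of k i] by (simp add: c'_def[abs_def])
  have c'M[measurable]: "c' k i \<in> borel_measurable M" for k i by (rule measurable_F_M[OF c'])
  have c'K: "\<bar>c' k i \<omega>\<bar> \<le> K" for k i \<omega> using K(1) by (auto simp: c'_def)
  define \<kappa> where "\<kappa> = K * sqrt (2 * T / \<epsilon>)"
  have \<kappa>: "0 < \<kappa>" using K(1) T \<open>0 < \<epsilon>\<close> by (simp add: \<kappa>_def)
  have \<kappa>2: "K\<^sup>2 * T / \<kappa>\<^sup>2 = \<epsilon> / 2"
    using K(1) T \<open>0 < \<epsilon>\<close> by (simp add: \<kappa>_def power_mult_distrib)
  let ?I = "\<lambda>c k i \<omega>. \<Sum>m<i. c k m \<omega> * incr (h k) W m \<omega> :: real"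
  from K(2) have "\<forall>\<^sub>F k in sequentially. prob {\<omega>\<in>space M. \<kappa> \<le> \<bar>running_max (Suc k) (?I c k) \<omega>\<bar>} \<le> \<epsilon>"
  proof eventually_elim
    case (elim k)
    have sub: "{\<omega>\<in>space M. \<kappa> \<le> \<bar>running_max (Suc k) (?I c k) \<omega>\<bar>} \<subseteq>
      {\<omega>\<in>space M. \<kappa> \<le> running_max (Suc k) (?I c' k) \<omega>} \<union>
      {\<omega>\<in>space M. K \<le> running_max (Suc k) (c k) \<omega>}"
    proof safe
      fix \<omega> assume \<omega>: "\<kappa> \<le> \<bar>running_max (Suc k) (?I c k) \<omega>\<bar>" "\<not> K \<le> running_max (Suc k) (c k) \<omega>"
      then have "\<bar>c k i \<omega>\<bar> < K" if "i \<le> Suc k" for i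
        using that by (auto simp: running_max_less_iff not_le)
      then have "?I c' k i \<omega> = ?I c k i \<omega>" if "i \<le> Suc k" for i
        using that by (intro sum.cong) (auto simp: c'_def dest!: less_imp_le intro!: less_imp_le)
      then have "running_max (Suc k) (?I c' k) \<omega> = running_max (Suc k) (?I c k) \<omega>"
        unfolding running_max_def by (intro arg_cong[of _ _ Max] image_cong) auto
      with \<omega> show "\<kappa> \<le> running_max (Suc k) (?I c' k) \<omega>" by (simp add: running_max_nonneg)
    qed
    have [measurable]: "running_max (Suc k) (?I c' k) \<in> borel_measurable M"
        "running_max (Suc k) (c k) \<in> borel_measurable M"
      by (intro running_max_measurable; measurable)+
    have "prob {\<omega>\<in>space M. \<kappa> \<le> running_max (Suc k) (?I c' k) \<omega>} \<le> \<epsilon> / 2"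
      using transform_maximal[OF W step_pos c' c'K \<kappa>, of "Suc k" k] \<kappa>2
      by (simp only: step_total)
    from prob_subset_Un_le[OF sub _ _ this elim] show ?case by simp
  qed
  then show "\<exists>K. \<forall>\<^sub>F k in sequentially. prob {\<omega>\<in>space M. K \<le> \<bar>running_max (Suc k) (?I c k) \<omega>\<bar>} \<le> \<epsilon>" ..
qed

context
  assumes c_vanish: "\<And>\<eta> \<epsilon>. 0 < \<eta> \<Longrightarrow> 0 < \<epsilon> \<Longrightarrow>
    \<forall>\<^sub>F k in sequentially. \<forall>i\<le>Suc k. prob {\<omega>\<in>space M. \<eta> \<le> \<bar>c k i \<omega>\<bar>} \<le> \<epsilon>"
begin

text \<open>The weights \<open>h k\<close> add up to T, so an average over indices of truncated
  moments has to vanish; each moment is split at size \<eta>, and the large part is at most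
  \<open>K ^ p\<close> times a small probability. Smallness at each index, uniformly in the index,
  is enough. The isometry uses p = 2, the quadratic sums use p = 1.\<close>

lemma truncated_moment_vanishes:
  assumes "0 < K" "0 < p"
  shows "(\<lambda>k. h k * (\<Sum>i<Suc k. expectation (\<lambda>\<omega>. \<bar>if \<bar>c k i \<omega>\<bar> \<le> K then c k i \<omega> else 0\<bar> ^ p))) \<longlonglongrightarrow> 0"
    (is "?s \<longlonglongrightarrow> 0")
proof (rule tendstoI)
  note [measurable] = c_measurable_M
  fix e :: real assume e: "0 < e"
  \<comment> \<open>The two contributions get at most a third of e each;
    \<open>\<eta> \<le> 1\<close> serves to replace \<open>\<eta> ^ p\<close> by \<eta>.\<close>
  define \<eta> where "\<eta> = min 1 (e / (3 * T))"
  define \<epsilon> where "\<epsilon> = e / (3 * T * K ^ p)"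
  have \<eta>: "0 < \<eta>" "\<eta> \<le> 1" "\<eta> * T \<le> e / 3" and \<epsilon>: "0 < \<epsilon>" "T * K ^ p * \<epsilon> = e / 3"
    using e T assms by (auto simp: \<eta>_def \<epsilon>_def min_def field_simps)
  from c_vanish[OF \<eta>(1) \<epsilon>(1)]
  show "\<forall>\<^sub>F k in sequentially. dist (?s k) 0 < e"
  proof eventually_elim
    case (elim k)
    let ?c = "\<lambda>i \<omega>. if \<bar>c k i \<omega>\<bar> \<le> K then c k i \<omega> else 0"
    have "expectation (\<lambda>\<omega>. \<bar>?c i \<omega>\<bar> ^ p) \<le> \<eta> + K ^ p * \<epsilon>" if i: "i < Suc k" for i
    proof -
      let ?A = "{\<omega>\<in>space M. \<eta> \<le> \<bar>c k i \<omega>\<bar>}"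
      have le: "\<bar>?c i \<omega>\<bar> ^ p \<le> \<eta> + K ^ p * indicator ?A \<omega>" if "\<omega> \<in> space M" for \<omega>
      proof (cases "\<omega> \<in> ?A")
        case True
        have "\<bar>?c i \<omega>\<bar> ^ p \<le> K ^ p" using \<open>0 < K\<close> by (intro power_mono) auto
        with True \<eta> show ?thesis by simp
      next
        case False
        then have "\<bar>?c i \<omega>\<bar> \<le> \<eta>" using that \<eta> by auto
        then have "\<bar>?c i \<omega>\<bar> ^ p \<le> \<eta> ^ p" by (intro power_mono) auto
        also have "\<dots> \<le> \<eta> ^ 1" using \<eta> \<open>0 < p\<close> by (intro power_decreasing) auto
        finally show ?thesis using False by simp
      qed
      have int1: "integrable M (indicator ?A :: 'a \<Rightarrow> real)"
        by (intro integrable_real_indicator) (simp_all add: emeasure_eq_measure)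
      have intA: "integrable M (\<lambda>\<omega>. \<eta> + K ^ p * indicator ?A \<omega>)"
        by (intro Bochner_Integration.integrable_add integrable_mult_right int1) simp
      from le have "expectation (\<lambda>\<omega>. \<bar>?c i \<omega>\<bar> ^ p) \<le> expectation (\<lambda>\<omega>. \<eta> + K ^ p * indicator ?A \<omega>)"
      proof (intro integral_mono intA)
        show "integrable M (\<lambda>\<omega>. \<bar>?c i \<omega>\<bar> ^ p)"
          by (rule integrable_const_bound[of _ "K ^ p"])
            (auto intro!: power_mono simp: \<open>0 < K\<close> less_imp_le power_abs \<open>0 < p\<close>)
      qed
      also have "\<dots> = \<eta> + K ^ p * prob ?A"
        by (subst Bochner_Integration.integral_add) (simp_all add: int1 prob_space)
      also have "\<dots> \<le> \<eta> + K ^ p * \<epsilon>" using elim i \<open>0 < K\<close> by (intro add_left_mono mult_left_mono) auto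
      finally show ?thesis .
    qed
    then have "?s k \<le> h k * (\<Sum>i<Suc k. \<eta> + K ^ p * \<epsilon>)"
      using step_pos[of k] by (intro mult_left_mono sum_mono) auto
    also have "\<dots> = (real (Suc k) * h k) * (\<eta> + K ^ p * \<epsilon>)" by simp
    also have "\<dots> = T * (\<eta> + K ^ p * \<epsilon>)" by (simp only: step_total)
    also have "\<dots> < e" using \<eta> \<epsilon> e by (simp add: algebra_simps)
    finally have "?s k < e" .
    moreover have "0 \<le> ?s k"
      using step_pos[of k] by (intro mult_nonneg_nonneg sum_nonneg integral_nonneg_AE) auto
    ultimately show ?case by (simp add: dist_real_def)
  qed
qed

lemma neq_truncated_prob_le:
  assumes "prob {\<omega>\<in>space M. K \<le> running_max (Suc k) (c k) \<omega>} \<le> \<epsilon>"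
    and "\<And>\<omega>. (\<And>i. i < Suc k \<Longrightarrow> \<bar>c k i \<omega>\<bar> \<le> K) \<Longrightarrow> f \<omega> = g \<omega>"
  shows "prob {\<omega>\<in>space M. f \<omega> \<noteq> g \<omega>} \<le> \<epsilon>"
proof -
  note [measurable] = c_measurable_M
  have [measurable]: "running_max (Suc k) (c k) \<in> borel_measurable M"
    by (intro running_max_measurable) measurable
  have "f \<omega> = g \<omega>" if "running_max (Suc k) (c k) \<omega> < K" for \<omega>
    using assms(2)[of \<omega>] that by (auto simp: running_max_less_iff less_imp_le)
  then have "prob {\<omega>\<in>space M. f \<omega> \<noteq> g \<omega>} \<le> prob {\<omega>\<in>space M. K \<le> running_max (Suc k) (c k) \<omega>}"
    by (intro finite_measure_mono) (auto simp: not_le[symmetric])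
  with assms(1) show ?thesis by simp
qed

text \<open>The truncated transforms tend to 0 in mean square by the isometry, and truncation is
  removed by localization.\<close>

lemma transform_vanishes:
  "vanishes_in_prob (\<lambda>k \<omega>. \<Sum>i<Suc k. c k i \<omega> * incr (h k) W i \<omega>)"
proof (rule vanishes_in_prob_local)
  note [measurable] = c_measurable_M incr_measurable_M
  show "(\<lambda>\<omega>. \<Sum>i<Suc k. c k i \<omega> * incr (h k) W i \<omega>) \<in> borel_measurable M" for k by measurable
  fix \<epsilon> :: real assume "0 < \<epsilon>"
  from truncation[OF this] obtain K where K: "0 < K"
    "\<forall>\<^sub>F k in sequentially. prob {\<omega>\<in>space M. K \<le> running_max (Suc k) (c k) \<omega>} \<le> \<epsilon>"
    "\<And>k i. (\<lambda>\<omega>. if \<bar>c k i \<omega>\<bar> \<le> K then c k i \<omega> else 0) \<in> borel_measurable (F (real i * h k))"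
    by blast
  define c' where "c' k i \<omega> = (if \<bar>c k i \<omega>\<bar> \<le> K then c k i \<omega> else 0)" for k i \<omega>
  have c': "c' k i \<in> borel_measurable (F (real i * h k))" for k i
    using K(3)[of k i] by (simp add: c'_def[abs_def])
  have c'M[measurable]: "c' k i \<in> borel_measurable M" for k i by (rule measurable_F_M[OF c'])
  have c'K: "\<bar>c' k i \<omega>\<bar> \<le> K" for k i \<omega> using K(1) by (auto simp: c'_def)
  let ?g = "\<lambda>k \<omega>. \<Sum>i<Suc k. c' k i \<omega> * incr (h k) W i \<omega>"
  note iso = transform_isometry[OF W step_pos c', where K = K, OF c'K]
  have "vanishes_in_prob (\<lambda>k \<omega>. (?g k \<omega>)\<^sup>2)"
  proof (rule vanishes_in_prob_expectation)
    show "integrable M (\<lambda>\<omega>. (?g k \<omega>)\<^sup>2)" for k by (rule iso(1))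
    show "(\<lambda>k. expectation (\<lambda>\<omega>. (?g k \<omega>)\<^sup>2)) \<longlonglongrightarrow> 0"
      unfolding iso(2) using truncated_moment_vanishes[OF K(1), of 2] by (simp add: c'_def)
  qed simp
  then have "vanishes_in_prob ?g"
    by (rule vanishes_in_prob_mono[OF vanishes_in_prob_sqrt]) auto
  moreover have "\<forall>\<^sub>F k in sequentially. prob {\<omega>\<in>space M.
      (\<Sum>i<Suc k. c k i \<omega> * incr (h k) W i \<omega>) \<noteq> ?g k \<omega>} \<le> \<epsilon>"
    using K(2)
  proof eventually_elim
    case (elim k)
    then show ?case by (rule neq_truncated_prob_le) (auto simp: c'_def intro!: sum.cong)
  qed
  ultimately show "\<exists>g. vanishes_in_prob g \<and> (\<forall>\<^sub>F k in sequentially. prob {\<omega>\<in>space M.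
      (\<Sum>i<Suc k. c k i \<omega> * incr (h k) W i \<omega>) \<noteq> g k \<omega>} \<le> \<epsilon>)" by blast
qed

text \<open>Given the past, the squared increment has mean \<open>h k\<close>, as large as the term
  beside it. The truncated sum thus has expectation twice a weighted first moment; no cancellation
  is involved, only smallness of the coefficients.\<close>

lemma quadratic_transform_vanishes:
  "vanishes_in_prob (\<lambda>k \<omega>. \<Sum>i<Suc k. \<bar>c k i \<omega>\<bar> * (h k + (incr (h k) W i \<omega>)\<^sup>2))"
proof (rule vanishes_in_prob_local)
  note [measurable] = c_measurable_M incr_measurable_M
  show "(\<lambda>\<omega>. \<Sum>i<Suc k. \<bar>c k i \<omega>\<bar> * (h k + (incr (h k) W i \<omega>)\<^sup>2)) \<in> borel_measurable M" for k
    by measurable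
  fix \<epsilon> :: real assume "0 < \<epsilon>"
  from truncation[OF this] obtain K where K: "0 < K"
    "\<forall>\<^sub>F k in sequentially. prob {\<omega>\<in>space M. K \<le> running_max (Suc k) (c k) \<omega>} \<le> \<epsilon>"
    "\<And>k i. (\<lambda>\<omega>. if \<bar>c k i \<omega>\<bar> \<le> K then c k i \<omega> else 0) \<in> borel_measurable (F (real i * h k))"
    by blast
  define c' where "c' k i \<omega> = \<bar>if \<bar>c k i \<omega>\<bar> \<le> K then c k i \<omega> else 0\<bar>" for k i \<omega>
  have c': "c' k i \<in> borel_measurable (F (real i * h k))" for k i
    using borel_measurable_abs[OF K(3)[of k i]] by (simp add: c'_def[abs_def])
  have c'M[measurable]: "c' k i \<in> borel_measurable M" for k i by (rule measurable_F_M[OF c'])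
  have c'int: "integrable M (c' k i)" for k i
    by (rule integrable_const_bound[of _ K]) (use K(1) in \<open>auto simp: c'_def\<close>)
  note mom = incr_times_past[OF W step_pos c' c'int]
  let ?g = "\<lambda>k \<omega>. \<Sum>i<Suc k. c' k i \<omega> * (h k + (incr (h k) W i \<omega>)\<^sup>2)"
  have int1: "integrable M (\<lambda>\<omega>. c' k i \<omega> * (h k + (incr (h k) W i \<omega>)\<^sup>2))" for k i
    using mom(3)[of k i] c'int[of k i] by (simp add: distrib_left)
  have "vanishes_in_prob ?g"
  proof (rule vanishes_in_prob_expectation)
    show "integrable M (?g k)" for k by (intro Bochner_Integration.integrable_sum int1)
    show "0 \<le> ?g k \<omega>" for k \<omega>
      using step_pos[of k] by (intro sum_nonneg mult_nonneg_nonneg) (auto simp: c'_def)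
    have "expectation (?g k) = 2 * (h k * (\<Sum>i<Suc k. expectation (c' k i)))" for k
    proof -
      have "expectation (?g k) = (\<Sum>i<Suc k. expectation (\<lambda>\<omega>. c' k i \<omega> * (h k + (incr (h k) W i \<omega>)\<^sup>2)))"
        by (intro Bochner_Integration.integral_sum int1)
      also have "\<dots> = (\<Sum>i<Suc k. 2 * (h k * expectation (c' k i)))"
        using mom(3,4)[of k] c'int[of k] by (intro sum.cong) (auto simp: distrib_left)
      finally show ?thesis by (simp only: sum_distrib_left)
    qed
    moreover have "(\<lambda>k. 2 * (h k * (\<Sum>i<Suc k. expectation (c' k i)))) \<longlonglongrightarrow> 2 * 0"
      using truncated_moment_vanishes[OF K(1), of 1]
      by (intro tendsto_mult tendsto_const) (simp add: c'_def[abs_def])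
    ultimately show "(\<lambda>k. expectation (?g k)) \<longlonglongrightarrow> 0" by simp
  qed
  moreover have "\<forall>\<^sub>F k in sequentially. prob {\<omega>\<in>space M.
      (\<Sum>i<Suc k. \<bar>c k i \<omega>\<bar> * (h k + (incr (h k) W i \<omega>)\<^sup>2)) \<noteq> ?g k \<omega>} \<le> \<epsilon>"
    using K(2)
  proof eventually_elim
    case (elim k)
    then show ?case by (rule neq_truncated_prob_le) (auto simp: c'_def intro!: sum.cong)
  qed
  ultimately show "\<exists>g. vanishes_in_prob g \<and> (\<forall>\<^sub>F k in sequentially. prob {\<omega>\<in>space M.
      (\<Sum>i<Suc k. \<bar>c k i \<omega>\<bar> * (h k + (incr (h k) W i \<omega>)\<^sup>2)) \<noteq> g k \<omega>} \<le> \<epsilon>)" by blast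
qed

end

end

text \<open>The expectation equals T on every grid, and the Markov inequality turns this into
  tightness.\<close>

lemma quadratic_variation_bounded:
  assumes W: "brownian_motion M F W" and T: "0 < T"
  defines "h \<equiv> \<lambda>k. T / real (Suc k)"
  shows "bounded_in_prob (\<lambda>k \<omega>. \<Sum>i<Suc k. (incr (h k) W i \<omega>)\<^sup>2)"
proof (rule bounded_in_prob_expectation)
  have h: "0 < h k" for k using T by (simp add: h_def)
  have mom: "integrable M (\<lambda>\<omega>. (incr (h k) W i \<omega>)\<^sup>2)"
      "expectation (\<lambda>\<omega>. (incr (h k) W i \<omega>)\<^sup>2) = h k" for k i
  proof -
    have "(\<lambda>_. 1 :: real) \<in> borel_measurable (F (real i * h k))" "integrable M (\<lambda>_. 1 :: real)" by auto
    note past = incr_times_past(3,4)[OF W h this]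
    show "integrable M (\<lambda>\<omega>. (incr (h k) W i \<omega>)\<^sup>2)" using past(1) by (simp only: mult_1)
    show "expectation (\<lambda>\<omega>. (incr (h k) W i \<omega>)\<^sup>2) = h k"
      using past(2) by (simp only: mult_1 mult_1_right lebesgue_integral_const prob_space real_scaleR_def)
  qed
  show "integrable M (\<lambda>\<omega>. \<Sum>i<Suc k. (incr (h k) W i \<omega>)\<^sup>2)" for k
    by (intro Bochner_Integration.integrable_sum mom)
  have "expectation (\<lambda>\<omega>. \<Sum>i<Suc k. (incr (h k) W i \<omega>)\<^sup>2) = (\<Sum>i<Suc k. h k)" for k
    using Bochner_Integration.integral_sum[of "{..<Suc k}" M "\<lambda>i \<omega>. (incr (h k) W i \<omega>)\<^sup>2"]
    by (simp only: mom finite_lessThan)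
  also have "(\<Sum>i<Suc k. h k) = T" for k by (simp add: h_def)
  finally show "expectation (\<lambda>\<omega>. \<Sum>i<Suc k. (incr (h k) W i \<omega>)\<^sup>2) \<le> T" for k by simp
qed (rule sum_nonneg, simp)

end

section \<open>Random signs and a Henstock lemma\<close>

text \<open>A subset A encodes the indices with sign plus, so sums over the power set are
  \<open>2 ^ n\<close> times Rademacher expectations: the second moment, and the fourth-moment
  Khintchine inequality with constant 3.\<close>

lemma sum_Pow_signs:
  fixes r :: "nat \<Rightarrow> real"
  defines "S \<equiv> \<lambda>n A. \<Sum>i<n. if i \<in> A then r i else - r i"
  shows "(\<Sum>A\<in>Pow {..<n}. (S n A)\<^sup>2) = 2 ^ n * (\<Sum>i<n. (r i)\<^sup>2)"
    and "(\<Sum>A\<in>Pow {..<n}. (S n A) ^ 4) \<le> 3 * 2 ^ n * (\<Sum>i<n. (r i)\<^sup>2)\<^sup>2"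
proof -
  have step: "(\<Sum>A\<in>Pow {..<Suc n}. f (S (Suc n) A)) = (\<Sum>A\<in>Pow {..<n}. f (S n A - r n) + f (S n A + r n))"
    for f :: "real \<Rightarrow> real" and n
  proof -
    have "(\<Sum>A\<in>Pow {..<Suc n}. f (S (Suc n) A)) =
        (\<Sum>A\<in>Pow {..<n}. f (S (Suc n) A)) + (\<Sum>A\<in>insert n ` Pow {..<n}. f (S (Suc n) A))"
      unfolding lessThan_Suc Pow_insert by (intro sum.union_disjoint) auto
    also have "(\<Sum>A\<in>insert n ` Pow {..<n}. f (S (Suc n) A)) = (\<Sum>A\<in>Pow {..<n}. f (S (Suc n) (insert n A)))"
      by (subst sum.reindex) (auto simp: inj_on_def intro!: sum.cong)
    also have "(\<Sum>A\<in>Pow {..<n}. f (S (Suc n) A)) = (\<Sum>A\<in>Pow {..<n}. f (S n A - r n))"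
      by (intro sum.cong) (auto simp: S_def)
    also have "S (Suc n) (insert n A) = S n A + r n" if "A \<in> Pow {..<n}" for A
    proof -
      have "(\<Sum>i<n. if i \<in> insert n A then r i else - r i) = (\<Sum>i<n. if i \<in> A then r i else - r i)"
        by (intro sum.cong) auto
      then show ?thesis by (simp add: S_def)
    qed
    then have "(\<Sum>A\<in>Pow {..<n}. f (S (Suc n) (insert n A))) = (\<Sum>A\<in>Pow {..<n}. f (S n A + r n))"
      by (intro sum.cong) auto
    finally show ?thesis by (simp add: sum.distrib)
  qed
  have card: "(\<Sum>A\<in>Pow {..<n}. c) = 2 ^ n * c" for n and c :: real
    by (simp add: card_Pow)
  have sq: "(\<Sum>A\<in>Pow {..<n}. (S n A)\<^sup>2) = 2 ^ n * (\<Sum>i<n. (r i)\<^sup>2)" for n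
  proof (induction n)
    case (Suc n)
    have "(\<Sum>A\<in>Pow {..<Suc n}. (S (Suc n) A)\<^sup>2) = (\<Sum>A\<in>Pow {..<n}. 2 * (S n A)\<^sup>2 + 2 * (r n)\<^sup>2)"
      by (subst step[of "\<lambda>x. x\<^sup>2"]) (simp add: power2_eq_square algebra_simps)
    also have "\<dots> = 2 * (2 ^ n * (\<Sum>i<n. (r i)\<^sup>2)) + 2 ^ n * (2 * (r n)\<^sup>2)"
      by (simp only: sum.distrib sum_distrib_left[symmetric] Suc.IH card)
    finally show ?case by (simp add: algebra_simps)
  qed (simp add: S_def)
  then show "(\<Sum>A\<in>Pow {..<n}. (S n A)\<^sup>2) = 2 ^ n * (\<Sum>i<n. (r i)\<^sup>2)" .
  show "(\<Sum>A\<in>Pow {..<n}. (S n A) ^ 4) \<le> 3 * 2 ^ n * (\<Sum>i<n. (r i)\<^sup>2)\<^sup>2"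
  proof (induction n)
    case (Suc n)
    let ?V = "\<Sum>i<n. (r i)\<^sup>2"
    have "(\<Sum>A\<in>Pow {..<Suc n}. (S (Suc n) A) ^ 4) =
        (\<Sum>A\<in>Pow {..<n}. 2 * (S n A) ^ 4 + 12 * (r n)\<^sup>2 * (S n A)\<^sup>2 + 2 * (r n) ^ 4)"
      by (subst step[of "\<lambda>x. x ^ 4"]) (intro sum.cong, simp_all add: power4_eq_xxxx power2_eq_square algebra_simps)
    also have "\<dots> = 2 * (\<Sum>A\<in>Pow {..<n}. (S n A) ^ 4) + 12 * (r n)\<^sup>2 * (2 ^ n * ?V) + 2 ^ n * (2 * (r n) ^ 4)"
      by (simp only: sum.distrib sum_distrib_left[symmetric] sq card)
    \<comment> \<open>The coefficient 2 of the last fourth power is raised to 6 to complete the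
      square \<open>6 * (V + r\<^sup>2)\<^sup>2\<close>.\<close>
    also have "\<dots> \<le> 2 * (3 * 2 ^ n * ?V\<^sup>2) + 12 * (r n)\<^sup>2 * (2 ^ n * ?V) + 2 ^ n * (6 * (r n) ^ 4)"
      using Suc.IH by (intro add_mono mult_left_mono) auto
    also have "\<dots> = 3 * 2 ^ Suc n * (?V + (r n)\<^sup>2)\<^sup>2"
      by (simp add: power2_eq_square power4_eq_xxxx algebra_simps)
    finally show ?case by simp
  qed (simp add: S_def)
qed

text \<open>A Paley-Zygmund estimate for Rademacher sums, in a form that only uses the pointwise bound
  \<open>a x\<^sup>2 - b x\<^sup>4 \<le> a \<theta> + 1[x\<^sup>2 \<ge> \<theta>]\<close> for \<open>b = a\<^sup>2/4\<close>.\<close>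

lemma many_sign_sums_large:
  fixes r :: "nat \<Rightarrow> real"
  assumes \<theta>: "0 < \<theta>" "4 * \<theta> \<le> (\<Sum>i<n. (r i)\<^sup>2)"
  shows "2 ^ n / 6 \<le> (\<Sum>A\<in>Pow {..<n}. of_bool (\<theta> \<le> (\<Sum>i<n. if i \<in> A then r i else - r i)\<^sup>2) :: real)"
proof -
  define V where "V = (\<Sum>i<n. (r i)\<^sup>2)"
  define S where "S A = (\<Sum>i<n. if i \<in> A then r i else - r i)" for A
  \<comment> \<open>The maximizer of \<open>a * V - 3 / 4 * a\<^sup>2 * V\<^sup>2\<close>, with
    maximal value 1/3; losing at most 1/6 through \<theta> leaves the claimed 1/6.\<close>
  define a where "a = 2 / (3 * V)"
  have V: "0 < V" "4 * \<theta> \<le> V" using \<theta> by (auto simp: V_def)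
  have a: "0 < a" "a * V = 2 / 3" using V by (auto simp: a_def)
  have "a * \<theta> \<le> 1 / 6" using V(2) V(1) by (simp add: a_def field_simps)
  have pt: "a * x\<^sup>2 - a\<^sup>2 / 4 * x ^ 4 - 1 / 6 \<le> of_bool (\<theta> \<le> x\<^sup>2)" for x
  proof (cases "\<theta> \<le> x\<^sup>2")
    case True
    have "a * x\<^sup>2 - a\<^sup>2 / 4 * x ^ 4 = 1 - (1 - a / 2 * x\<^sup>2)\<^sup>2"
      by (simp add: power2_eq_square power4_eq_xxxx algebra_simps)
    also have "\<dots> \<le> 1" by simp
    finally show ?thesis using True by simp
  next
    case False
    then have "a * x\<^sup>2 \<le> a * \<theta>" using a by (intro mult_left_mono) auto
    moreover have "0 \<le> a\<^sup>2 / 4 * x ^ 4" by simp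
    moreover have "of_bool (\<theta> \<le> x\<^sup>2) = (0 :: real)" using False by simp
    ultimately show ?thesis using \<open>a * \<theta> \<le> 1 / 6\<close> by linarith
  qed
  have "2 ^ n / 6 = a * (2 ^ n * V) - a\<^sup>2 / 4 * (3 * 2 ^ n * V\<^sup>2) - 2 ^ n / 6"
  proof -
    have "a * (2 ^ n * V) = 2 ^ n * (a * V)" "a\<^sup>2 / 4 * (3 * 2 ^ n * V\<^sup>2) = 3 / 4 * 2 ^ n * (a * V)\<^sup>2"
      by (simp_all add: power2_eq_square algebra_simps)
    then have "a * (2 ^ n * V) = 2 / 3 * 2 ^ n" "a\<^sup>2 / 4 * (3 * 2 ^ n * V\<^sup>2) = 1 / 3 * 2 ^ n"
      unfolding a(2) by (simp_all only:) (simp_all add: power2_eq_square)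
    then show ?thesis by linarith
  qed
  also have "\<dots> \<le> a * (\<Sum>A\<in>Pow {..<n}. (S A)\<^sup>2) - a\<^sup>2 / 4 * (\<Sum>A\<in>Pow {..<n}. (S A) ^ 4) - 2 ^ n / 6"
    using sum_Pow_signs[where r = r and n = n, folded S_def V_def] 
      a(1)
    by (intro diff_right_mono diff_mono mult_left_mono) auto
  also have "\<dots> = (\<Sum>A\<in>Pow {..<n}. a * (S A)\<^sup>2 - a\<^sup>2 / 4 * (S A) ^ 4 - 1 / 6)"
    by (simp add: sum_subtractf sum_distrib_left card_Pow)
  also have "\<dots> \<le> (\<Sum>A\<in>Pow {..<n}. of_bool (\<theta> \<le> (S A)\<^sup>2))"
    by (intro sum_mono pt)
  finally show ?thesis by (simp add: S_def)
qed

context prob_space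
begin

text \<open>A signed sum is the difference of two complementary subset sums, so it reaches
  \<open>2 * \<eta>\<close> with probability at most \<open>2 * \<epsilon>\<close>. Wherever the
  square sum is at least \<open>16 * \<eta>\<^sup>2\<close>, a sixth of all sign patterns give such
  a large signed sum. Counting the pairs of a pattern and an outcome in two ways yields the factor
  12.\<close>

lemma square_sum_small_if_subset_sums_small:
  fixes r :: "nat \<Rightarrow> 'a \<Rightarrow> real"
  assumes [measurable]: "\<And>i. i < n \<Longrightarrow> r i \<in> borel_measurable M"
    and \<eta>: "0 < \<eta>"
    and small: "\<And>A. A \<subseteq> {..<n} \<Longrightarrow> prob {\<omega>\<in>space M. \<eta> \<le> \<bar>\<Sum>i\<in>A. r i \<omega>\<bar>} \<le> \<epsilon>"
  shows "prob {\<omega>\<in>space M. 16 * \<eta>\<^sup>2 \<le> (\<Sum>i<n. (r i \<omega>)\<^sup>2)} \<le> 12 * \<epsilon>"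
proof -
  define S where "S A \<omega> = (\<Sum>i<n. if i \<in> A then r i \<omega> else - r i \<omega>)" for A \<omega>
  define \<theta> where "\<theta> = 4 * \<eta>\<^sup>2"
  have [measurable]: "S A \<in> borel_measurable M" for A
    unfolding S_def by (intro borel_measurable_sum) auto
  have [measurable]: "(\<lambda>\<omega>. \<Sum>i\<in>A. r i \<omega>) \<in> borel_measurable M" if "A \<subseteq> {..<n}" for A
    using that by (intro borel_measurable_sum assms(1)) auto
  let ?B = "{\<omega>\<in>space M. 4 * \<theta> \<le> (\<Sum>i<n. (r i \<omega>)\<^sup>2)}"
  have [measurable]: "?B \<in> events" by measurable
  have S_prob: "prob {\<omega>\<in>space M. \<theta> \<le> (S A \<omega>)\<^sup>2} \<le> \<epsilon> + \<epsilon>" if A: "A \<subseteq> {..<n}" for A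
  proof (rule prob_subset_Un_le)
    show "{\<omega>\<in>space M. \<theta> \<le> (S A \<omega>)\<^sup>2} \<subseteq>
        {\<omega>\<in>space M. \<eta> \<le> \<bar>\<Sum>i\<in>A. r i \<omega>\<bar>} \<union> {\<omega>\<in>space M. \<eta> \<le> \<bar>\<Sum>i\<in>{..<n} - A. r i \<omega>\<bar>}"
    proof safe
      fix \<omega> assume "\<theta> \<le> (S A \<omega>)\<^sup>2" and n: "\<not> \<eta> \<le> \<bar>\<Sum>i\<in>{..<n} - A. r i \<omega>\<bar>"
      then have "(2 * \<eta>)\<^sup>2 \<le> \<bar>S A \<omega>\<bar>\<^sup>2" by (simp add: \<theta>_def power_mult_distrib)
      then have "2 * \<eta> \<le> \<bar>S A \<omega>\<bar>" by (rule power2_le_imp_le) simp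
      moreover have "S A \<omega> = (\<Sum>i\<in>A. r i \<omega>) - (\<Sum>i\<in>{..<n} - A. r i \<omega>)"
      proof -
        have "S A \<omega> = (\<Sum>i\<in>{..<n} - A. if i \<in> A then r i \<omega> else - r i \<omega>) +
            (\<Sum>i\<in>A. if i \<in> A then r i \<omega> else - r i \<omega>)"
          unfolding S_def using A by (subst sum.subset_diff[of A]) auto
        then show ?thesis by (simp add: sum_negf)
      qed
      ultimately show "\<eta> \<le> \<bar>\<Sum>i\<in>A. r i \<omega>\<bar>" using n by linarith
    qed
  qed (use A in \<open>auto intro: small\<close>)
  have "2 ^ n / 6 * prob ?B = expectation (\<lambda>\<omega>. 2 ^ n / 6 * indicator ?B \<omega>)" by simp
  also have "\<dots> \<le> expectation (\<lambda>\<omega>. \<Sum>A\<in>Pow {..<n}. indicator {\<omega>\<in>space M. \<theta> \<le> (S A \<omega>)\<^sup>2} \<omega>)"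
  proof (rule integral_mono)
    show "integrable M (\<lambda>\<omega>. 2 ^ n / 6 * indicator ?B \<omega> :: real)"
      by (intro integrable_mult_right integrable_real_indicator) (simp_all add: emeasure_eq_measure)
    show "integrable M (\<lambda>\<omega>. \<Sum>A\<in>Pow {..<n}. indicator {\<omega>\<in>space M. \<theta> \<le> (S A \<omega>)\<^sup>2} \<omega> :: real)"
      by (intro Bochner_Integration.integrable_sum integrable_real_indicator)
        (simp_all add: emeasure_eq_measure)
    fix \<omega> assume \<omega>: "\<omega> \<in> space M"
    show "2 ^ n / 6 * indicator ?B \<omega> \<le> (\<Sum>A\<in>Pow {..<n}. indicator {\<omega>\<in>space M. \<theta> \<le> (S A \<omega>)\<^sup>2} \<omega> :: real)"
    proof (cases "\<omega> \<in> ?B")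
      case True
      then have "4 * \<theta> \<le> (\<Sum>i<n. (r i \<omega>)\<^sup>2)" "0 < \<theta>" using \<eta> by (auto simp: \<theta>_def)
      from many_sign_sums_large[OF this(2,1)] True \<omega> show ?thesis
        by (simp add: S_def indicator_def of_bool_def)
    qed (auto intro: sum_nonneg)
  qed
  also have "\<dots> = (\<Sum>A\<in>Pow {..<n}. prob {\<omega>\<in>space M. \<theta> \<le> (S A \<omega>)\<^sup>2})"
    by (subst Bochner_Integration.integral_sum)
      (auto intro!: integrable_real_indicator sum.cong simp: emeasure_eq_measure)
  also have "\<dots> \<le> (\<Sum>A\<in>Pow {..<n}. \<epsilon> + \<epsilon>)" by (intro sum_mono S_prob) auto
  also have "\<dots> = 2 ^ n / 6 * (12 * \<epsilon>)" by (simp add: card_Pow)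
  finally have "prob ?B \<le> 12 * \<epsilon>" by (simp add: mult_le_cancel_left_pos)
  moreover have "4 * \<theta> = 16 * \<eta>\<^sup>2" by (simp add: \<theta>_def)
  ultimately show ?thesis by simp
qed

text \<open>Interval functions whose sums over fine partitions of each [0, t] vanish in probability.
  The value 0 on degenerate intervals allows a partition to be padded with repeated points, which
  \<open>interval_partition\<close> admits.\<close>

definition integrates_to_zero :: "(real \<Rightarrow> real \<Rightarrow> 'a \<Rightarrow> real) \<Rightarrow> bool" where
  "integrates_to_zero r \<longleftrightarrow>
     (\<forall>s t. 0 \<le> s \<and> s \<le> t \<longrightarrow> r s t \<in> borel_measurable M) \<and> (\<forall>s. r s s = (\<lambda>_. 0)) \<and>
     (\<forall>t\<ge>0. \<forall>\<eta>>0. \<forall>\<epsilon>>0. \<exists>\<delta>>0. \<forall>n p.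
        interval_partition t n p \<and> (\<forall>i<n. p (Suc i) - p i < \<delta>) \<longrightarrow>
        prob {\<omega>\<in>space M. \<eta> \<le> \<bar>\<Sum>i<n. r (p i) (p (Suc i)) \<omega>\<bar>} < \<epsilon>)"

text \<open>The hypothesis speaks about intervals starting at 0; a single cell of width h is reached
  as the difference of [0, (i + 1) h] and [0, i h], both cut into pieces of length
  \<open>h / real (Suc m)\<close>.\<close>

lemma fine_sums_vanish:
  assumes r: "integrates_to_zero r" and h: "0 < h"
  shows "vanishes_in_prob (\<lambda>m \<omega>. \<Sum>j\<in>{i * Suc m..<i * Suc m + Suc m}.
    r (real j * h / real (Suc m)) (real (Suc j) * h / real (Suc m)) \<omega>)"
proof -
  let ?r = "\<lambda>m j. r (real j * h / real (Suc m)) (real (Suc j) * h / real (Suc m))"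
  define Q where "Q i m \<omega> = (\<Sum>j<i * Suc m. ?r m j \<omega>)" for i m \<omega>
  have rM[measurable]: "?r m j \<in> borel_measurable M" for m j
    using r h by (auto simp: integrates_to_zero_def divide_right_mono)
  have Q: "vanishes_in_prob (Q i)" for i
  proof (rule vanishes_in_probI)
    show "Q i m \<in> borel_measurable M" for m unfolding Q_def by measurable
    fix \<eta> \<epsilon> :: real assume e: "0 < \<eta>" "0 < \<epsilon>"
    have "0 \<le> real i * h" using h by simp
    then obtain \<delta> where \<delta>: "0 < \<delta>" "\<And>n p. interval_partition (real i * h) n p \<Longrightarrow>
        (\<And>i. i < n \<Longrightarrow> p (Suc i) - p i < \<delta>) \<Longrightarrow>
        prob {\<omega>\<in>space M. \<eta> \<le> \<bar>\<Sum>i<n. r (p i) (p (Suc i)) \<omega>\<bar>} < \<epsilon>"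
      using r e unfolding integrates_to_zero_def by meson
    have "(\<lambda>m. h / real (Suc m)) \<longlonglongrightarrow> 0"
      by (rule LIMSEQ_Suc[OF lim_const_over_n])
    from order_tendstoD(2)[OF this \<delta>(1)]
    show "\<forall>\<^sub>F m in sequentially. prob {\<omega> \<in> space M. \<eta> \<le> \<bar>Q i m \<omega>\<bar>} \<le> \<epsilon>"
    proof eventually_elim
      case (elim m)
      have "prob {\<omega>\<in>space M. \<eta> \<le> \<bar>\<Sum>j<i * Suc m. ?r m j \<omega>\<bar>} < \<epsilon>"
      proof (rule \<delta>(2)[of "i * Suc m" "\<lambda>j. real j * h / real (Suc m)"])
        show "interval_partition (real i * h) (i * Suc m) (\<lambda>j. real j * h / real (Suc m))"
          unfolding interval_partition_def of_nat_mult
          using h by (auto simp: divide_right_mono simp del: of_nat_Suc)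
        show "real (Suc j) * h / real (Suc m) - real j * h / real (Suc m) < \<delta>" for j
          using elim by (simp add: diff_divide_distrib[symmetric] distrib_right)
      qed
      then show ?case by (simp add: Q_def)
    qed
  qed
  have eq: "(\<Sum>j\<in>{i * Suc m..<i * Suc m + Suc m}. ?r m j \<omega>) = Q (Suc i) m \<omega> + (- 1) * Q i m \<omega>" for m \<omega>
    unfolding Q_def sum.nat_group[symmetric] by simp
  have "vanishes_in_prob (\<lambda>m \<omega>. (- 1) * Q i m \<omega>)"
    by (rule vanishes_in_prob_mono[OF Q[of i]]) (use Q in \<open>auto simp: vanishes_in_prob_def\<close>)
  with Q[of "Suc i"] show ?thesis unfolding eq by (rule vanishes_in_prob_add)
qed

text \<open>A Henstock lemma: on the intervals outside \<open>A\<close> the partition is refined until their contribution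
  is negligible; the intervals in \<open>A\<close> are kept and padded by degenerate ones.\<close>

lemma subset_sum_small:
  assumes r: "integrates_to_zero r" and T: "0 < T" and \<eta>: "0 < \<eta>" and \<epsilon>: "0 < \<epsilon>"
  shows "\<forall>\<^sub>F k in sequentially. \<forall>A\<subseteq>{..<Suc k}.
    prob {\<omega>\<in>space M. \<eta> \<le> \<bar>\<Sum>i\<in>A. r (real i * (T / real (Suc k))) (real (Suc i) * (T / real (Suc k))) \<omega>\<bar>} \<le> \<epsilon>"
proof -
  have "0 \<le> T" "0 < \<eta> / 2" "0 < \<epsilon> / 2" using T \<eta> \<epsilon> by auto
  then obtain \<delta> where \<delta>: "0 < \<delta>" "\<And>n p. interval_partition T n p \<Longrightarrow>
      (\<And>i. i < n \<Longrightarrow> p (Suc i) - p i < \<delta>) \<Longrightarrow>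
      prob {\<omega>\<in>space M. \<eta> / 2 \<le> \<bar>\<Sum>i<n. r (p i) (p (Suc i)) \<omega>\<bar>} < \<epsilon> / 2"
    using r unfolding integrates_to_zero_def by meson
  have "(\<lambda>k. T / real (Suc k)) \<longlonglongrightarrow> 0"
    by (rule LIMSEQ_Suc[OF lim_const_over_n])
  from order_tendstoD(2)[OF this \<delta>(1)] show ?thesis
  proof eventually_elim
    case (elim k)
    define h where "h = T / real (Suc k)"
    have h: "0 < h" "h < \<delta>" "real (Suc k) * h = T" using elim T by (auto simp: h_def)
    show ?case unfolding h_def[symmetric]
    proof (intro allI impI)
      fix A assume A: "A \<subseteq> {..<Suc k}"
      let ?f = "\<lambda>m i \<omega>. \<Sum>j\<in>{i * Suc m..<i * Suc m + Suc m}.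
        r (real j * h / real (Suc m)) (real (Suc j) * h / real (Suc m)) \<omega>"
      have "vanishes_in_prob (\<lambda>m \<omega>. \<Sum>i\<in>{..<Suc k} - A. ?f m i \<omega>)"
        by (intro vanishes_in_prob_sum fine_sums_vanish[OF r h(1)]) auto
      note fineM = vanishes_in_prob_measurable[OF this] and fine = vanishes_in_probD[OF this \<open>0 < \<eta> / 2\<close> \<open>0 < \<epsilon> / 2\<close>]
      then obtain m where m: "prob {\<omega>\<in>space M. \<eta> / 2 \<le> \<bar>\<Sum>i\<in>{..<Suc k} - A. ?f m i \<omega>\<bar>} \<le> \<epsilon> / 2"
        by (auto simp: eventually_sequentially)
      define N where "N = Suc m"
      have N: "0 < N" by (simp add: N_def)
      \<comment> \<open>Every coarse cell receives N cells of q. Outside A these are equal pieces;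
        inside A the first one jumps to the right end and the other N - 1 are degenerate, so that r
        contributes there exactly its value on the coarse cell.\<close>
      define q where "q j = (if j div N \<in> A \<and> 0 < j mod N then real (Suc (j div N)) * h else real j * h / real N)" for j
      \<comment> \<open>The formula includes l = N, an index that already belongs to the next block:
        both branches then give the right end of cell i.\<close>
      have q: "q (i * N + l) = (if i \<in> A \<and> 0 < l then real (Suc i) * h else real (i * N + l) * h / real N)"
        if "l \<le> N" for i l
      proof (cases "l = N")
        case True
        then have eq: "i * N + l = Suc i * N" by simp
        have "q (Suc i * N) = real (Suc i * N) * h / real N" by (simp add: q_def)
        also have "\<dots> = real (Suc i) * h" by (simp only: of_nat_mult) (use N in simp)
        finally have "q (Suc i * N) = real (Suc i) * h" .
        moreover have "real (Suc i * N) * h / real N = real (Suc i) * h"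
          by (simp only: of_nat_mult) (use N in simp)
        ultimately show ?thesis unfolding eq by (simp only: if_cancel)
      next
        case False
        then have "l < N" using that by simp
        then have "(i * N + l) div N = i" "(i * N + l) mod N = l" by auto
        then show ?thesis unfolding q_def by simp
      qed
      have q_step: "q (Suc j) - q j \<le> h \<and> q j \<le> q (Suc j)" for j
      proof -
        define i l where "i = j div N" and "l = j mod N"
        have j: "j = i * N + l" "l < N" using N by (auto simp: i_def l_def)
        have hN: "h / real N \<le> h" "0 < h / real N" using h N by (auto simp: field_simps)
        have "real l * h / real N \<le> h" using j h N by (simp add: field_simps)
        have iN: "real (i * N) * h / real N = real i * h" using N by simp
        then have lin: "real (i * N + l') * h / real N = real i * h + real l' * h / real N" for l'
          by (simp add: distrib_right add_divide_distrib)
        have Sl: "real (Suc l) * h / real N = real l * h / real N + h / real N"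
          by (simp add: distrib_right add_divide_distrib)
        have Si: "real (Suc i) * h = real i * h + h" by (simp add: distrib_right)
        show ?thesis
        proof (cases "i \<in> A")
          case True
          then show ?thesis using j q[of l i] q[of "Suc l" i] h(1) unfolding j(1) add_Suc_right[symmetric]
            by (cases "l = 0") (auto simp: lin iN Si simp del: of_nat_Suc of_nat_add of_nat_mult)
        next
          case False
          have "real (Suc (i * N + l)) * h / real N = real i * h + real l * h / real N + h / real N"
            using lin[of "Suc l"] by (simp only: add_Suc_right Sl add.assoc)
          with False show ?thesis using j q[of l i] q[of "Suc l" i] hN unfolding j(1) add_Suc_right[symmetric]
            by (auto simp: lin simp del: of_nat_Suc of_nat_add of_nat_mult)
        qed
      qed
      have part: "interval_partition T (Suc k * N) q"
        unfolding interval_partition_def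
      proof (intro conjI allI impI)
        show "q 0 = 0" by (simp add: q_def)
        have "q (Suc k * N + 0) = real (Suc k * N + 0) * h / real N" by (subst q) auto
        then have "q (Suc k * N) = real (Suc k) * real N * h / real N" by (simp only: add_0_right of_nat_mult)
        also have "\<dots> = real (Suc k) * h" using N by (simp del: of_nat_Suc)
        finally show "q (Suc k * N) = T" by (simp only: h(3))
      qed (use q_step in auto)
      have mesh: "q (Suc j) - q j < \<delta>" for j using q_step[of j] h(2) by linarith
      have block: "(\<Sum>j\<in>{i * N..<i * N + N}. r (q j) (q (Suc j)) \<omega>) =
          (if i \<in> A then r (real i * h) (real (Suc i) * h) \<omega> else ?f m i \<omega>)" for i \<omega>
      proof (cases "i \<in> A")
        case True
        have "(\<Sum>j\<in>{i * N..<i * N + N}. r (q j) (q (Suc j)) \<omega>) =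
            (\<Sum>l<N. r (q (i * N + l)) (q (i * N + Suc l)) \<omega>)"
          using sum.shift_bounds_nat_ivl[of "\<lambda>j. r (q j) (q (Suc j)) \<omega>" 0 "i * N" N]
          by (simp add: add.commute lessThan_atLeast0)
        also have "\<dots> = (\<Sum>l<N. if l = 0 then r (real i * h) (real (Suc i) * h) \<omega> else 0)"
        proof (intro sum.cong refl)
          fix l assume "l \<in> {..<N}"
          moreover have "r s s \<omega> = 0" for s using r by (simp add: integrates_to_zero_def)
          ultimately show "r (q (i * N + l)) (q (i * N + Suc l)) \<omega> =
              (if l = 0 then r (real i * h) (real (Suc i) * h) \<omega> else 0)"
            using True N q[of l i] q[of "Suc l" i] by auto
        qed
        also have "\<dots> = r (real i * h) (real (Suc i) * h) \<omega>"
          using N by (simp add: N_def sum.lessThan_Suc_shift)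
        finally show ?thesis using True by simp
      next
        case False
        have "r (q j) (q (Suc j)) \<omega> = r (real j * h / real N) (real (Suc j) * h / real N) \<omega>"
          if "j \<in> {i * N..<i * N + N}" for j
        proof -
          define l where "l = j - i * N"
          have j: "j = i * N + l" "l < N" using that by (auto simp: l_def)
          show ?thesis using False j q[of l i] q[of "Suc l" i] by simp
        qed
        then show ?thesis using False by (simp add: N_def)
      qed
      have total: "(\<Sum>j<Suc k * N. r (q j) (q (Suc j)) \<omega>) =
          (\<Sum>i\<in>A. r (real i * h) (real (Suc i) * h) \<omega>) + (\<Sum>i\<in>{..<Suc k} - A. ?f m i \<omega>)" for \<omega>
      proof -
        have "(\<Sum>j<Suc k * N. r (q j) (q (Suc j)) \<omega>) =
            (\<Sum>i<Suc k. if i \<in> A then r (real i * h) (real (Suc i) * h) \<omega> else ?f m i \<omega>)"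
          unfolding sum.nat_group[symmetric] block ..
        also have "\<dots> = (\<Sum>i\<in>{..<Suc k} - A. if i \<in> A then r (real i * h) (real (Suc i) * h) \<omega> else ?f m i \<omega>)
            + (\<Sum>i\<in>A. if i \<in> A then r (real i * h) (real (Suc i) * h) \<omega> else ?f m i \<omega>)"
          using A by (intro sum.subset_diff) auto
        also have "(\<Sum>i\<in>{..<Suc k} - A. if i \<in> A then r (real i * h) (real (Suc i) * h) \<omega> else ?f m i \<omega>) =
            (\<Sum>i\<in>{..<Suc k} - A. ?f m i \<omega>)" by (intro sum.cong) auto
        also have "(\<Sum>i\<in>A. if i \<in> A then r (real i * h) (real (Suc i) * h) \<omega> else ?f m i \<omega>) =
            (\<Sum>i\<in>A. r (real i * h) (real (Suc i) * h) \<omega>)" by (intro sum.cong) auto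
        finally show ?thesis by simp
      qed
      have qM: "(\<lambda>\<omega>. \<Sum>j<Suc k * N. r (q j) (q (Suc j)) \<omega>) \<in> borel_measurable M"
      proof (intro borel_measurable_sum)
        fix j
        have "0 \<le> q j" using h(1) by (auto simp: q_def)
        then show "r (q j) (q (Suc j)) \<in> borel_measurable M"
          using r q_step[of j] by (auto simp: integrates_to_zero_def)
      qed
      have split: "\<eta> / 2 \<le> \<bar>a + b\<bar> \<or> \<eta> / 2 \<le> \<bar>b\<bar>" if "\<eta> \<le> \<bar>a\<bar>" for a b :: real
        using that by linarith
      have "prob {\<omega>\<in>space M. \<eta> \<le> \<bar>\<Sum>i\<in>A. r (real i * h) (real (Suc i) * h) \<omega>\<bar>} \<le> \<epsilon> / 2 + \<epsilon> / 2"
      proof (rule prob_subset_Un_le)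
        let ?F = "\<lambda>\<omega>. \<Sum>j<Suc k * N. r (q j) (q (Suc j)) \<omega>" and ?G = "\<lambda>\<omega>. \<Sum>i\<in>{..<Suc k} - A. ?f m i \<omega>"
        show "{\<omega>\<in>space M. \<eta> \<le> \<bar>\<Sum>i\<in>A. r (real i * h) (real (Suc i) * h) \<omega>\<bar>} \<subseteq>
            {\<omega>\<in>space M. \<eta> / 2 \<le> \<bar>?F \<omega>\<bar>} \<union> {\<omega>\<in>space M. \<eta> / 2 \<le> \<bar>?G \<omega>\<bar>}"
          unfolding total using split by blast
        show "prob {\<omega>\<in>space M. \<eta> / 2 \<le> \<bar>?F \<omega>\<bar>} \<le> \<epsilon> / 2"
          using \<delta>(2)[OF part mesh] by simp
        show "{\<omega>\<in>space M. \<eta> / 2 \<le> \<bar>?F \<omega>\<bar>} \<in> events" using qM by measurable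
        show "{\<omega>\<in>space M. \<eta> / 2 \<le> \<bar>?G \<omega>\<bar>} \<in> events" using fineM[of m] by measurable
      qed (rule m)
      then show "prob {\<omega>\<in>space M. \<eta> \<le> \<bar>\<Sum>i\<in>A. r (real i * h) (real (Suc i) * h) \<omega>\<bar>} \<le> \<epsilon>" by simp
    qed
  qed
qed

lemma square_sum_vanishes:
  assumes r: "integrates_to_zero r" and T: "0 < T"
  shows "vanishes_in_prob (\<lambda>k \<omega>. \<Sum>i<Suc k.
    (r (real i * (T / real (Suc k))) (real (Suc i) * (T / real (Suc k))) \<omega>)\<^sup>2)"
proof (rule vanishes_in_probI)
  let ?r = "\<lambda>k i. r (real i * (T / real (Suc k))) (real (Suc i) * (T / real (Suc k)))"
  have rM[measurable]: "?r k i \<in> borel_measurable M" for k i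
  proof -
    have "0 \<le> real i * (T / real (Suc k))"
        "real i * (T / real (Suc k)) \<le> real (Suc i) * (T / real (Suc k))"
      using T by (simp, intro mult_right_mono) auto
    then show ?thesis using r by (auto simp: integrates_to_zero_def)
  qed
  show "(\<lambda>\<omega>. \<Sum>i<Suc k. (?r k i \<omega>)\<^sup>2) \<in> borel_measurable M" for k by measurable
  fix \<eta> \<epsilon> :: real assume e: "0 < \<eta>" "0 < \<epsilon>"
  \<comment> \<open>Chosen to undo the factors 16 and 12 of the sign argument.\<close>
  then have e': "0 < sqrt \<eta> / 4" "0 < \<epsilon> / 12" by auto
  from subset_sum_small[OF r T this]
  show "\<forall>\<^sub>F k in sequentially. prob {\<omega> \<in> space M. \<eta> \<le> \<bar>\<Sum>i<Suc k. (?r k i \<omega>)\<^sup>2\<bar>} \<le> \<epsilon>"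
  proof eventually_elim
    case (elim k)
    have "prob {\<omega>\<in>space M. 16 * (sqrt \<eta> / 4)\<^sup>2 \<le> (\<Sum>i<Suc k. (?r k i \<omega>)\<^sup>2)} \<le> 12 * (\<epsilon> / 12)"
      using elim by (intro square_sum_small_if_subset_sums_small rM e') blast
    moreover have "16 * (sqrt \<eta> / 4)\<^sup>2 = \<eta>" using e by (simp add: power_divide)
    moreover have "\<bar>\<Sum>i<Suc k. (?r k i \<omega>)\<^sup>2\<bar> = (\<Sum>i<Suc k. (?r k i \<omega>)\<^sup>2)" for \<omega>
      by (intro abs_of_nonneg sum_nonneg) simp
    ultimately show ?case by simp
  qed
qed

end

section \<open>The trapezoidal recursion\<close>

text \<open>The constant 3 bounds the factor \<open>exp \<bar>Re z\<bar>\<close> of the Taylor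
  remainder on the unit disc.\<close>

lemma exp_Taylor_unit:
  fixes z :: complex
  assumes "cmod z \<le> 1"
  shows "cmod (exp z - 1) \<le> 3 * cmod z"
    and "cmod (exp z - 1 - z) \<le> 3 * (cmod z)\<^sup>2"
    and "cmod (exp z - 1 - z - z\<^sup>2 / 2) \<le> 3 / 2 * cmod z ^ 3"
proof -
  have "exp \<bar>Re z\<bar> \<le> exp (1 :: real)" using assms abs_Re_le_cmod[of z] by simp
  also have "\<dots> \<le> 3" using exp_le by simp
  finally have e: "exp \<bar>Re z\<bar> \<le> 3" .
  show "cmod (exp z - 1) \<le> 3 * cmod z"
    using Taylor_exp[of z 0] mult_right_mono[OF e, of "cmod z"] by simp
  show "cmod (exp z - 1 - z) \<le> 3 * (cmod z)\<^sup>2"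
    using Taylor_exp[of z 1] mult_right_mono[OF e, of "(cmod z)\<^sup>2"]
    by (simp add: diff_diff_eq power2_eq_square)
  show "cmod (exp z - 1 - z - z\<^sup>2 / 2) \<le> 3 / 2 * cmod z ^ 3"
    using Taylor_exp[of z 2] mult_right_mono[OF e, of "(cmod z) ^ 3"]
    by (simp add: diff_diff_eq numeral_2_eq_2 power_Suc ac_simps add.assoc)
      (simp add: power3_eq_cube mult_ac)
qed

text \<open>The trapezoidal rule applied to \<open>e' = -e\<close> has a local error of third order.\<close>

lemma trapezoidal_defect:
  fixes z :: complex
  assumes "cmod z \<le> 1"
  shows "cmod ((1 + exp (- z)) * z / 2 + (exp (- z) - 1)) \<le> 3 * cmod z ^ 3"
proof -
  define \<rho> where "\<rho> = exp (- z) - 1 - (- z) - (- z)\<^sup>2 / 2"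
  have \<rho>: "cmod \<rho> \<le> 3 / 2 * cmod z ^ 3"
    using exp_Taylor_unit(3)[of "- z"] assms by (simp add: \<rho>_def)
  \<comment> \<open>Inserting \<open>1 - z + z\<^sup>2 / 2 + \<rho>\<close> for the exponential
    cancels all terms of order at most two. The constants then add up to 1/4 + 9/4, below 3.\<close>
  have "(1 + exp (- z)) * z / 2 + (exp (- z) - 1) = z ^ 3 / 4 + (1 + z / 2) * \<rho>"
    by (simp add: \<rho>_def power2_eq_square power3_eq_cube field_simps)
  also have "cmod \<dots> \<le> cmod (z ^ 3 / 4) + cmod ((1 + z / 2) * \<rho>)" by (rule norm_triangle_ineq)
  also have "cmod ((1 + z / 2) * \<rho>) \<le> 3 / 2 * (3 / 2 * cmod z ^ 3)"
    unfolding norm_mult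
  proof (rule mult_mono)
    have "cmod (1 + z / 2) \<le> 1 + cmod (z / 2)" using norm_triangle_ineq[of 1 "z / 2"] by simp
    then show "cmod (1 + z / 2) \<le> 3 / 2" using assms by (simp add: norm_divide)
  qed (use \<rho> in auto)
  also have "cmod (z ^ 3 / 4) = cmod z ^ 3 / 4" by (simp add: norm_divide norm_power)
  also have "cmod z ^ 3 / 4 + 3 / 2 * (3 / 2 * cmod z ^ 3) \<le> 3 * cmod z ^ 3"
    using zero_le_power[of "cmod z" 3] by simp
  finally show ?thesis by simp
qed

lemma linear_increment_square_le:
  fixes b :: "'l::finite \<Rightarrow> complex" and D :: "'l \<Rightarrow> real"
  shows "(cmod (a * of_real h + (\<Sum>j\<in>UNIV. b j * of_real (D j))))\<^sup>2
    \<le> 2 * ((cmod a)\<^sup>2 + (\<Sum>j\<in>UNIV. (cmod (b j))\<^sup>2)) * (h\<^sup>2 + (\<Sum>j\<in>UNIV. (D j)\<^sup>2))"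
proof -
  let ?s = "\<Sum>j\<in>UNIV. cmod (b j) * \<bar>D j\<bar>"
  let ?B = "\<Sum>j\<in>UNIV. (cmod (b j))\<^sup>2" and ?Q = "\<Sum>j\<in>UNIV. (D j)\<^sup>2"
  have s: "?s\<^sup>2 \<le> ?B * ?Q"
    using Cauchy_Schwarz_ineq_sum[of "\<lambda>j. cmod (b j)" "\<lambda>j. \<bar>D j\<bar>" UNIV] by simp
  have "cmod (a * of_real h + (\<Sum>j\<in>UNIV. b j * of_real (D j))) \<le> cmod a * \<bar>h\<bar> + ?s"
    by (intro norm_triangle_le add_mono order_trans[OF norm_sum] sum_mono) (auto simp: norm_mult)
  then have "(cmod (a * of_real h + (\<Sum>j\<in>UNIV. b j * of_real (D j))))\<^sup>2 \<le> (cmod a * \<bar>h\<bar> + ?s)\<^sup>2"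
    by (intro power_mono) auto
  also have "\<dots> \<le> 2 * (cmod a * \<bar>h\<bar>)\<^sup>2 + 2 * ?s\<^sup>2"
    using zero_le_power2[of "cmod a * \<bar>h\<bar> - ?s"] by (simp add: power2_eq_square algebra_simps)
  also have "\<dots> \<le> 2 * ((cmod a)\<^sup>2 * h\<^sup>2) + 2 * (?B * ?Q)"
    using s by (simp add: power_mult_distrib)
  also have "\<dots> \<le> 2 * ((cmod a)\<^sup>2 + ?B) * (h\<^sup>2 + ?Q)"
  proof -
    have "0 \<le> (cmod a)\<^sup>2 * ?Q" "0 \<le> ?B * h\<^sup>2" by (auto intro!: mult_nonneg_nonneg sum_nonneg)
    then show ?thesis by (simp add: algebra_simps)
  qed
  finally show ?thesis .
qed

lemma cmod_sum_of_real_le: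
  fixes c :: "nat \<Rightarrow> complex" and D :: "nat \<Rightarrow> real"
  shows "cmod (\<Sum>i<n. c i * of_real (D i)) \<le> \<bar>\<Sum>i<n. Re (c i) * D i\<bar> + \<bar>\<Sum>i<n. Im (c i) * D i\<bar>"
  using cmod_le[of "\<Sum>i<n. c i * of_real (D i)"] by simp

text \<open>The deterministic part of the argument, at a fixed outcome: Y and e are the solution and
  the inverse flow sampled on a grid, d the increments of the exponent, \<rho> the defects with
  partial sums R, and D the Brownian increments. Everything random is confined to the sizes of the
  bounds proved here.\<close>

locale trapezoidal_recursion =
  fixes Y e d \<rho> R :: "nat \<Rightarrow> complex" and a :: complex and b :: "'l::finite \<Rightarrow> complex"
    and D :: "'l \<Rightarrow> nat \<Rightarrow> real" and h :: real and N :: nat and ME MY :: real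
  assumes d: "\<And>i. d i = a * of_real h + (\<Sum>j\<in>UNIV. b j * of_real (D j i))"
    and e: "\<And>i. e (Suc i) = e i * exp (- d i)"
    and \<rho>: "\<And>i. \<rho> i = Y (Suc i) - Y i - d i * ((Y i + Y (Suc i)) / 2)"
    and R: "\<And>i. R i = (\<Sum>m<i. \<rho> m)"
    and h_nonneg: "0 \<le> h"
    and e_le: "\<And>i. i \<le> N \<Longrightarrow> cmod (e i) \<le> ME"
    and Y_le: "\<And>i. i \<le> N \<Longrightarrow> cmod (Y i) \<le> MY"
begin

abbreviation B where "B \<equiv> 2 * ((cmod a)\<^sup>2 + (\<Sum>j\<in>UNIV. (cmod (b j))\<^sup>2))"

lemma mean_le: "i < N \<Longrightarrow> cmod ((Y i + Y (Suc i)) / 2) \<le> MY"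
  using norm_triangle_ineq[of "Y i" "Y (Suc i)"] Y_le[of i] Y_le[of "Suc i"]
  by (simp add: norm_divide)

text \<open>An a priori bound meant for tightness of the largest partial sum, not for its smallness.
  The trapezoidal mean is traded for the left end point, which makes the Brownian terms adapted
  transforms, accessible to the maximal inequality; the price is quadratic in d and \<rho>.\<close>

lemma error_sum_le:
  assumes i: "i \<le> N"
  shows "cmod (R i) \<le> (2 + cmod a * (real N * h)) * MY
    + (\<Sum>j\<in>UNIV. cmod (b j) * (\<bar>\<Sum>m<i. Re (Y m) * D j m\<bar> + \<bar>\<Sum>m<i. Im (Y m) * D j m\<bar>))
    + ((\<Sum>m<N. (cmod (d m))\<^sup>2) + (\<Sum>m<N. (cmod (\<rho> m))\<^sup>2) + (\<Sum>m<N. (cmod (d m))\<^sup>2) * MY)"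
proof -
  have MY: "0 \<le> MY" using order_trans[OF norm_ge_zero Y_le[of 0]] by simp
  \<comment> \<open>The mean equals the left value plus half the increment, and the increment is
    \<rho> plus d times the mean.\<close>
  have "\<rho> m = (Y (Suc m) - Y m) - (d m * Y m + d m * (\<rho> m + d m * ((Y m + Y (Suc m)) / 2)) / 2)" for m
    unfolding \<rho> by (simp add: field_simps)
  then have "R i = (\<Sum>m<i. (Y (Suc m) - Y m) - (d m * Y m + d m * (\<rho> m + d m * ((Y m + Y (Suc m)) / 2)) / 2))"
    unfolding R by (intro sum.cong) auto
  then have R_eq: "R i = (Y i - Y 0) - ((\<Sum>m<i. d m * Y m) + (\<Sum>m<i. d m * (\<rho> m + d m * ((Y m + Y (Suc m)) / 2)) / 2))"
    unfolding sum_lessThan_telescope[symmetric] by (simp only: sum_subtractf sum.distrib)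
  have main: "cmod (R i) \<le> cmod (Y i - Y 0) + (cmod (\<Sum>m<i. d m * Y m) +
      cmod (\<Sum>m<i. d m * (\<rho> m + d m * ((Y m + Y (Suc m)) / 2)) / 2))"
    unfolding R_eq by (intro order_trans[OF norm_triangle_ineq4] add_left_mono norm_triangle_ineq)
  have t1: "cmod (Y i - Y 0) \<le> 2 * MY"
    using norm_triangle_ineq4[of "Y i" "Y 0"] Y_le[of i] Y_le[of 0] i by simp
  have "(\<Sum>m<i. d m * Y m) = a * of_real h * (\<Sum>m<i. Y m) + (\<Sum>j\<in>UNIV. b j * (\<Sum>m<i. Y m * of_real (D j m)))"
  proof -
    have "d m * Y m = a * of_real h * Y m + (\<Sum>j\<in>UNIV. b j * (Y m * of_real (D j m)))" for m
      unfolding d distrib_right sum_distrib_right by (simp add: mult_ac)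
    then have "(\<Sum>m<i. d m * Y m) = a * of_real h * (\<Sum>m<i. Y m) + (\<Sum>m<i. \<Sum>j\<in>UNIV. b j * (Y m * of_real (D j m)))"
      by (simp only: sum.distrib sum_distrib_left)
    also have "(\<Sum>m<i. \<Sum>j\<in>UNIV. b j * (Y m * of_real (D j m))) = (\<Sum>j\<in>UNIV. b j * (\<Sum>m<i. Y m * of_real (D j m)))"
      unfolding sum_distrib_left by (rule sum.swap)
    finally show ?thesis .
  qed
  also have "cmod \<dots> \<le> cmod a * h * (real N * MY) + (\<Sum>j\<in>UNIV. cmod (b j) * (\<bar>\<Sum>m<i. Re (Y m) * D j m\<bar> + \<bar>\<Sum>m<i. Im (Y m) * D j m\<bar>))"
  proof (intro norm_triangle_le add_mono)
    have "cmod (\<Sum>m<i. Y m) \<le> (\<Sum>m<i. MY)" using i by (intro order_trans[OF norm_sum] sum_mono Y_le) auto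
    also have "\<dots> \<le> real N * MY" using i MY by (simp add: mult_right_mono)
    finally show "cmod (a * of_real h * (\<Sum>m<i. Y m)) \<le> cmod a * h * (real N * MY)"
      using h_nonneg by (simp add: norm_mult mult_left_mono)
    show "cmod (\<Sum>j\<in>UNIV. b j * (\<Sum>m<i. Y m * of_real (D j m))) \<le>
      (\<Sum>j\<in>UNIV. cmod (b j) * (\<bar>\<Sum>m<i. Re (Y m) * D j m\<bar> + \<bar>\<Sum>m<i. Im (Y m) * D j m\<bar>))"
      by (intro order_trans[OF norm_sum] sum_mono)
        (auto simp: norm_mult intro!: mult_left_mono cmod_sum_of_real_le)
  qed
  finally have t2: "cmod (\<Sum>m<i. d m * Y m) \<le> \<dots>" .
  have "cmod (\<Sum>m<i. d m * (\<rho> m + d m * ((Y m + Y (Suc m)) / 2)) / 2) \<le>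
      (\<Sum>m<i. (cmod (d m))\<^sup>2 + (cmod (\<rho> m))\<^sup>2 + (cmod (d m))\<^sup>2 * MY)"
  proof (intro order_trans[OF norm_sum] sum_mono)
    fix m assume "m \<in> {..<i}"
    then have m: "m < N" using i by auto
    have "cmod (d m * (\<rho> m + d m * ((Y m + Y (Suc m)) / 2)) / 2) \<le>
        cmod (d m) * (cmod (\<rho> m) + cmod (d m) * MY) / 2"
    proof -
      have "cmod (\<rho> m + d m * ((Y m + Y (Suc m)) / 2)) \<le> cmod (\<rho> m) + cmod (d m) * MY"
      proof (intro norm_triangle_le add_mono order_refl)
        show "cmod (d m * ((Y m + Y (Suc m)) / 2)) \<le> cmod (d m) * MY"
          unfolding norm_mult[of "d m"] by (intro mult_left_mono mean_le m norm_ge_zero)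
      qed
      then show ?thesis
        unfolding norm_divide norm_mult[of "d m" "_ + _"]
        by (simp only: norm_numeral) (intro divide_right_mono mult_left_mono, auto)
    qed
    also have "\<dots> \<le> (cmod (d m))\<^sup>2 + (cmod (\<rho> m))\<^sup>2 + (cmod (d m))\<^sup>2 * MY"
    proof -
      have "cmod (d m) * cmod (\<rho> m) \<le> (cmod (d m))\<^sup>2 + (cmod (\<rho> m))\<^sup>2"
        using sum_squares_bound[of "cmod (d m)" "cmod (\<rho> m)"] mult_nonneg_nonneg[OF norm_ge_zero[of "d m"] norm_ge_zero[of "\<rho> m"]]
        by linarith
      moreover have "0 \<le> cmod (d m) * cmod (\<rho> m)" "0 \<le> (cmod (d m))\<^sup>2 * MY" using MY by auto
      moreover have "cmod (d m) * (cmod (\<rho> m) + cmod (d m) * MY) / 2 =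
          (cmod (d m) * cmod (\<rho> m) + (cmod (d m))\<^sup>2 * MY) / 2"
        by (simp add: algebra_simps power2_eq_square)
      moreover have "(p + u) / 2 \<le> q + u" if "p \<le> q" "0 \<le> p" "0 \<le> u" for p q u :: real
      proof -
        have "p + u \<le> (q + u) + (q + u)" using that by simp
        then show ?thesis by simp
      qed
      ultimately show ?thesis by metis
    qed
    finally show "cmod (d m * (\<rho> m + d m * ((Y m + Y (Suc m)) / 2)) / 2) \<le> \<dots>" .
  qed
  also have "\<dots> \<le> (\<Sum>m<N. (cmod (d m))\<^sup>2 + (cmod (\<rho> m))\<^sup>2 + (cmod (d m))\<^sup>2 * MY)"
    using i MY by (intro sum_mono2) auto
  also have "\<dots> = (\<Sum>m<N. (cmod (d m))\<^sup>2) + (\<Sum>m<N. (cmod (\<rho> m))\<^sup>2) + (\<Sum>m<N. (cmod (d m))\<^sup>2) * MY"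
    by (simp add: sum.distrib sum_distrib_right)
  finally have t3: "cmod (\<Sum>m<i. d m * (\<rho> m + d m * ((Y m + Y (Suc m)) / 2)) / 2) \<le> \<dots>" .
  from main t1 t2 t3 show ?thesis by (simp add: algebra_simps)
qed

text \<open>With \<open>e\<close> the discrete inverse flow, \<open>e Y\<close> is constant up to terms controlled by the errors \<open>\<rho>\<close>;
  the increments of \<open>e\<close> are kept on the side where their martingale part is visible.\<close>

lemma product_decomposition:
  "e N * Y N - e 0 * Y 0 =
    e N * R N - (\<Sum>i<N. R i * (e (Suc i) - e i)) - (\<Sum>i<N. \<rho> i * (e (Suc i) - e i)) / 2
    + (\<Sum>i<N. e i * ((1 + exp (- d i)) * d i / 2 + (exp (- d i) - 1)) * ((Y i + Y (Suc i)) / 2))"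
proof -
  \<comment> \<open>The product rule with averages: the increment of \<open>e * Y\<close> is the
    average of e times the increment of Y plus the increment of e times the mean of Y. Since the
    increment of Y is \<rho> plus d times the mean, the mean gets the trapezoidal defect of e as its
    factor. Subtracting the increment of \<open>e * R\<close> replaces the average of e before
    \<rho> by half an increment of e.\<close>
  have step: "e (Suc i) * Y (Suc i) - e i * Y i - (e (Suc i) * R (Suc i) - e i * R i) =
      e i * ((1 + exp (- d i)) * d i / 2 + (exp (- d i) - 1)) * ((Y i + Y (Suc i)) / 2)
      - R i * (e (Suc i) - e i) - \<rho> i * (e (Suc i) - e i) / 2" for i
  proof -
    have RS: "R (Suc i) = R i + \<rho> i" by (simp add: R)
    define m where "m = (Y i + Y (Suc i)) / 2"
    have "Y (Suc i) + Y i = 2 * m" "Y (Suc i) - Y i = \<rho> i + d i * m"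
      unfolding \<rho> m_def by simp_all
    then have YS: "Y (Suc i) = m + (\<rho> i + d i * m) / 2" and Yi: "Y i = m - (\<rho> i + d i * m) / 2"
      by algebra+
    show ?thesis unfolding m_def[symmetric] RS e YS Yi by (simp add: field_simps)
  qed
  have "e N * Y N - e 0 * Y 0 - (e N * R N - e 0 * R 0) =
      (\<Sum>i<N. e (Suc i) * Y (Suc i) - e i * Y i - (e (Suc i) * R (Suc i) - e i * R i))"
    unfolding sum_subtractf
    using sum_lessThan_telescope[of "\<lambda>i. e i * Y i" N] sum_lessThan_telescope[of "\<lambda>i. e i * R i" N]
    by (simp only: sum_subtractf)
  also have "\<dots> = (\<Sum>i<N. e i * ((1 + exp (- d i)) * d i / 2 + (exp (- d i) - 1)) * ((Y i + Y (Suc i)) / 2))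
      - (\<Sum>i<N. R i * (e (Suc i) - e i)) - (\<Sum>i<N. \<rho> i * (e (Suc i) - e i)) / 2"
    unfolding step by (simp only: sum_subtractf sum_divide_distrib)
  moreover have "R 0 = 0" by (simp add: R)
  ultimately show ?thesis by (simp add: algebra_simps)
qed

text \<open>Each line of the bound meets its own probabilistic estimate: smallness of the last
  partial sum, adapted transforms with coefficients \<open>R * e\<close>, the quadratic sums with
  the same coefficients, Cauchy-Schwarz for defects against increments, and third-order terms
  controlled by the largest increment MD.\<close>

lemma product_almost_constant:
  fixes MD T :: real
  assumes d_le: "\<And>i. i < N \<Longrightarrow> cmod (d i) \<le> MD" and MD: "MD \<le> 1"
    and T: "real N * h \<le> T"
  shows "cmod (e N * Y N - e 0 * Y 0) \<le>
    ME * cmod (R N)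
    + (\<Sum>j\<in>UNIV. cmod (b j) * (\<bar>\<Sum>i<N. Re (R i * e i) * D j i\<bar> + \<bar>\<Sum>i<N. Im (R i * e i) * D j i\<bar>))
    + (cmod a + 3 * B * (T + 1)) * (\<Sum>j\<in>UNIV. \<Sum>i<N. (\<bar>Re (R i * e i)\<bar> + \<bar>Im (R i * e i)\<bar>) * (h + (D j i)\<^sup>2))
    + 3 * ME * (sqrt (\<Sum>i<N. (cmod (\<rho> i))\<^sup>2) * sqrt (\<Sum>i<N. (cmod (d i))\<^sup>2))
    + 3 * ME * MY * MD * (\<Sum>i<N. (cmod (d i))\<^sup>2)"
proof -
  have ME: "0 \<le> ME" using order_trans[OF norm_ge_zero e_le[of 0]] by simp
  have MY: "0 \<le> MY" using order_trans[OF norm_ge_zero Y_le[of 0]] by simp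
  have B: "0 \<le> B" by (auto intro!: add_nonneg_nonneg sum_nonneg)
  have d1: "cmod (- d i) \<le> 1" if "i < N" for i using d_le[OF that] MD by simp
  have es: "e (Suc i) - e i = e i * (exp (- d i) - 1)" for i by (simp add: e algebra_simps)
  have t4: "cmod (\<Sum>i<N. e i * ((1 + exp (- d i)) * d i / 2 + (exp (- d i) - 1)) * ((Y i + Y (Suc i)) / 2))
      \<le> 3 * ME * MY * MD * (\<Sum>i<N. (cmod (d i))\<^sup>2)"
    unfolding sum_distrib_left
  proof (intro order_trans[OF norm_sum] sum_mono)
    fix i assume "i \<in> {..<N}"
    then have i: "i < N" by simp
    have "cmod (d i) ^ 3 = cmod (d i) * (cmod (d i))\<^sup>2" by (simp add: power3_eq_cube power2_eq_square)
    also have "\<dots> \<le> MD * (cmod (d i))\<^sup>2" by (intro mult_right_mono d_le i) auto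
    finally have d3: "cmod (d i) ^ 3 \<le> MD * (cmod (d i))\<^sup>2" .
    have "cmod (e i * ((1 + exp (- d i)) * d i / 2 + (exp (- d i) - 1)) * ((Y i + Y (Suc i)) / 2))
        \<le> ME * (3 * (MD * (cmod (d i))\<^sup>2)) * MY"
    proof -
      have "cmod ((1 + exp (- d i)) * d i / 2 + (exp (- d i) - 1)) \<le> 3 * (MD * (cmod (d i))\<^sup>2)"
        using trapezoidal_defect[of "d i"] d1[OF i] d3 by simp
      moreover have "0 \<le> 3 * (MD * (cmod (d i))\<^sup>2)" using order_trans[OF zero_le_power d3] by simp
      ultimately show ?thesis
        using e_le[of i] mean_le[OF i] i ME MY
        unfolding norm_mult by (intro mult_mono) auto
    qed
    then show "cmod (e i * ((1 + exp (- d i)) * d i / 2 + (exp (- d i) - 1)) * ((Y i + Y (Suc i)) / 2))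
        \<le> 3 * ME * MY * MD * (cmod (d i))\<^sup>2" by (simp add: mult_ac)
  qed
  have "cmod (\<Sum>i<N. \<rho> i * (e (Suc i) - e i)) \<le> (\<Sum>i<N. 3 * ME * (cmod (\<rho> i) * cmod (d i)))"
  proof (intro order_trans[OF norm_sum] sum_mono)
    fix i assume "i \<in> {..<N}"
    then have i: "i < N" by simp
    have "cmod (e (Suc i) - e i) \<le> ME * (3 * cmod (d i))"
      unfolding es norm_mult using exp_Taylor_unit(1)[OF d1[OF i]] e_le[of i] i ME by (intro mult_mono) auto
    then have "cmod (\<rho> i * (e (Suc i) - e i)) \<le> cmod (\<rho> i) * (ME * (3 * cmod (d i)))"
      unfolding norm_mult by (intro mult_left_mono) auto
    then show "cmod (\<rho> i * (e (Suc i) - e i)) \<le> 3 * ME * (cmod (\<rho> i) * cmod (d i))" by (simp add: mult_ac)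
  qed
  also have "\<dots> = 3 * ME * (\<Sum>i<N. cmod (\<rho> i) * cmod (d i))" by (rule sum_distrib_left[symmetric])
  also have "\<dots> \<le> 3 * ME * (sqrt (\<Sum>i<N. (cmod (\<rho> i))\<^sup>2) * sqrt (\<Sum>i<N. (cmod (d i))\<^sup>2))"
  proof (rule mult_left_mono)
    have "(\<Sum>i<N. cmod (\<rho> i) * cmod (d i)) \<le> \<bar>\<Sum>i<N. cmod (\<rho> i) * cmod (d i)\<bar>" by simp
    also have "\<dots> = sqrt ((\<Sum>i<N. cmod (\<rho> i) * cmod (d i))\<^sup>2)" by simp
    also have "\<dots> \<le> sqrt ((\<Sum>i<N. (cmod (\<rho> i))\<^sup>2) * (\<Sum>i<N. (cmod (d i))\<^sup>2))"
      by (intro real_sqrt_le_mono Cauchy_Schwarz_ineq_sum)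
    finally show "(\<Sum>i<N. cmod (\<rho> i) * cmod (d i)) \<le> sqrt (\<Sum>i<N. (cmod (\<rho> i))\<^sup>2) * sqrt (\<Sum>i<N. (cmod (d i))\<^sup>2)"
      by (simp add: real_sqrt_mult)
  qed (use ME in simp)
  finally have t3: "cmod (\<Sum>i<N. \<rho> i * (e (Suc i) - e i)) \<le> \<dots>" .
  \<comment> \<open>An increment of e is e times \<open>\<kappa> - d\<close>. Only the Brownian part
    of d relies on cancellation; the drift and the second-order remainder \<kappa> are estimated by
    absolute values.\<close>
  define \<kappa> where "\<kappa> i = exp (- d i) - 1 - (- d i)" for i
  have "R i * (e (Suc i) - e i) = R i * e i * (\<kappa> i - a * of_real h) - (\<Sum>j\<in>UNIV. b j * (R i * e i * of_real (D j i)))" for i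
  proof -
    have "exp (- d i) - 1 = \<kappa> i - a * of_real h - (\<Sum>j\<in>UNIV. b j * of_real (D j i))"
      by (simp add: \<kappa>_def d)
    moreover have "(\<Sum>j\<in>UNIV. b j * (R i * e i * of_real (D j i))) = R i * e i * (\<Sum>j\<in>UNIV. b j * of_real (D j i))"
      unfolding sum_distrib_left by (simp add: mult_ac)
    ultimately show ?thesis unfolding es by (simp add: right_diff_distrib mult.assoc)
  qed
  then have "(\<Sum>i<N. R i * (e (Suc i) - e i)) =
      (\<Sum>i<N. R i * e i * (\<kappa> i - a * of_real h)) - (\<Sum>i<N. \<Sum>j\<in>UNIV. b j * (R i * e i * of_real (D j i)))"
    by (simp only: sum_subtractf)
  also have "(\<Sum>i<N. \<Sum>j\<in>UNIV. b j * (R i * e i * of_real (D j i))) =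
      (\<Sum>j\<in>UNIV. b j * (\<Sum>i<N. R i * e i * of_real (D j i)))"
    unfolding sum_distrib_left by (rule sum.swap)
  finally have t2_eq: "(\<Sum>i<N. R i * (e (Suc i) - e i)) =
      (\<Sum>i<N. R i * e i * (\<kappa> i - a * of_real h)) - (\<Sum>j\<in>UNIV. b j * (\<Sum>i<N. R i * e i * of_real (D j i)))" .
  have t2: "cmod (\<Sum>i<N. R i * (e (Suc i) - e i))
    \<le> (cmod a + 3 * B * (T + 1)) * (\<Sum>j\<in>UNIV. \<Sum>i<N. (\<bar>Re (R i * e i)\<bar> + \<bar>Im (R i * e i)\<bar>) * (h + (D j i)\<^sup>2))
    + (\<Sum>j\<in>UNIV. cmod (b j) * (\<bar>\<Sum>i<N. Re (R i * e i) * D j i\<bar> + \<bar>\<Sum>i<N. Im (R i * e i) * D j i\<bar>))"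
    unfolding t2_eq
  proof (intro order_trans[OF norm_triangle_ineq4] add_mono)
    show "cmod (\<Sum>j\<in>UNIV. b j * (\<Sum>i<N. R i * e i * of_real (D j i))) \<le>
        (\<Sum>j\<in>UNIV. cmod (b j) * (\<bar>\<Sum>i<N. Re (R i * e i) * D j i\<bar> + \<bar>\<Sum>i<N. Im (R i * e i) * D j i\<bar>))"
    proof (intro order_trans[OF norm_sum] sum_mono)
      show "cmod (b j * (\<Sum>i<N. R i * e i * of_real (D j i))) \<le>
          cmod (b j) * (\<bar>\<Sum>i<N. Re (R i * e i) * D j i\<bar> + \<bar>\<Sum>i<N. Im (R i * e i) * D j i\<bar>)" for j
        unfolding norm_mult by (intro mult_left_mono cmod_sum_of_real_le) auto
    qed
    have "cmod (R i * e i * (\<kappa> i - a * of_real h)) \<le>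
        (cmod a + 3 * B * (T + 1)) * (\<Sum>j\<in>UNIV. (\<bar>Re (R i * e i)\<bar> + \<bar>Im (R i * e i)\<bar>) * (h + (D j i)\<^sup>2))"
      if i: "i < N" for i
    proof -
      let ?Q = "\<Sum>j\<in>UNIV. (D j i)\<^sup>2" and ?S = "\<Sum>j\<in>UNIV. h + (D j i)\<^sup>2"
      have S: "?S = real CARD('l) * h + ?Q" by (simp add: sum.distrib)
      have Q: "0 \<le> ?Q" by (intro sum_nonneg) auto
      \<comment> \<open>The index type is nonempty, so the drift can be charged to the summand h
        that accompanies each squared Brownian increment.\<close>
      have "h \<le> real CARD('l) * h"
        using mult_right_mono[of 1 "real CARD('l)" h] h_nonneg by (simp add: Suc_leI)
      then have hS: "h \<le> ?S" "?Q \<le> ?S" using Q h_nonneg unfolding S by auto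
      have "h \<le> real N * h" using mult_right_mono[of 1 "real N" h] h_nonneg i by simp
      then have hT: "h \<le> T" using T by simp
      then have "h\<^sup>2 \<le> T * h" using h_nonneg by (simp add: power2_eq_square mult_right_mono)
      then have h2: "h\<^sup>2 \<le> T * ?S" using mult_left_mono[OF hS(1), of T] hT h_nonneg by simp
      have "cmod (\<kappa> i) \<le> 3 * (cmod (d i))\<^sup>2"
        using exp_Taylor_unit(2)[OF d1[OF i]] by (simp add: \<kappa>_def)
      also have "(cmod (d i))\<^sup>2 \<le> B * (h\<^sup>2 + ?Q)" unfolding d by (rule linear_increment_square_le)
      also have "\<dots> \<le> B * ((T + 1) * ?S)"
        using h2 hS by (intro mult_left_mono B) (simp add: algebra_simps)
      finally have k: "cmod (\<kappa> i) \<le> 3 * (B * ((T + 1) * ?S))" by simp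
      have "cmod (\<kappa> i - a * of_real h) \<le> cmod (\<kappa> i) + cmod a * h"
        using norm_triangle_ineq4[of "\<kappa> i" "a * of_real h"] h_nonneg by (simp add: norm_mult)
      also have "\<dots> \<le> 3 * (B * ((T + 1) * ?S)) + cmod a * ?S"
        by (intro add_mono k mult_left_mono hS) auto
      also have "\<dots> = (cmod a + 3 * B * (T + 1)) * ?S" by (simp add: algebra_simps)
      finally have "cmod (\<kappa> i - a * of_real h) \<le> (cmod a + 3 * B * (T + 1)) * ?S" .
      then have "cmod (R i * e i * (\<kappa> i - a * of_real h)) \<le>
          (\<bar>Re (R i * e i)\<bar> + \<bar>Im (R i * e i)\<bar>) * ((cmod a + 3 * B * (T + 1)) * ?S)"
        unfolding norm_mult[of "R i * e i"] by (intro mult_mono cmod_le) auto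
      also have "\<dots> = (cmod a + 3 * B * (T + 1)) * ((\<bar>Re (R i * e i)\<bar> + \<bar>Im (R i * e i)\<bar>) * ?S)"
        by (rule mult.left_commute)
      finally show ?thesis by (simp only: sum_distrib_left)
    qed
    then have "cmod (\<Sum>i<N. R i * e i * (\<kappa> i - a * of_real h)) \<le> (\<Sum>i<N.
        (cmod a + 3 * B * (T + 1)) * (\<Sum>j\<in>UNIV. (\<bar>Re (R i * e i)\<bar> + \<bar>Im (R i * e i)\<bar>) * (h + (D j i)\<^sup>2)))"
      by (intro order_trans[OF norm_sum] sum_mono) auto
    also have "\<dots> = (cmod a + 3 * B * (T + 1)) * (\<Sum>j\<in>UNIV. \<Sum>i<N. (\<bar>Re (R i * e i)\<bar> + \<bar>Im (R i * e i)\<bar>) * (h + (D j i)\<^sup>2))"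
      by (subst sum.swap) (rule sum_distrib_left[symmetric])
    finally show "cmod (\<Sum>i<N. R i * e i * (\<kappa> i - a * of_real h)) \<le> \<dots>" .
  qed
  have t1: "cmod (e N * R N) \<le> ME * cmod (R N)"
    unfolding norm_mult by (intro mult_right_mono e_le) auto
  have tri: "cmod (p - q - s / 2 + t) \<le> cmod p + cmod q + cmod s + cmod t" for p q s t
  proof -
    have "cmod (p - q - s / 2 + t) \<le> cmod p + cmod q + cmod (s / 2) + cmod t"
      by (intro norm_triangle_le norm_triangle_le_diff add_mono order_refl)
    moreover have "cmod (s / 2) = cmod s / 2" by (simp add: norm_divide)
    ultimately show ?thesis using norm_ge_zero[of s] by linarith
  qed
  show ?thesis
    unfolding product_decomposition
    by (rule order_trans[OF tri]) (use t1 t2 t3 t4 in linarith)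
qed

end

section \<open>Scalar linear Stratonovich equations\<close>

context prob_space
begin

lemma bounded_in_prob_sum:
  "finite I \<Longrightarrow> (\<And>i. i \<in> I \<Longrightarrow> bounded_in_prob (f i)) \<Longrightarrow>
   bounded_in_prob (\<lambda>k \<omega>. \<Sum>i\<in>I. f i k \<omega>)"
  by (induction I rule: finite_induct) (auto intro: bounded_in_prob_fixed bounded_in_prob_add)

lemma bounded_in_prob_const: "bounded_in_prob (\<lambda>k \<omega>. c)"
  by (rule bounded_in_prob_fixed) simp

lemma vanishes_in_prob_cmult: "vanishes_in_prob f \<Longrightarrow> vanishes_in_prob (\<lambda>k \<omega>. c * f k \<omega>)"
  using vanishes_in_prob_mult[OF _ bounded_in_prob_const, of f c] by (simp add: mult.commute)

end

text \<open>The equation for Y is not among the assumptions; it is added below in the form that the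
  defects integrate to zero, which is all that is known about the integral.\<close>

locale linear_stratonovich = usual_filtered_prob_space M F
  for M :: "'a measure" and F :: "real \<Rightarrow> 'a measure" +
  fixes W :: "'l::finite \<Rightarrow> real \<Rightarrow> 'a \<Rightarrow> real" and Y :: "real \<Rightarrow> 'a \<Rightarrow> complex"
    and a :: complex and b :: "'l \<Rightarrow> complex" and T :: real
  assumes W: "\<And>j. brownian_motion M F (W j)"
    and Y_adapted: "adapted F Y" and Y_paths: "continuous_paths M Y"
    and T: "0 < T"
begin

definition exponent :: "real \<Rightarrow> 'a \<Rightarrow> complex" where
  "exponent t \<omega> = a * of_real t + (\<Sum>j\<in>UNIV. b j * of_real (W j t \<omega>))"

definition inverse_flow :: "real \<Rightarrow> 'a \<Rightarrow> complex" where
  "inverse_flow t \<omega> = exp (- exponent t \<omega>)"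

text \<open>Summed over a partition, this is the increment of Y minus its trapezoidal sums. Drift
  and noise are discretized by the same rule, so that both enter through the increment of one
  exponent.\<close>

definition defect :: "real \<Rightarrow> real \<Rightarrow> 'a \<Rightarrow> complex" where
  "defect s t \<omega> = Y t \<omega> - Y s \<omega> - (exponent t \<omega> - exponent s \<omega>) * ((Y s \<omega> + Y t \<omega>) / 2)"

definition step :: "nat \<Rightarrow> real" where
  "step k = T / real (Suc k)"

definition grid :: "(real \<Rightarrow> 'a \<Rightarrow> complex) \<Rightarrow> nat \<Rightarrow> nat \<Rightarrow> 'a \<Rightarrow> complex" where
  "grid Z k i = Z (real i * step k)"

definition grid_error :: "nat \<Rightarrow> nat \<Rightarrow> 'a \<Rightarrow> complex" where
  "grid_error k i \<omega> = (\<Sum>m<i. defect (real m * step k) (real (Suc m) * step k) \<omega>)"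

definition exponent_incr :: "nat \<Rightarrow> nat \<Rightarrow> 'a \<Rightarrow> complex" where
  "exponent_incr k i \<omega> = grid exponent k (Suc i) \<omega> - grid exponent k i \<omega>"

definition grid_max :: "(real \<Rightarrow> 'a \<Rightarrow> complex) \<Rightarrow> nat \<Rightarrow> 'a \<Rightarrow> real" where
  "grid_max Z k = running_max (Suc k) (\<lambda>i \<omega>. cmod (grid Z k i \<omega>))"

text \<open>With k, not \<open>Suc k\<close>: the k + 1 cells have the indices 0 to k, whereas the
  grid points run up to \<open>Suc k\<close>.\<close>

definition incr_max :: "nat \<Rightarrow> 'a \<Rightarrow> real" where
  "incr_max k = running_max k (\<lambda>i \<omega>. cmod (exponent_incr k i \<omega>))"

definition square_incr :: "nat \<Rightarrow> 'a \<Rightarrow> real" where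
  "square_incr k \<omega> = (\<Sum>i<Suc k. (cmod (exponent_incr k i \<omega>))\<^sup>2)"

definition square_defect :: "nat \<Rightarrow> 'a \<Rightarrow> real" where
  "square_defect k \<omega> = (\<Sum>i<Suc k. (cmod (defect (real i * step k) (real (Suc i) * step k) \<omega>))\<^sup>2)"

lemma step_pos: "0 < step k" using T by (simp add: step_def)

lemma step_fun: "step = (\<lambda>k. T / real (Suc k))" by (simp add: step_def fun_eq_iff)

lemma step_total: "real (Suc k) * step k = T" by (simp add: step_def)

lemma grid_le:
  assumes "i \<le> Suc k"
  shows "real i * step k \<le> T"
proof -
  have "real i * step k \<le> real (Suc k) * step k"
    using assms step_pos[of k] by (intro mult_right_mono) auto
  then show ?thesis by (simp only: step_total)
qed

lemma grid_mono: "i \<le> m \<Longrightarrow> real i * step k \<le> real m * step k"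
  using step_pos[of k] by (intro mult_right_mono) auto

lemma grid_nonneg: "0 \<le> real i * step k"
  using step_pos[of k] by simp

lemma Y_measurable: "0 \<le> s \<Longrightarrow> s \<le> t \<Longrightarrow> Y s \<in> borel_measurable (F t)"
  by (rule measurable_F_mono[of _ s]) (use Y_adapted in \<open>auto simp: adapted_def\<close>)

lemma exponent_measurable: "0 \<le> s \<Longrightarrow> s \<le> t \<Longrightarrow> exponent s \<in> borel_measurable (F t)"
proof -
  assume s: "0 \<le> s" "s \<le> t"
  note [measurable] = brownian_motion_measurable[OF W s]
  show ?thesis unfolding exponent_def[abs_def] by measurable
qed

lemma inverse_flow_measurable: "0 \<le> s \<Longrightarrow> s \<le> t \<Longrightarrow> inverse_flow s \<in> borel_measurable (F t)"
proof -
  assume s: "0 \<le> s" "s \<le> t"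
  note [measurable] = exponent_measurable[OF s]
  have [measurable]: "exp \<in> borel_measurable (borel :: complex measure)"
    by (intro borel_measurable_continuous_onI continuous_intros)
  show ?thesis unfolding inverse_flow_def[abs_def] by measurable
qed

lemma defect_measurable: "0 \<le> s \<Longrightarrow> s \<le> u \<Longrightarrow> u \<le> t \<Longrightarrow> defect s u \<in> borel_measurable (F t)"
proof -
  assume s: "0 \<le> s" "s \<le> u" "u \<le> t"
  then have s': "0 \<le> u" "s \<le> t" by auto
  note [measurable] = exponent_measurable[OF s(1) s'(2)] exponent_measurable[OF s'(1) s(3)]
    Y_measurable[OF s(1) s'(2)] Y_measurable[OF s'(1) s(3)]
  show ?thesis unfolding defect_def[abs_def] by measurable
qed

lemma grid_error_measurable: "grid_error k i \<in> borel_measurable (F (real i * step k))"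
  unfolding grid_error_def[abs_def]
  by (intro borel_measurable_sum defect_measurable grid_nonneg grid_mono) auto

lemma exponent_incr_eq:
  "exponent_incr k i \<omega> = a * of_real (step k) + (\<Sum>j\<in>UNIV. b j * of_real (incr (step k) (W j) i \<omega>))"
proof -
  have "complex_of_real (real (Suc i) * step k) = of_real (real i * step k) + of_real (step k)"
    unfolding of_real_add[symmetric] by (rule arg_cong[of _ _ of_real]) (simp add: distrib_right)
  then show ?thesis
    unfolding exponent_incr_def grid_def exponent_def incr_def of_real_diff right_diff_distrib sum_subtractf
    by (simp only: distrib_left add_diff_add add_diff_cancel_left')
qed

lemma recursion:
  "trapezoidal_recursion (\<lambda>i. grid Y k i \<omega>) (\<lambda>i. grid inverse_flow k i \<omega>) (\<lambda>i. exponent_incr k i \<omega>)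
    (\<lambda>i. defect (real i * step k) (real (Suc i) * step k) \<omega>) (\<lambda>i. grid_error k i \<omega>) a b
    (\<lambda>j i. incr (step k) (W j) i \<omega>) (step k) (Suc k) (grid_max inverse_flow k \<omega>) (grid_max Y k \<omega>)"
proof
  show "grid inverse_flow k (Suc i) \<omega> = grid inverse_flow k i \<omega> * exp (- exponent_incr k i \<omega>)" for i
    unfolding grid_def inverse_flow_def exponent_incr_def by (simp add: exp_add[symmetric])
  show "defect (real i * step k) (real (Suc i) * step k) \<omega> =
      grid Y k (Suc i) \<omega> - grid Y k i \<omega> - exponent_incr k i \<omega> * ((grid Y k i \<omega> + grid Y k (Suc i) \<omega>) / 2)" for i
    unfolding defect_def grid_def exponent_incr_def ..
  show "0 \<le> step k" using step_pos[of k] by simp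
  show "cmod (grid inverse_flow k i \<omega>) \<le> grid_max inverse_flow k \<omega>" if "i \<le> Suc k" for i
    using running_max_ge[OF that, of "\<lambda>i \<omega>. cmod (grid inverse_flow k i \<omega>)"] by (simp add: grid_max_def)
  show "cmod (grid Y k i \<omega>) \<le> grid_max Y k \<omega>" if "i \<le> Suc k" for i
    using running_max_ge[OF that, of "\<lambda>i \<omega>. cmod (grid Y k i \<omega>)"] by (simp add: grid_max_def)
qed (simp_all add: exponent_incr_eq grid_error_def)

lemma grid_measurable:
  assumes "\<And>s t. 0 \<le> s \<Longrightarrow> s \<le> t \<Longrightarrow> Z s \<in> borel_measurable (F t)"
  shows "grid Z k i \<in> borel_measurable (F (real i * step k))" "grid Z k i \<in> borel_measurable M"
proof -
  show "grid Z k i \<in> borel_measurable (F (real i * step k))"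
    unfolding grid_def by (rule assms[OF grid_nonneg order_refl])
  then show "grid Z k i \<in> borel_measurable M" by (rule measurable_F_M)
qed

lemma exponent_incr_measurable_M: "exponent_incr k i \<in> borel_measurable M"
proof -
  note [measurable] = grid_measurable(2)[OF exponent_measurable]
  show ?thesis unfolding exponent_incr_def[abs_def] by measurable
qed

text \<open>A continuous path is bounded on [0, T], with one bound for all grids.\<close>

lemma grid_max_bounded:
  assumes meas: "\<And>s t. 0 \<le> s \<Longrightarrow> s \<le> t \<Longrightarrow> Z s \<in> borel_measurable (F t)"
    and paths: "continuous_paths M Z"
  shows "bounded_in_prob (grid_max Z)"
proof (rule bounded_in_prob_AE)
  note [measurable] = grid_measurable(2)[OF meas]
  show "grid_max Z k \<in> borel_measurable M" for k
    unfolding grid_max_def by (rule running_max_measurable) measurable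
  show "AE \<omega> in M. \<exists>B. \<forall>k. \<bar>grid_max Z k \<omega>\<bar> \<le> B"
    using paths unfolding continuous_paths_def
  proof eventually_elim
    case (elim \<omega>)
    then have "continuous_on {0..T} (\<lambda>t. Z t \<omega>)" by (rule continuous_on_subset) auto
    then have "compact ((\<lambda>t. Z t \<omega>) ` {0..T})" by (rule compact_continuous_image) auto
    then have "bounded ((\<lambda>t. Z t \<omega>) ` {0..T})" by (rule compact_imp_bounded)
    then obtain B where "\<forall>z\<in>(\<lambda>t. Z t \<omega>) ` {0..T}. cmod z \<le> B"
      unfolding bounded_iff ..
    then have B: "cmod (Z t \<omega>) \<le> B" if "t \<in> {0..T}" for t using that by blast
    have "grid_max Z k \<omega> \<le> B" for k
      unfolding grid_max_def running_max_le_iff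
      using B grid_le grid_nonneg by (auto simp: grid_def)
    moreover have "0 \<le> grid_max Z k \<omega>" for k unfolding grid_max_def by (rule running_max_nonneg)
    ultimately show ?case by auto
  qed
qed

lemma exponent_paths: "AE \<omega> in M. continuous_on {0..} (\<lambda>t. exponent t \<omega>)"
proof -
  have "AE \<omega> in M. \<forall>j\<in>UNIV. continuous_on {0..} (\<lambda>t. W j t \<omega>)"
    using W by (intro AE_finite_allI) (auto simp: brownian_motion_def continuous_paths_def)
  then show ?thesis
    unfolding exponent_def by eventually_elim (intro continuous_intros, auto)
qed

lemma inverse_flow_max_bounded: "bounded_in_prob (grid_max inverse_flow)"
proof (rule grid_max_bounded[OF inverse_flow_measurable])
  show "continuous_paths M inverse_flow"
    unfolding continuous_paths_def inverse_flow_def using exponent_paths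
    by eventually_elim (intro continuous_intros)
qed

lemma Y_max_bounded: "bounded_in_prob (grid_max Y)"
  by (rule grid_max_bounded[OF Y_measurable Y_paths])

text \<open>Uniform continuity of almost every path of the exponent on [0, T].\<close>

lemma incr_max_vanishes: "vanishes_in_prob incr_max"
proof (rule vanishes_in_prob_AE)
  note [measurable] = exponent_incr_measurable_M
  show "incr_max k \<in> borel_measurable M" for k
    unfolding incr_max_def by (rule running_max_measurable) measurable
  show "AE \<omega> in M. (\<lambda>k. incr_max k \<omega>) \<longlonglongrightarrow> 0"
    using exponent_paths
  proof eventually_elim
    case (elim \<omega>)
    then have "continuous_on {0..T} (\<lambda>t. exponent t \<omega>)" by (rule continuous_on_subset) auto
    then have uc: "uniformly_continuous_on {0..T} (\<lambda>t. exponent t \<omega>)"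
      by (rule compact_uniformly_continuous) auto
    show ?case
    proof (rule tendstoI)
      fix \<epsilon> :: real assume "0 < \<epsilon>"
      then obtain \<delta> where \<delta>: "0 < \<delta>" "\<And>s t. s \<in> {0..T} \<Longrightarrow> t \<in> {0..T} \<Longrightarrow> dist t s < \<delta> \<Longrightarrow>
          dist (exponent t \<omega>) (exponent s \<omega>) < \<epsilon>"
        using uc unfolding uniformly_continuous_on_def by meson
      have "step \<longlonglongrightarrow> 0" unfolding step_fun by (rule LIMSEQ_Suc[OF lim_const_over_n])
      from order_tendstoD(2)[OF this \<delta>(1)]
      show "\<forall>\<^sub>F k in sequentially. dist (incr_max k \<omega>) 0 < \<epsilon>"
      proof eventually_elim
        case (elim k)
        have "\<bar>cmod (exponent_incr k i \<omega>)\<bar> < \<epsilon>" if "i \<le> k" for i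
        proof -
          have "dist (real (Suc i) * step k) (real i * step k) = step k"
            using step_pos[of k] by (simp add: dist_real_def algebra_simps)
          then show ?thesis
            using \<delta>(2)[of "real i * step k" "real (Suc i) * step k"] elim that
              grid_nonneg[of i k] grid_nonneg[of "Suc i" k] grid_le[of i k] grid_le[of "Suc i" k]
            by (simp add: exponent_incr_def grid_def dist_norm)
        qed
        then have "incr_max k \<omega> < \<epsilon>" unfolding incr_max_def running_max_less_iff by blast
        then show ?case by (simp add: incr_max_def running_max_nonneg)
      qed
    qed
  qed
qed

lemma square_incr_bounded: "bounded_in_prob square_incr"
proof -
  let ?B = "2 * ((cmod a)\<^sup>2 + (\<Sum>j\<in>UNIV. (cmod (b j))\<^sup>2))"
  have B: "0 \<le> ?B" by (auto intro!: add_nonneg_nonneg sum_nonneg)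
  note [measurable] = exponent_incr_measurable_M
  have "bounded_in_prob (\<lambda>k \<omega>. ?B * (T * T + (\<Sum>j\<in>UNIV. \<Sum>i<Suc k. (incr (step k) (W j) i \<omega>)\<^sup>2)))"
    using quadratic_variation_bounded[OF W T, folded step_def]
    by (intro bounded_in_prob_mult bounded_in_prob_add bounded_in_prob_const bounded_in_prob_sum) auto
  then show ?thesis
  proof (rule bounded_in_prob_mono)
    show "square_incr k \<in> borel_measurable M" for k unfolding square_incr_def[abs_def] by measurable
    fix k \<omega>
    have "square_incr k \<omega> \<le> (\<Sum>i<Suc k. ?B * ((step k)\<^sup>2 + (\<Sum>j\<in>UNIV. (incr (step k) (W j) i \<omega>)\<^sup>2)))"
      unfolding square_incr_def exponent_incr_eq by (intro sum_mono linear_increment_square_le)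
    also have "\<dots> = ?B * (real (Suc k) * (step k)\<^sup>2 + (\<Sum>i<Suc k. \<Sum>j\<in>UNIV. (incr (step k) (W j) i \<omega>)\<^sup>2))"
      unfolding sum_distrib_left[symmetric] sum.distrib by simp
    also have "\<dots> \<le> ?B * (T * T + (\<Sum>j\<in>UNIV. \<Sum>i<Suc k. (incr (step k) (W j) i \<omega>)\<^sup>2))"
    proof (intro mult_left_mono add_mono B)
      have "real (Suc k) * (step k)\<^sup>2 = (real (Suc k) * step k) * step k" by (simp only: power2_eq_square mult.assoc)
      also have "\<dots> \<le> T * T"
        unfolding step_total using T grid_le[of 1 k] by (intro mult_left_mono) auto
      finally show "real (Suc k) * (step k)\<^sup>2 \<le> T * T" .
      show "(\<Sum>i<Suc k. \<Sum>j\<in>UNIV. (incr (step k) (W j) i \<omega>)\<^sup>2) \<le> (\<Sum>j\<in>UNIV. \<Sum>i<Suc k. (incr (step k) (W j) i \<omega>)\<^sup>2)"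
        by (subst sum.swap) (rule order_refl)
    qed
    finally have "square_incr k \<omega> \<le> ?B * (T * T + (\<Sum>j\<in>UNIV. \<Sum>i<Suc k. (incr (step k) (W j) i \<omega>)\<^sup>2))" .
    moreover have "0 \<le> square_incr k \<omega>" unfolding square_incr_def by (intro sum_nonneg) auto
    ultimately show "\<bar>square_incr k \<omega>\<bar> \<le> \<bar>?B * (T * T + (\<Sum>j\<in>UNIV. \<Sum>i<Suc k. (incr (step k) (W j) i \<omega>)\<^sup>2))\<bar>"
      by linarith
  qed
qed

section \<open>Consequences of the vanishing of the defect sums\<close>

context
  assumes defect_Re: "integrates_to_zero (\<lambda>s t \<omega>. Re (defect s t \<omega>))"
    and defect_Im: "integrates_to_zero (\<lambda>s t \<omega>. Im (defect s t \<omega>))"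
begin

lemma square_defect_vanishes: "vanishes_in_prob square_defect"
proof -
  have "square_defect = (\<lambda>k \<omega>. (\<Sum>i<Suc k. (Re (defect (real i * step k) (real (Suc i) * step k) \<omega>))\<^sup>2)
      + (\<Sum>i<Suc k. (Im (defect (real i * step k) (real (Suc i) * step k) \<omega>))\<^sup>2))"
    unfolding square_defect_def[abs_def] cmod_power2 sum.distrib ..
  then show ?thesis
    using vanishes_in_prob_add[OF square_sum_vanishes[OF defect_Re T] square_sum_vanishes[OF defect_Im T]]
    by (simp only: step_fun)
qed

lemma grid_error_measurable_M: "grid_error k i \<in> borel_measurable M"
  by (rule measurable_F_M[OF grid_error_measurable])

lemma grid_error_uniformly_small:
  assumes "0 < \<eta>" "0 < \<epsilon>"
  shows "\<forall>\<^sub>F k in sequentially. \<forall>i\<le>Suc k. prob {\<omega>\<in>space M. \<eta> \<le> cmod (grid_error k i \<omega>)} \<le> \<epsilon>"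
proof -
  have e: "0 < \<eta> / 2" "0 < \<epsilon> / 2" using assms by auto
  note [measurable] = grid_error_measurable_M
  from subset_sum_small[OF defect_Re T e] subset_sum_small[OF defect_Im T e]
  show ?thesis
  proof eventually_elim
    case (elim k)
    show ?case
    proof (intro allI impI)
      fix i assume "i \<le> Suc k"
      then have i: "{..<i} \<subseteq> {..<Suc k}" by auto
      have le: "prob {\<omega>\<in>space M. \<eta> / 2 \<le> \<bar>Re (grid_error k i \<omega>)\<bar>} \<le> \<epsilon> / 2"
          "prob {\<omega>\<in>space M. \<eta> / 2 \<le> \<bar>Im (grid_error k i \<omega>)\<bar>} \<le> \<epsilon> / 2"
        using elim(1)[rule_format, OF i] elim(2)[rule_format, OF i]
        unfolding grid_error_def step_def Re_sum Im_sum .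
      have "{\<omega>\<in>space M. \<eta> \<le> cmod (grid_error k i \<omega>)} \<subseteq>
          {\<omega>\<in>space M. \<eta> / 2 \<le> \<bar>Re (grid_error k i \<omega>)\<bar>} \<union> {\<omega>\<in>space M. \<eta> / 2 \<le> \<bar>Im (grid_error k i \<omega>)\<bar>}"
      proof safe
        fix \<omega> assume "\<eta> \<le> cmod (grid_error k i \<omega>)" "\<not> \<eta> / 2 \<le> \<bar>Im (grid_error k i \<omega>)\<bar>"
        then show "\<eta> / 2 \<le> \<bar>Re (grid_error k i \<omega>)\<bar>" using cmod_le[of "grid_error k i \<omega>"] by linarith
      qed
      from prob_subset_Un_le[OF this _ _ le] show "prob {\<omega>\<in>space M. \<eta> \<le> cmod (grid_error k i \<omega>)} \<le> \<epsilon>"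
        by simp
    qed
  qed
qed

lemma endpoint_error_vanishes: "vanishes_in_prob (\<lambda>k \<omega>. cmod (grid_error k (Suc k) \<omega>))"
proof (rule vanishes_in_probI)
  note [measurable] = grid_error_measurable_M
  show "(\<lambda>\<omega>. cmod (grid_error k (Suc k) \<omega>)) \<in> borel_measurable M" for k by measurable
  fix \<eta> \<epsilon> :: real assume "0 < \<eta>" "0 < \<epsilon>"
  from grid_error_uniformly_small[OF this]
  show "\<forall>\<^sub>F k in sequentially. prob {\<omega>\<in>space M. \<eta> \<le> \<bar>cmod (grid_error k (Suc k) \<omega>)\<bar>} \<le> \<epsilon>"
    by eventually_elim auto
qed

text \<open>Supplies the tightness on which truncation rests. The a priori bound is applied with the
  maximal inequality for transforms of Re Y and Im Y, and with the square sums of defects and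
  increments.\<close>

lemma grid_error_max_bounded: "bounded_in_prob (\<lambda>k. running_max (Suc k) (\<lambda>i \<omega>. cmod (grid_error k i \<omega>)))"
proof -
  note [measurable] = grid_error_measurable_M grid_measurable[OF Y_measurable]
  define mx where "mx f j k = running_max (Suc k) (\<lambda>i \<omega>. \<Sum>m<i. f (grid Y k m \<omega>) * incr (step k) (W j) m \<omega>)"
    for f :: "complex \<Rightarrow> real" and j k
  have mx: "bounded_in_prob (mx f j)" if f: "f \<in> borel_measurable borel" "\<And>z. \<bar>f z\<bar> \<le> cmod z" for f j
    unfolding mx_def
  proof (rule transform_max_bounded[OF W T _ _ step_fun])
    note [measurable] = f(1)
    show "(\<lambda>\<omega>. f (grid Y k i \<omega>)) \<in> borel_measurable (F (real i * step k))" for k i by measurable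
    show "bounded_in_prob (\<lambda>k. running_max (Suc k) (\<lambda>i \<omega>. f (grid Y k i \<omega>)))"
    proof (rule bounded_in_prob_mono[OF Y_max_bounded])
      show "running_max (Suc k) (\<lambda>i \<omega>. f (grid Y k i \<omega>)) \<in> borel_measurable M" for k
        by (rule running_max_measurable) measurable
      show "\<bar>running_max (Suc k) (\<lambda>i \<omega>. f (grid Y k i \<omega>)) \<omega>\<bar> \<le> \<bar>grid_max Y k \<omega>\<bar>" for k \<omega>
        using running_max_nonneg[of "Suc k" "\<lambda>i \<omega>. f (grid Y k i \<omega>)" \<omega>]
          running_max_ge[of _ "Suc k" "\<lambda>i \<omega>. cmod (grid Y k i \<omega>)" \<omega>]
        by (auto simp: grid_max_def running_max_nonneg running_max_le_iff intro: order_trans[OF f(2)])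
    qed
  qed
  have mxRe: "bounded_in_prob (mx Re j)" and mxIm: "bounded_in_prob (mx Im j)" for j
    by (rule mx; simp add: abs_Re_le_cmod abs_Im_le_cmod)+
  let ?G = "\<lambda>k \<omega>. (2 + cmod a * T) * grid_max Y k \<omega> + (\<Sum>j\<in>UNIV. cmod (b j) * (mx Re j k \<omega> + mx Im j k \<omega>))
      + (square_incr k \<omega> + square_defect k \<omega> + square_incr k \<omega> * grid_max Y k \<omega>)"
  have "bounded_in_prob ?G"
    by (intro bounded_in_prob_add bounded_in_prob_mult bounded_in_prob_sum bounded_in_prob_const
        Y_max_bounded square_incr_bounded mxRe mxIm bounded_in_prob_vanishes[OF square_defect_vanishes]) auto
  then show ?thesis
  proof (rule bounded_in_prob_mono)
    show "running_max (Suc k) (\<lambda>i \<omega>. cmod (grid_error k i \<omega>)) \<in> borel_measurable M" for k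
      by (rule running_max_measurable) measurable
    fix k \<omega>
    interpret trapezoidal_recursion "\<lambda>i. grid Y k i \<omega>" "\<lambda>i. grid inverse_flow k i \<omega>" "\<lambda>i. exponent_incr k i \<omega>"
      "\<lambda>i. defect (real i * step k) (real (Suc i) * step k) \<omega>" "\<lambda>i. grid_error k i \<omega>" a b
      "\<lambda>j i. incr (step k) (W j) i \<omega>" "step k" "Suc k" "grid_max inverse_flow k \<omega>" "grid_max Y k \<omega>"
      by (rule recursion)
    have "\<bar>cmod (grid_error k i \<omega>)\<bar> \<le> ?G k \<omega>" if i: "i \<le> Suc k" for i
    proof -
      have le: "(\<Sum>j\<in>UNIV. cmod (b j) * (\<bar>\<Sum>m<i. Re (grid Y k m \<omega>) * incr (step k) (W j) m \<omega>\<bar>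
          + \<bar>\<Sum>m<i. Im (grid Y k m \<omega>) * incr (step k) (W j) m \<omega>\<bar>)) \<le>
          (\<Sum>j\<in>UNIV. cmod (b j) * (mx Re j k \<omega> + mx Im j k \<omega>))"
        unfolding mx_def
        by (intro sum_mono mult_left_mono add_mono norm_ge_zero
            running_max_ge[OF i, of "\<lambda>i \<omega>. \<Sum>m<i. Re (grid Y k m \<omega>) * incr (step k) (W _) m \<omega>"]
            running_max_ge[OF i, of "\<lambda>i \<omega>. \<Sum>m<i. Im (grid Y k m \<omega>) * incr (step k) (W _) m \<omega>"])
      show ?thesis
        unfolding abs_norm_cancel square_incr_def square_defect_def
        by (rule order_trans[OF error_sum_le[OF i, unfolded step_total]]) (intro add_mono order_refl le)
    qed
    then have "running_max (Suc k) (\<lambda>i \<omega>. cmod (grid_error k i \<omega>)) \<omega> \<le> ?G k \<omega>"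
      unfolding running_max_le_iff by blast
    then show "\<bar>running_max (Suc k) (\<lambda>i \<omega>. cmod (grid_error k i \<omega>)) \<omega>\<bar> \<le> \<bar>?G k \<omega>\<bar>"
      using running_max_nonneg[of "Suc k" "\<lambda>i \<omega>. cmod (grid_error k i \<omega>)" \<omega>] by linarith
  qed
qed

text \<open>For f = Re and f = Im. The coefficients are adapted because the partial sum up to i
  involves defects ending at grid point i; they inherit uniform smallness from the errors and
  tightness from both factors.\<close>

lemma error_flow_terms_vanish:
  assumes f: "f \<in> borel_measurable borel" "\<And>z. \<bar>f z\<bar> \<le> cmod z"
  shows "vanishes_in_prob (\<lambda>k \<omega>. \<Sum>i<Suc k. f (grid_error k i \<omega> * grid inverse_flow k i \<omega>) * incr (step k) (W j) i \<omega>)"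
    and "vanishes_in_prob (\<lambda>k \<omega>. \<Sum>i<Suc k. \<bar>f (grid_error k i \<omega> * grid inverse_flow k i \<omega>)\<bar>
      * (step k + (incr (step k) (W j) i \<omega>)\<^sup>2))"
proof -
  note [measurable] = f(1) grid_error_measurable grid_measurable(1)[OF inverse_flow_measurable]
    grid_error_measurable_M grid_measurable(2)[OF inverse_flow_measurable]
  let ?c = "\<lambda>k i \<omega>. f (grid_error k i \<omega> * grid inverse_flow k i \<omega>)"
  let ?ME = "grid_max inverse_flow"
  have c: "?c k i \<in> borel_measurable (F (real i * step k))" for k i by measurable
  have e_le: "cmod (grid inverse_flow k i \<omega>) \<le> ?ME k \<omega>" if "i \<le> Suc k" for k i \<omega>
    using running_max_ge[OF that, of "\<lambda>i \<omega>. cmod (grid inverse_flow k i \<omega>)" \<omega>] by (simp add: grid_max_def)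
  have c_le: "\<bar>?c k i \<omega>\<bar> \<le> cmod (grid_error k i \<omega>) * ?ME k \<omega>" if "i \<le> Suc k" for k i \<omega>
    using f(2)[of "grid_error k i \<omega> * grid inverse_flow k i \<omega>"] mult_left_mono[OF e_le[OF that], of "cmod (grid_error k i \<omega>)" \<omega>]
    by (simp add: norm_mult)
  have ME: "0 \<le> ?ME k \<omega>" for k \<omega> unfolding grid_max_def by (rule running_max_nonneg)
  have cmax: "bounded_in_prob (\<lambda>k. running_max (Suc k) (?c k))"
  proof (rule bounded_in_prob_mono[OF bounded_in_prob_mult[OF grid_error_max_bounded inverse_flow_max_bounded]])
    show "running_max (Suc k) (?c k) \<in> borel_measurable M" for k by (rule running_max_measurable) measurable
    fix k \<omega>
    have "\<bar>?c k i \<omega>\<bar> \<le> running_max (Suc k) (\<lambda>i \<omega>. cmod (grid_error k i \<omega>)) \<omega> * ?ME k \<omega>" if i: "i \<le> Suc k" for i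
      using c_le[OF i, of \<omega>] mult_right_mono[OF running_max_ge[OF i, of "\<lambda>i \<omega>. cmod (grid_error k i \<omega>)" \<omega>] ME[of k \<omega>]]
      by simp
    then have "running_max (Suc k) (?c k) \<omega> \<le> running_max (Suc k) (\<lambda>i \<omega>. cmod (grid_error k i \<omega>)) \<omega> * ?ME k \<omega>"
      unfolding running_max_le_iff by blast
    then show "\<bar>running_max (Suc k) (?c k) \<omega>\<bar> \<le>
        \<bar>running_max (Suc k) (\<lambda>i \<omega>. cmod (grid_error k i \<omega>)) \<omega> * ?ME k \<omega>\<bar>"
      using running_max_nonneg[of "Suc k" "?c k" \<omega>] by linarith
  qed
  have small: "\<forall>\<^sub>F k in sequentially. \<forall>i\<le>Suc k. prob {\<omega>\<in>space M. \<eta> \<le> \<bar>?c k i \<omega>\<bar>} \<le> \<epsilon>"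
    if "0 < \<eta>" "0 < \<epsilon>" for \<eta> \<epsilon>
  proof -
    have e: "0 < \<epsilon> / 2" using that by simp
    from bounded_in_prob_common[OF inverse_flow_max_bounded inverse_flow_max_bounded e]
    obtain K where K: "0 < K" "\<forall>\<^sub>F k in sequentially. prob {\<omega>\<in>space M. K \<le> \<bar>?ME k \<omega>\<bar>} \<le> \<epsilon> / 2" by auto
    have "0 < \<eta> / K" using that K by simp
    from grid_error_uniformly_small[OF this e] K(2) show ?thesis
    proof eventually_elim
      case (elim k)
      note [measurable] = bounded_in_prob_measurable[OF inverse_flow_max_bounded, of k]
      show ?case
      proof (intro allI impI)
        fix i assume i: "i \<le> Suc k"
        have "{\<omega>\<in>space M. \<eta> \<le> \<bar>?c k i \<omega>\<bar>} \<subseteq>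
            {\<omega>\<in>space M. \<eta> / K \<le> cmod (grid_error k i \<omega>)} \<union> {\<omega>\<in>space M. K \<le> \<bar>?ME k \<omega>\<bar>}"
        proof safe
          fix \<omega> assume *: "\<eta> \<le> \<bar>?c k i \<omega>\<bar>" "\<not> K \<le> \<bar>?ME k \<omega>\<bar>"
          have "\<eta> \<le> cmod (grid_error k i \<omega>) * ?ME k \<omega>" using *(1) c_le[OF i, of \<omega>] by simp
          also have "\<dots> \<le> cmod (grid_error k i \<omega>) * K" using *(2) by (intro mult_left_mono) auto
          finally show "\<eta> / K \<le> cmod (grid_error k i \<omega>)" using K(1) by (simp add: field_simps)
        qed
        from prob_subset_Un_le[OF this _ _ elim(1)[rule_format, OF i] elim(2)]
        show "prob {\<omega>\<in>space M. \<eta> \<le> \<bar>?c k i \<omega>\<bar>} \<le> \<epsilon>" by simp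
      qed
    qed
  qed
  show "vanishes_in_prob (\<lambda>k \<omega>. \<Sum>i<Suc k. ?c k i \<omega> * incr (step k) (W j) i \<omega>)"
    by (rule transform_vanishes[OF W T c cmax step_fun small])
  show "vanishes_in_prob (\<lambda>k \<omega>. \<Sum>i<Suc k. \<bar>?c k i \<omega>\<bar> * (step k + (incr (step k) (W j) i \<omega>)\<^sup>2))"
    by (rule quadratic_transform_vanishes[OF W T c cmax step_fun small])
qed

text \<open>The discrepancy between the end points of [0, T] does not depend on the grid, while its
  bound vanishes in probability along the grids. The bound is available where the largest increment
  is below 1.\<close>

theorem inverse_flow_product_constant:
  "AE \<omega> in M. inverse_flow T \<omega> * Y T \<omega> = inverse_flow 0 \<omega> * Y 0 \<omega>"
proof -
  let ?D = "\<lambda>\<omega>. cmod (inverse_flow T \<omega> * Y T \<omega> - inverse_flow 0 \<omega> * Y 0 \<omega>)"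
  let ?c = "\<lambda>k i \<omega>. grid_error k i \<omega> * grid inverse_flow k i \<omega>"
  let ?ME = "grid_max inverse_flow" and ?MY = "grid_max Y"
  let ?B = "2 * ((cmod a)\<^sup>2 + (\<Sum>j\<in>UNIV. (cmod (b j))\<^sup>2))"
  let ?S = "\<lambda>f j k \<omega>. \<Sum>i<Suc k. f (?c k i \<omega>) * incr (step k) (W j) i \<omega>"
  let ?Q = "\<lambda>f j k \<omega>. \<Sum>i<Suc k. \<bar>f (?c k i \<omega>)\<bar> * (step k + (incr (step k) (W j) i \<omega>)\<^sup>2)"
  let ?G = "\<lambda>k \<omega>. cmod (grid_error k (Suc k) \<omega>) * ?ME k \<omega>
    + (\<Sum>j\<in>UNIV. cmod (b j) * (\<bar>?S Re j k \<omega>\<bar> + \<bar>?S Im j k \<omega>\<bar>))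
    + (cmod a + 3 * ?B * (T + 1)) * (\<Sum>j\<in>UNIV. ?Q Re j k \<omega> + ?Q Im j k \<omega>)
    + 3 * (sqrt \<bar>square_defect k \<omega>\<bar> * (?ME k \<omega> * sqrt \<bar>square_incr k \<omega>\<bar>))
    + 3 * (incr_max k \<omega> * (?ME k \<omega> * ?MY k \<omega> * square_incr k \<omega>))"
  have abs: "vanishes_in_prob (\<lambda>k \<omega>. \<bar>f k \<omega>\<bar>)" if "vanishes_in_prob f" for f
    by (rule vanishes_in_prob_mono[OF that borel_measurable_abs[OF vanishes_in_prob_measurable[OF that]]]) simp
  have vS: "vanishes_in_prob (?S Re j)" "vanishes_in_prob (?S Im j)"
    and vQ: "vanishes_in_prob (?Q Re j)" "vanishes_in_prob (?Q Im j)" for j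
    by (intro error_flow_terms_vanish; simp add: abs_Re_le_cmod abs_Im_le_cmod)+
  have "vanishes_in_prob ?G"
    by (intro vanishes_in_prob_add vanishes_in_prob_mult vanishes_in_prob_cmult vanishes_in_prob_sum abs
        endpoint_error_vanishes inverse_flow_max_bounded vS vQ vanishes_in_prob_sqrt square_defect_vanishes
        bounded_in_prob_mult bounded_in_prob_sqrt square_incr_bounded incr_max_vanishes Y_max_bounded finite)
  then have "vanishes_in_prob (\<lambda>k. ?D)"
  proof (rule vanishes_in_prob_mono_on[OF _ incr_max_vanishes])
    have [measurable]: "inverse_flow T \<in> borel_measurable M" "inverse_flow 0 \<in> borel_measurable M"
        "Y T \<in> borel_measurable M" "Y 0 \<in> borel_measurable M"
      using T by (auto intro!: measurable_F_M[OF inverse_flow_measurable[OF _ order_refl]]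
          measurable_F_M[OF Y_measurable[OF _ order_refl]])
    show "?D \<in> borel_measurable M" by measurable
    fix k \<omega>
    assume "\<bar>incr_max k \<omega>\<bar> < 1"
    then have d1: "incr_max k \<omega> \<le> 1" by simp
    interpret trapezoidal_recursion "\<lambda>i. grid Y k i \<omega>" "\<lambda>i. grid inverse_flow k i \<omega>" "\<lambda>i. exponent_incr k i \<omega>"
      "\<lambda>i. defect (real i * step k) (real (Suc i) * step k) \<omega>" "\<lambda>i. grid_error k i \<omega>" a b
      "\<lambda>j i. incr (step k) (W j) i \<omega>" "step k" "Suc k" "?ME k \<omega>" "?MY k \<omega>"
      by (rule recursion)
    have d_le: "cmod (exponent_incr k i \<omega>) \<le> incr_max k \<omega>" if "i < Suc k" for i
      using running_max_ge[of i k "\<lambda>i \<omega>. cmod (exponent_incr k i \<omega>)" \<omega>] that by (simp add: incr_max_def)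
    have D: "cmod (grid inverse_flow k (Suc k) \<omega> * grid Y k (Suc k) \<omega> - grid inverse_flow k 0 \<omega> * grid Y k 0 \<omega>) = ?D \<omega>"
      unfolding grid_def step_total by simp
    have Q: "(\<Sum>j\<in>UNIV. \<Sum>i<Suc k. (\<bar>Re (?c k i \<omega>)\<bar> + \<bar>Im (?c k i \<omega>)\<bar>) * (step k + (incr (step k) (W j) i \<omega>)\<^sup>2)) =
        (\<Sum>j\<in>UNIV. ?Q Re j k \<omega> + ?Q Im j k \<omega>)"
      by (simp only: distrib_right sum.distrib)
    have sq: "\<bar>square_defect k \<omega>\<bar> = square_defect k \<omega>" "\<bar>square_incr k \<omega>\<bar> = square_incr k \<omega>"
      unfolding square_defect_def square_incr_def by (intro abs_of_nonneg sum_nonneg; simp)+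
    have "?D \<omega> \<le> ?G k \<omega>"
      using product_almost_constant[OF d_le d1, of T]
      unfolding D Q step_total sq square_defect_def[symmetric] square_incr_def[symmetric]
      by (simp only: mult_ac order_refl)
    then show "\<bar>?D \<omega>\<bar> \<le> \<bar>?G k \<omega>\<bar>"
      unfolding abs_norm_cancel by (rule order_trans[OF _ abs_ge_self])
  qed
  from vanishes_in_prob_fixed_imp_AE_zero[OF this] show ?thesis by simp
qed

end

end

section \<open>Eigenfunctionals of the vector equation\<close>

lemma interval_partition_bounds:
  assumes "interval_partition t n p" "i \<le> n"
  shows "0 \<le> p i" "p i \<le> t"
proof -
  have mono: "p j \<le> p m" if "j \<le> m" "m \<le> n" for j m
    using that
  proof (induction m rule: dec_induct)
    case (step m)
    moreover have "p m \<le> p (Suc m)" using step assms(1) by (auto simp: interval_partition_def)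
    ultimately show ?case by simp
  qed simp
  show "0 \<le> p i" "p i \<le> t"
    using mono[of 0 i] mono[of i n] assms by (auto simp: interval_partition_def)
qed

lemma trapezoidal_sums_converge:
  fixes g :: "real \<Rightarrow> 'b::euclidean_space"
  assumes g: "continuous_on {0..t} g" and e: "0 < e"
  shows "\<exists>\<delta>>0. \<forall>n p. interval_partition t n p \<and> (\<forall>i<n. p (Suc i) - p i < \<delta>) \<longrightarrow>
    norm ((\<Sum>i<n. (p (Suc i) - p i) *\<^sub>R ((1/2) *\<^sub>R (g (p i) + g (p (Suc i))))) - integral {0..t} g) \<le> e"
proof -
  \<comment> \<open>The added 1 avoids a division by zero for t = 0.\<close>
  define e' where "e' = e / (\<bar>t\<bar> + 1)"
  have e': "0 < e'" using e by (simp add: e'_def)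
  have "uniformly_continuous_on {0..t} g" using g by (rule compact_uniformly_continuous) auto
  then obtain \<delta> where \<delta>: "0 < \<delta>"
    "\<And>u v. u \<in> {0..t} \<Longrightarrow> v \<in> {0..t} \<Longrightarrow> dist v u < \<delta> \<Longrightarrow> dist (g v) (g u) < e'"
    using e' unfolding uniformly_continuous_on_def by meson
  show ?thesis
  proof (intro exI[of _ \<delta>] conjI allI impI \<delta>(1))
    fix n p assume "interval_partition t n p \<and> (\<forall>i<n. p (Suc i) - p i < \<delta>)"
    then have p: "interval_partition t n p" and mesh: "\<And>i. i < n \<Longrightarrow> p (Suc i) - p i < \<delta>" by auto
    note bnd = interval_partition_bounds[OF p]
    have p0: "p 0 = 0" "p n = t" and mono: "\<And>i. i < n \<Longrightarrow> p i \<le> p (Suc i)"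
      using p by (auto simp: interval_partition_def)
    have int: "g integrable_on {u..v}" if "0 \<le> u" "v \<le> t" for u v
      using that by (intro integrable_continuous_real continuous_on_subset[OF g]) auto
    have split: "integral {0..p m} g = (\<Sum>i<m. integral {p i..p (Suc i)} g)" if "m \<le> n" for m
      using that
    proof (induction m)
      case (Suc m)
      have "integral {0..p (Suc m)} g = integral {0..p m} g + integral {p m..p (Suc m)} g"
        using Suc.prems bnd[of m] bnd[of "Suc m"] mono[of m]
        by (intro Henstock_Kurzweil_Integration.integral_combine[symmetric] int) auto
      with Suc show ?case by simp
    qed (simp add: p0)
    have cell: "norm ((p (Suc i) - p i) *\<^sub>R ((1/2) *\<^sub>R (g (p i) + g (p (Suc i)))) - integral {p i..p (Suc i)} g)
        \<le> e' * (p (Suc i) - p i)" if i: "i < n" for i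
    proof -
      let ?u = "p i" and ?v = "p (Suc i)" and ?c = "(1/2) *\<^sub>R (g (p i) + g (p (Suc i)))"
      have uv: "0 \<le> ?u" "?u \<le> ?v" "?v \<le> t" using bnd[of i] bnd[of "Suc i"] mono[OF i] i by auto
      have "norm (integral (cbox ?u ?v) (\<lambda>s. ?c - g s)) \<le> e' * measure lborel (cbox ?u ?v)"
      proof (rule integrable_bound)
        show "(\<lambda>s. ?c - g s) integrable_on cbox ?u ?v"
          using int[OF uv(1,3)] by (auto intro!: integrable_diff)
        fix s assume "s \<in> cbox ?u ?v"
        then have s: "s \<in> {0..t}" "dist s ?u < \<delta>" "dist s ?v < \<delta>" "?u \<in> {0..t}" "?v \<in> {0..t}"
          using uv mesh[OF i] by (auto simp: dist_real_def)
        have "?c - g s = (1/2) *\<^sub>R ((g ?u - g s) + (g ?v - g s))"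
          by (simp add: algebra_simps flip: scaleR_2)
        also have "norm \<dots> \<le> (1/2) * (norm (g ?u - g s) + norm (g ?v - g s))"
          using norm_triangle_ineq[of "g ?u - g s" "g ?v - g s"] by simp
        also have "\<dots> \<le> e'"
          using \<delta>(2)[OF s(4,1,2)] \<delta>(2)[OF s(5,1,3)] by (simp add: dist_norm norm_minus_commute)
        finally show "norm (?c - g s) \<le> e'" .
      qed (use e' in simp)
      also have "integral (cbox ?u ?v) (\<lambda>s. ?c - g s) = (?v - ?u) *\<^sub>R ?c - integral {?u..?v} g"
        unfolding cbox_interval
        by (subst Henstock_Kurzweil_Integration.integral_diff[OF integrable_const_ivl int[OF uv(1,3)]])
          (use uv in simp)
      finally show ?thesis using uv by simp
    qed
    have "norm ((\<Sum>i<n. (p (Suc i) - p i) *\<^sub>R ((1/2) *\<^sub>R (g (p i) + g (p (Suc i))))) - integral {0..t} g) =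
        norm (\<Sum>i<n. (p (Suc i) - p i) *\<^sub>R ((1/2) *\<^sub>R (g (p i) + g (p (Suc i)))) - integral {p i..p (Suc i)} g)"
      using split[of n] p0 by (simp add: sum_subtractf)
    also have "\<dots> \<le> (\<Sum>i<n. e' * (p (Suc i) - p i))"
      by (intro order_trans[OF norm_sum] sum_mono cell) auto
    also have "\<dots> = e' * t" using sum_lessThan_telescope[of p n] p0 by (simp add: sum_distrib_left[symmetric])
    also have "\<dots> \<le> e' * (\<bar>t\<bar> + 1)" using e' by (intro mult_left_mono) auto
    also have "\<dots> = e" by (simp add: e'_def)
    finally show "norm ((\<Sum>i<n. (p (Suc i) - p i) *\<^sub>R ((1/2) *\<^sub>R (g (p i) + g (p (Suc i))))) - integral {0..t} g) \<le> e" .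
  qed
qed

lemma has_stratonovich_integralD:
  assumes "has_stratonovich_integral M Y W t S" "0 < \<eta>" "0 < \<epsilon>"
  shows "\<exists>\<delta>>0. \<forall>n p. interval_partition t n p \<and> (\<forall>i<n. p (Suc i) - p i < \<delta>) \<longrightarrow>
    measure M {\<omega>\<in>space M. \<eta> \<le> norm (stratonovich_sum Y W n p \<omega> - S \<omega>)} < \<epsilon>"
  using assms by (simp add: has_stratonovich_integral_def)

lemma borel_measurable_matrix_vector_mult:
  fixes B :: "real^'n^'m"
  assumes [measurable]: "f \<in> borel_measurable N"
  shows "(\<lambda>\<omega>. B *v f \<omega>) \<in> borel_measurable N"
proof -
  have [measurable]: "(\<lambda>v. B *v v) \<in> borel_measurable borel"
    by (intro borel_measurable_continuous_onI linear_continuous_on) (rule matrix_vector_mul_bounded_linear)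
  show ?thesis by measurable
qed

context usual_filtered_prob_space
begin

context
  fixes W :: "'l::finite \<Rightarrow> real \<Rightarrow> 'a \<Rightarrow> real" and A :: "real^'d^'d" and B :: "'l \<Rightarrow> real^'d^'d"
    and x :: "real^'d" and X :: "real \<Rightarrow> 'a \<Rightarrow> real^'d"
  assumes W: "\<And>j. brownian_motion M F (W j)" and X: "stratonovich_solution M F W A B x X"
begin

definition vector_defect :: "real \<Rightarrow> real \<Rightarrow> 'a \<Rightarrow> real^'d" where
  "vector_defect s t \<omega> = X t \<omega> - X s \<omega> - (t - s) *\<^sub>R (A *v ((1/2) *\<^sub>R (X s \<omega> + X t \<omega>)))
     - (\<Sum>j\<in>UNIV. (W j t \<omega> - W j s \<omega>) *\<^sub>R (B j *v ((1/2) *\<^sub>R (X s \<omega> + X t \<omega>))))"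

lemma X_measurable: "0 \<le> t \<Longrightarrow> X t \<in> borel_measurable M"
  using X by (auto simp: stratonovich_solution_def adapted_def intro: measurable_F_M)

lemma vector_defect_measurable: "0 \<le> s \<Longrightarrow> 0 \<le> t \<Longrightarrow> vector_defect s t \<in> borel_measurable M"
proof -
  assume st: "0 \<le> s" "0 \<le> t"
  note [measurable] = X_measurable[OF st(1)] X_measurable[OF st(2)]
    measurable_F_M[OF brownian_motion_measurable[OF W st(1) order_refl]]
    measurable_F_M[OF brownian_motion_measurable[OF W st(2) order_refl]]
  have [measurable]: "(\<lambda>\<omega>. C *v ((1/2) *\<^sub>R (X s \<omega> + X t \<omega>))) \<in> borel_measurable M" for C :: "real^'d^'d"
    by (rule borel_measurable_matrix_vector_mult) measurable
  show ?thesis unfolding vector_defect_def[abs_def] by measurable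
qed

text \<open>The initial value is contained in the equation at time 0. The partition of [0, 0]
  without cells has an empty sum, which forces the stochastic integrals there to vanish almost
  surely.\<close>

lemma solution_at_0: "AE \<omega> in M. X 0 \<omega> = x"
proof -
  obtain S where S: "\<And>j t. 0 \<le> t \<Longrightarrow> has_stratonovich_integral M (\<lambda>s \<omega>. B j *v X s \<omega>) (W j) t (S j t)"
    and eq: "\<And>t. 0 \<le> t \<Longrightarrow> AE \<omega> in M.
      X t \<omega> = x + integral {0..t} (\<lambda>s. A *v X s \<omega>) + (\<Sum>j\<in>UNIV. S j t \<omega>)"
    using X unfolding stratonovich_solution_def by blast
  have S0: "AE \<omega> in M. S j 0 \<omega> = 0" for j
  proof -
    note S0 = S[of 0 j, simplified]
    have SM[measurable]: "S j 0 \<in> borel_measurable M" using S0 by (simp add: has_stratonovich_integral_def)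
    have "vanishes_in_prob (\<lambda>k \<omega>. norm (S j 0 \<omega>))"
    proof (rule vanishes_in_probI)
      fix \<eta> \<epsilon> :: real assume "0 < \<eta>" "0 < \<epsilon>"
      then obtain \<delta> where \<delta>: "0 < \<delta>" "\<And>n p. interval_partition 0 n p \<and> (\<forall>i<n. p (Suc i) - p i < \<delta>) \<Longrightarrow>
          prob {\<omega>\<in>space M. \<eta> \<le> norm (stratonovich_sum (\<lambda>s \<omega>. B j *v X s \<omega>) (W j) n p \<omega> - S j 0 \<omega>)} < \<epsilon>"
        using has_stratonovich_integralD[OF S0] by blast
      have "interval_partition 0 0 (\<lambda>_. 0)" by (simp add: interval_partition_def)
      with \<delta>(2)[of 0 "\<lambda>_. 0"] have "prob {\<omega>\<in>space M. \<eta> \<le> norm (S j 0 \<omega>)} < \<epsilon>"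
        by (simp add: stratonovich_sum_def)
      then show "\<forall>\<^sub>F k in sequentially. prob {\<omega>\<in>space M. \<eta> \<le> \<bar>norm (S j 0 \<omega>)\<bar>} \<le> \<epsilon>"
        by (simp add: less_imp_le)
    qed measurable
    from vanishes_in_prob_fixed_imp_AE_zero[OF this] show ?thesis by simp
  qed
  have "AE \<omega> in M. \<forall>j\<in>UNIV. S j 0 \<omega> = 0" by (intro AE_finite_allI S0) simp
  with eq[OF order_refl] show ?thesis by eventually_elim simp
qed

lemma vector_defect_sum:
  assumes "interval_partition t n p"
  shows "(\<Sum>i<n. vector_defect (p i) (p (Suc i)) \<omega>) = X t \<omega> - X 0 \<omega>
    - (\<Sum>i<n. (p (Suc i) - p i) *\<^sub>R ((1/2) *\<^sub>R (A *v X (p i) \<omega> + A *v X (p (Suc i)) \<omega>)))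
    - (\<Sum>j\<in>UNIV. stratonovich_sum (\<lambda>s \<omega>. B j *v X s \<omega>) (W j) n p \<omega>)"
proof -
  have lin: "C *v ((1/2) *\<^sub>R (u + v)) = (1/2) *\<^sub>R (C *v u + C *v v)" for C :: "real^'d^'d" and u v
    by (simp add: matrix_vector_mult_scaleR matrix_vector_right_distrib)
  have p: "p 0 = 0" "p n = t" using assms by (auto simp: interval_partition_def)
  have "(\<Sum>i<n. X (p (Suc i)) \<omega> - X (p i) \<omega>) = X t \<omega> - X 0 \<omega>"
    using sum_lessThan_telescope[of "\<lambda>i. X (p i) \<omega>" n] p by simp
  moreover have "(\<Sum>i<n. \<Sum>j\<in>UNIV. (W j (p (Suc i)) \<omega> - W j (p i) \<omega>) *\<^sub>R
        ((1/2) *\<^sub>R (B j *v X (p i) \<omega> + B j *v X (p (Suc i)) \<omega>))) =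
      (\<Sum>j\<in>UNIV. stratonovich_sum (\<lambda>s \<omega>. B j *v X s \<omega>) (W j) n p \<omega>)"
    unfolding stratonovich_sum_def by (rule sum.swap)
  ultimately show ?thesis
    unfolding vector_defect_def lin by (simp only: sum_subtractf)
qed

text \<open>The drift sums converge pathwise, with a mesh that depends on \<omega>, whereas the
  claim needs one mesh for all outcomes. Hence the argument by contradiction: along a sequence of
  bad partitions with mesh below 1/(k + 1), almost sure convergence does give convergence in
  probability.\<close>

lemma vector_defect_integrates_to_zero:
  assumes t: "0 \<le> t" and \<eta>: "0 < \<eta>" and \<epsilon>: "0 < \<epsilon>"
  shows "\<exists>\<delta>>0. \<forall>n p. interval_partition t n p \<and> (\<forall>i<n. p (Suc i) - p i < \<delta>) \<longrightarrow>
    prob {\<omega>\<in>space M. \<eta> \<le> norm (\<Sum>i<n. vector_defect (p i) (p (Suc i)) \<omega>)} < \<epsilon>"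
proof (rule ccontr)
  assume contr: "\<not> ?thesis"
  have "\<forall>k. \<exists>n p. interval_partition t n p \<and> (\<forall>i<n. p (Suc i) - p i < inverse (real (Suc k))) \<and>
      \<epsilon> \<le> prob {\<omega>\<in>space M. \<eta> \<le> norm (\<Sum>i<n. vector_defect (p i) (p (Suc i)) \<omega>)}"
  proof
    fix k :: nat
    have "0 < inverse (real (Suc k))" by simp
    with contr show "\<exists>n p. interval_partition t n p \<and> (\<forall>i<n. p (Suc i) - p i < inverse (real (Suc k))) \<and>
      \<epsilon> \<le> prob {\<omega>\<in>space M. \<eta> \<le> norm (\<Sum>i<n. vector_defect (p i) (p (Suc i)) \<omega>)}"
      by (meson not_less)
  qed
  from choice[OF this] obtain n where "\<forall>k. \<exists>p. interval_partition t (n k) p \<and>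
      (\<forall>i<n k. p (Suc i) - p i < inverse (real (Suc k))) \<and>
      \<epsilon> \<le> prob {\<omega>\<in>space M. \<eta> \<le> norm (\<Sum>i<n k. vector_defect (p i) (p (Suc i)) \<omega>)}" ..
  from choice[OF this] obtain p where *: "\<forall>k. interval_partition t (n k) (p k) \<and>
      (\<forall>i<n k. p k (Suc i) - p k i < inverse (real (Suc k))) \<and>
      \<epsilon> \<le> prob {\<omega>\<in>space M. \<eta> \<le> norm (\<Sum>i<n k. vector_defect (p k i) (p k (Suc i)) \<omega>)}" ..
  then have p: "\<And>k. interval_partition t (n k) (p k)"
    and mesh: "\<And>k i. i < n k \<Longrightarrow> p k (Suc i) - p k i < inverse (real (Suc k))"
    and large: "\<And>k. \<epsilon> \<le> prob {\<omega>\<in>space M. \<eta> \<le> norm (\<Sum>i<n k. vector_defect (p k i) (p k (Suc i)) \<omega>)}"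
    by simp_all
  obtain S where S: "\<And>j. has_stratonovich_integral M (\<lambda>s \<omega>. B j *v X s \<omega>) (W j) t (S j)"
    and eq: "AE \<omega> in M. X t \<omega> = x + integral {0..t} (\<lambda>s. A *v X s \<omega>) + (\<Sum>j\<in>UNIV. S j \<omega>)"
    using X t unfolding stratonovich_solution_def by meson
  have fine: "\<forall>\<^sub>F k in sequentially. \<forall>i<n k. p k (Suc i) - p k i < \<delta>" if "0 < \<delta>" for \<delta>
  proof -
    have "\<forall>\<^sub>F k in sequentially. inverse (real (Suc k)) < \<delta>"
      using order_tendstoD(2)[OF LIMSEQ_inverse_real_of_nat that] .
    then show ?thesis by eventually_elim (use mesh less_trans in blast)
  qed
  let ?R = "\<lambda>k \<omega>. \<Sum>i<n k. (p k (Suc i) - p k i) *\<^sub>R ((1/2) *\<^sub>R (A *v X (p k i) \<omega> + A *v X (p k (Suc i)) \<omega>))"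
  let ?T = "\<lambda>j k \<omega>. stratonovich_sum (\<lambda>s \<omega>. B j *v X s \<omega>) (W j) (n k) (p k) \<omega>"
  have SM[measurable]: "S j \<in> borel_measurable M" for j using S by (simp add: has_stratonovich_integral_def)
  have XM: "(\<lambda>\<omega>. C *v X (p k i) \<omega>) \<in> borel_measurable M" if "i \<le> n k" for C :: "real^'d^'d" and k i
    by (intro borel_measurable_matrix_vector_mult X_measurable interval_partition_bounds(1)[OF p that])
  have RM[measurable]: "?R k \<in> borel_measurable M" for k
    by (intro borel_measurable_sum borel_measurable_scaleR borel_measurable_const borel_measurable_add XM) auto
  have TM[measurable]: "?T j k \<in> borel_measurable M" for j k
    unfolding stratonovich_sum_def
    by (intro borel_measurable_sum borel_measurable_scaleR borel_measurable_const borel_measurable_add XM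
        borel_measurable_diff measurable_F_M[OF brownian_motion_measurable[OF W interval_partition_bounds(1)[OF p] order_refl]]) auto
  have XtM[measurable]: "X t \<in> borel_measurable M" "X 0 \<in> borel_measurable M"
    using t by (auto intro: X_measurable)
  have vT: "vanishes_in_prob (\<lambda>k \<omega>. norm (?T j k \<omega> - S j \<omega>))" for j
  proof (rule vanishes_in_probI)
    fix \<eta> \<epsilon> :: real assume e: "0 < \<eta>" "0 < \<epsilon>"
    then obtain \<delta> where \<delta>: "0 < \<delta>" "\<And>n p. interval_partition t n p \<and> (\<forall>i<n. p (Suc i) - p i < \<delta>) \<Longrightarrow>
        prob {\<omega>\<in>space M. \<eta> \<le> norm (stratonovich_sum (\<lambda>s \<omega>. B j *v X s \<omega>) (W j) n p \<omega> - S j \<omega>)} < \<epsilon>"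
      using has_stratonovich_integralD[OF S[of j]] by blast
    from fine[OF \<delta>(1)] show "\<forall>\<^sub>F k in sequentially. prob {\<omega>\<in>space M. \<eta> \<le> \<bar>norm (?T j k \<omega> - S j \<omega>)\<bar>} \<le> \<epsilon>"
      by eventually_elim (use less_imp_le[OF \<delta>(2)[OF conjI[OF p]]] in simp)
  qed measurable
  have vR: "vanishes_in_prob (\<lambda>k \<omega>. norm (?R k \<omega> - (X t \<omega> - X 0 \<omega> - (\<Sum>j\<in>UNIV. S j \<omega>))))"
  proof (rule vanishes_in_prob_AE)
    have "continuous_paths M X" using X by (simp add: stratonovich_solution_def)
    then show "AE \<omega> in M. (\<lambda>k. norm (?R k \<omega> - (X t \<omega> - X 0 \<omega> - (\<Sum>j\<in>UNIV. S j \<omega>)))) \<longlonglongrightarrow> 0"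
      unfolding continuous_paths_def using eq solution_at_0
    proof eventually_elim
      case (elim \<omega>)
      have g: "continuous_on {0..t} (\<lambda>s. A *v X s \<omega>)"
        by (rule bounded_linear.continuous_on[OF matrix_vector_mul_bounded_linear
              continuous_on_subset[OF elim(1)]]) auto
      have I: "X t \<omega> - X 0 \<omega> - (\<Sum>j\<in>UNIV. S j \<omega>) = integral {0..t} (\<lambda>s. A *v X s \<omega>)"
        using elim(2,3) by simp
      show ?case unfolding I
      proof (rule tendstoI)
        fix e :: real assume "0 < e"
        then have "0 < e / 2" by simp
        from trapezoidal_sums_converge[OF g this] obtain \<delta> where \<delta>: "0 < \<delta>"
          "\<And>n p. interval_partition t n p \<and> (\<forall>i<n. p (Suc i) - p i < \<delta>) \<Longrightarrow>
            norm ((\<Sum>i<n. (p (Suc i) - p i) *\<^sub>R ((1/2) *\<^sub>R (A *v X (p i) \<omega> + A *v X (p (Suc i)) \<omega>)))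
              - integral {0..t} (\<lambda>s. A *v X s \<omega>)) \<le> e / 2" by blast
        from fine[OF \<delta>(1)] show "\<forall>\<^sub>F k in sequentially.
            dist (norm (?R k \<omega> - integral {0..t} (\<lambda>s. A *v X s \<omega>))) 0 < e"
        proof eventually_elim
          case (elim k)
          from \<delta>(2)[OF conjI[OF p elim]] \<open>0 < e\<close> show ?case by (simp only: dist_0_norm dist_real_def) simp
        qed
      qed
    qed
  qed measurable
  have "vanishes_in_prob (\<lambda>k \<omega>. norm (?R k \<omega> - (X t \<omega> - X 0 \<omega> - (\<Sum>j\<in>UNIV. S j \<omega>)))
      + (\<Sum>j\<in>UNIV. norm (?T j k \<omega> - S j \<omega>)))"
    by (intro vanishes_in_prob_add vanishes_in_prob_sum vR vT finite)
  then have "vanishes_in_prob (\<lambda>k \<omega>. norm (\<Sum>i<n k. vector_defect (p k i) (p k (Suc i)) \<omega>))"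
  proof (rule vanishes_in_prob_mono)
    fix k \<omega>
    have neg: "(\<Sum>i<n k. vector_defect (p k i) (p k (Suc i)) \<omega>) =
        - (?R k \<omega> - (X t \<omega> - X 0 \<omega> - (\<Sum>j\<in>UNIV. S j \<omega>))) - (\<Sum>j\<in>UNIV. ?T j k \<omega> - S j \<omega>)"
      unfolding vector_defect_sum[OF p] by (simp add: sum_subtractf algebra_simps)
    have "norm (\<Sum>i<n k. vector_defect (p k i) (p k (Suc i)) \<omega>) \<le>
        norm (?R k \<omega> - (X t \<omega> - X 0 \<omega> - (\<Sum>j\<in>UNIV. S j \<omega>))) + (\<Sum>j\<in>UNIV. norm (?T j k \<omega> - S j \<omega>))"
      unfolding neg
      by (intro order_trans[OF norm_triangle_ineq4] add_mono norm_sum) (simp only: norm_minus_cancel order_refl)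
    then show "\<bar>norm (\<Sum>i<n k. vector_defect (p k i) (p k (Suc i)) \<omega>)\<bar> \<le>
        \<bar>norm (?R k \<omega> - (X t \<omega> - X 0 \<omega> - (\<Sum>j\<in>UNIV. S j \<omega>))) + (\<Sum>j\<in>UNIV. norm (?T j k \<omega> - S j \<omega>))\<bar>"
      unfolding abs_norm_cancel by (rule order_trans[OF _ abs_ge_self])
    show "(\<lambda>\<omega>. norm (\<Sum>i<n k. vector_defect (p k i) (p k (Suc i)) \<omega>)) \<in> borel_measurable M"
    proof -
      have [measurable]: "(\<lambda>\<omega>. \<Sum>i<n k. vector_defect (p k i) (p k (Suc i)) \<omega>) \<in> borel_measurable M"
        by (intro borel_measurable_sum vector_defect_measurable interval_partition_bounds(1)[OF p]) auto
      show ?thesis by measurable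
    qed
  qed
  from vanishes_in_probD[OF this \<eta>, of "\<epsilon> / 2"] \<epsilon> obtain k where
    "prob {\<omega>\<in>space M. \<eta> \<le> norm (\<Sum>i<n k. vector_defect (p k i) (p k (Suc i)) \<omega>)} \<le> \<epsilon> / 2"
    by (auto simp: eventually_sequentially)
  with large[of k] \<epsilon> show False by simp
qed

text \<open>A common left eigenfunctional maps the vector defect to the scalar defect of its own
  equation, so vanishing defect sums are inherited up to the operator bound K. The functionals in
  question are the rows of P.\<close>

lemma eigenfunctional_of_solution:
  fixes \<phi> :: "real^'d \<Rightarrow> complex"
  assumes \<phi>: "bounded_linear \<phi>" and a: "\<And>v. \<phi> (A *v v) = a * \<phi> v"
    and b: "\<And>j v. \<phi> (B j *v v) = b j * \<phi> v" and T: "0 < T"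
  shows "AE \<omega> in M. \<phi> (X T \<omega>) = \<phi> x * exp (a * of_real T + (\<Sum>j\<in>UNIV. b j * of_real (W j T \<omega>)))"
proof -
  interpret \<phi>: bounded_linear \<phi> by (rule \<phi>)
  have cont: "continuous_on UNIV \<phi>" by (rule linear_continuous_on[OF \<phi>])
  have [measurable]: "\<phi> \<in> borel_measurable borel" by (rule borel_measurable_continuous_onI[OF cont])
  interpret linear_stratonovich M F W "\<lambda>t \<omega>. \<phi> (X t \<omega>)" a b T
  proof
    show "adapted F (\<lambda>t \<omega>. \<phi> (X t \<omega>))" unfolding adapted_def
    proof (intro allI impI)
      fix t :: real assume "0 \<le> t"
      then have [measurable]: "X t \<in> borel_measurable (F t)"
        using X by (auto simp: stratonovich_solution_def adapted_def)
      show "(\<lambda>\<omega>. \<phi> (X t \<omega>)) \<in> borel_measurable (F t)" by measurable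
    qed
    show "continuous_paths M (\<lambda>t \<omega>. \<phi> (X t \<omega>))"
      using X unfolding stratonovich_solution_def continuous_paths_def
      by (auto elim!: eventually_mono intro: continuous_on_compose2[OF cont])
  qed (use W T in auto)
  have defect_eq: "defect s t \<omega> = \<phi> (vector_defect s t \<omega>)" for s t \<omega>
  proof -
    let ?m = "(1/2) *\<^sub>R (X s \<omega> + X t \<omega>)"
    have m: "(\<phi> (X s \<omega>) + \<phi> (X t \<omega>)) / 2 = \<phi> ?m"
      unfolding \<phi>.scaleR \<phi>.add by (simp add: scaleR_conv_of_real)
    have e: "exponent t \<omega> - exponent s \<omega> = a * of_real (t - s) + (\<Sum>j\<in>UNIV. b j * of_real (W j t \<omega> - W j s \<omega>))"
      unfolding exponent_def by (simp add: algebra_simps sum_subtractf)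
    have "\<phi> (\<Sum>j\<in>UNIV. (W j t \<omega> - W j s \<omega>) *\<^sub>R (B j *v ?m)) = (\<Sum>j\<in>UNIV. b j * of_real (W j t \<omega> - W j s \<omega>)) * \<phi> ?m"
      unfolding \<phi>.sum \<phi>.scaleR b sum_distrib_right by (simp add: scaleR_conv_of_real mult_ac)
    moreover have "\<phi> ((t - s) *\<^sub>R (A *v ?m)) = a * of_real (t - s) * \<phi> ?m"
      unfolding \<phi>.scaleR a by (simp add: scaleR_conv_of_real mult_ac)
    ultimately show ?thesis
      unfolding defect_def vector_defect_def \<phi>.diff m e by (simp add: distrib_right)
  qed
  obtain K where K: "0 < K" "\<And>v. cmod (\<phi> v) \<le> norm v * K" using \<phi>.pos_bounded by auto
  have zero: "integrates_to_zero (\<lambda>s t \<omega>. f (defect s t \<omega>))"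
    if f: "bounded_linear f" "\<And>z. \<bar>f z\<bar> \<le> cmod z" for f :: "complex \<Rightarrow> real"
    unfolding integrates_to_zero_def
  proof (intro conjI allI impI)
    interpret f: bounded_linear f by (rule f(1))
    have [measurable]: "f \<in> borel_measurable borel"
      by (intro borel_measurable_continuous_onI linear_continuous_on f(1))
    have fM: "(\<lambda>\<omega>. f (defect s t \<omega>)) \<in> borel_measurable M" if st: "0 \<le> s" "0 \<le> t" for s t
    proof -
      note [measurable] = vector_defect_measurable[OF st]
      show ?thesis unfolding defect_eq by measurable
    qed
    show "(\<lambda>\<omega>. f (defect s t \<omega>)) \<in> borel_measurable M" if "0 \<le> s \<and> s \<le> t" for s t
      using that by (intro fM) auto
    show "(\<lambda>\<omega>. f (defect s s \<omega>)) = (\<lambda>_. 0)" for s by (simp add: defect_def f.zero)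
    fix t \<eta> \<epsilon> :: real assume e: "0 \<le> t" "0 < \<eta>" "0 < \<epsilon>"
    then have "0 < \<eta> / K" using K by simp
    from vector_defect_integrates_to_zero[OF e(1) this e(3)]
    obtain \<delta> where \<delta>: "0 < \<delta>" "\<And>n p. interval_partition t n p \<and> (\<forall>i<n. p (Suc i) - p i < \<delta>) \<Longrightarrow>
      prob {\<omega>\<in>space M. \<eta> / K \<le> norm (\<Sum>i<n. vector_defect (p i) (p (Suc i)) \<omega>)} < \<epsilon>" by blast
    show "\<exists>\<delta>>0. \<forall>n p. interval_partition t n p \<and> (\<forall>i<n. p (Suc i) - p i < \<delta>) \<longrightarrow>
        prob {\<omega>\<in>space M. \<eta> \<le> \<bar>\<Sum>i<n. f (defect (p i) (p (Suc i)) \<omega>)\<bar>} < \<epsilon>"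
    proof (intro exI[of _ \<delta>] conjI allI impI \<delta>(1))
      fix n p assume p: "interval_partition t n p \<and> (\<forall>i<n. p (Suc i) - p i < \<delta>)"
      have "\<bar>\<Sum>i<n. f (defect (p i) (p (Suc i)) \<omega>)\<bar> \<le> norm (\<Sum>i<n. vector_defect (p i) (p (Suc i)) \<omega>) * K" for \<omega>
        unfolding defect_eq f.sum[symmetric] \<phi>.sum[symmetric] by (rule order_trans[OF f(2) K(2)])
      then have sub: "\<eta> / K \<le> norm (\<Sum>i<n. vector_defect (p i) (p (Suc i)) \<omega>)"
        if "\<eta> \<le> \<bar>\<Sum>i<n. f (defect (p i) (p (Suc i)) \<omega>)\<bar>" for \<omega>
        using K(1) order_trans[OF that] by (simp add: field_simps)
      have "prob {\<omega>\<in>space M. \<eta> \<le> \<bar>\<Sum>i<n. f (defect (p i) (p (Suc i)) \<omega>)\<bar>} \<le>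
          prob {\<omega>\<in>space M. \<eta> / K \<le> norm (\<Sum>i<n. vector_defect (p i) (p (Suc i)) \<omega>)}"
      proof (rule finite_measure_mono)
        have [measurable]: "(\<lambda>\<omega>. \<Sum>i<n. vector_defect (p i) (p (Suc i)) \<omega>) \<in> borel_measurable M"
          using p by (intro borel_measurable_sum vector_defect_measurable interval_partition_bounds(1)[of t n p]) auto
        show "{\<omega>\<in>space M. \<eta> / K \<le> norm (\<Sum>i<n. vector_defect (p i) (p (Suc i)) \<omega>)} \<in> events" by measurable
      qed (use sub in blast)
      then show "prob {\<omega>\<in>space M. \<eta> \<le> \<bar>\<Sum>i<n. f (defect (p i) (p (Suc i)) \<omega>)\<bar>} < \<epsilon>"
        using \<delta>(2)[OF p] by linarith
    qed
  qed
  have "AE \<omega> in M. \<forall>j\<in>UNIV. W j 0 \<omega> = 0"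
    using W by (intro AE_finite_allI) (auto simp: brownian_motion_def)
  with inverse_flow_product_constant[OF zero[OF bounded_linear_Re abs_Re_le_cmod] zero[OF bounded_linear_Im abs_Im_le_cmod]]
    solution_at_0
  show ?thesis
  proof eventually_elim
    case (elim \<omega>)
    have "exp (- exponent T \<omega>) * \<phi> (X T \<omega>) = \<phi> x"
      using elim by (simp add: inverse_flow_def exponent_def)
    then show ?case unfolding exponent_def[symmetric]
      by (simp add: exp_minus field_simps)
  qed
qed

end

end

section \<open>Gaussian moments and the second moment of the solution\<close>

text \<open>Completing the square: an exponential weight shifts the mean of a Gaussian.\<close>

lemma normal_density_tilt:
  assumes "0 < \<sigma>"
  shows "normal_density 0 \<sigma> x * exp (a * x) = exp (a\<^sup>2 * \<sigma>\<^sup>2 / 2) * normal_density (a * \<sigma>\<^sup>2) \<sigma> x"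
proof -
  have "- (x - 0)\<^sup>2 / (2 * \<sigma>\<^sup>2) + a * x = a\<^sup>2 * \<sigma>\<^sup>2 / 2 + - (x - a * \<sigma>\<^sup>2)\<^sup>2 / (2 * \<sigma>\<^sup>2)"
    using assms by (simp add: power2_eq_square field_simps)
  then show ?thesis
    unfolding normal_density_def by (simp add: exp_add[symmetric] mult_ac)
qed

text \<open>The real part of z is absorbed by tilting the density, the imaginary part by the
  characteristic function of the standard normal law; no contour has to be moved.\<close>

lemma normal_complex_exponential_moment:
  fixes z :: complex
  assumes \<sigma>: "0 < \<sigma>"
  shows "integrable lborel (\<lambda>x. normal_density 0 \<sigma> x *\<^sub>R exp (z * of_real x))"
    and "(\<integral>x. normal_density 0 \<sigma> x *\<^sub>R exp (z * of_real x) \<partial>lborel) = exp (z\<^sup>2 * of_real (\<sigma>\<^sup>2) / 2)"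
proof -
  define a b where "a = Re z" and "b = Im z"
  have z: "z = of_real a + \<i> * of_real b" by (simp add: a_def b_def complex_eq)
  have split: "normal_density 0 \<sigma> x *\<^sub>R exp (z * of_real x) =
      exp (a\<^sup>2 * \<sigma>\<^sup>2 / 2) *\<^sub>R (normal_density (a * \<sigma>\<^sup>2) \<sigma> x *\<^sub>R iexp (b * x))" for x
  proof -
    have "exp (z * of_real x) = exp (of_real (a * x)) * iexp (b * x)"
      by (simp add: z distrib_right exp_add mult.assoc)
    then have "exp (z * of_real x) = exp (a * x) *\<^sub>R iexp (b * x)"
      by (simp only: exp_of_real scaleR_conv_of_real)
    then show ?thesis using normal_density_tilt[OF \<sigma>, of x a] by simp
  qed
  have int: "integrable lborel (\<lambda>x. normal_density m \<sigma> x *\<^sub>R iexp (b * x))" for m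
  proof (rule Bochner_Integration.integrable_bound)
    show "integrable lborel (normal_density m \<sigma>)" using \<sigma> by simp
  qed (use \<sigma> in \<open>simp_all add: norm_exp_i_times\<close>)
  show "integrable lborel (\<lambda>x. normal_density 0 \<sigma> x *\<^sub>R exp (z * of_real x))"
    unfolding split by (intro integrable_scaleR_right int)
  have std: "(\<integral>x. std_normal_density x *\<^sub>R iexp (t * x) \<partial>lborel) = of_real (exp (- (t\<^sup>2) / 2))" for t
    using fun_cong[OF char_std_normal_distribution, of t] unfolding char_def
    by (subst (asm) integral_density) auto
  have "(\<integral>x. normal_density (a * \<sigma>\<^sup>2) \<sigma> x *\<^sub>R iexp (b * x) \<partial>lborel) =
      \<bar>\<sigma>\<bar> *\<^sub>R (\<integral>u. normal_density (a * \<sigma>\<^sup>2) \<sigma> (a * \<sigma>\<^sup>2 + \<sigma> * u) *\<^sub>R iexp (b * (a * \<sigma>\<^sup>2 + \<sigma> * u)) \<partial>lborel)"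
    using \<sigma> by (intro lborel_integral_real_affine) simp
  also have "\<dots> = (\<integral>u. iexp (a * b * \<sigma>\<^sup>2) * (std_normal_density u *\<^sub>R iexp (b * \<sigma> * u)) \<partial>lborel)"
  proof -
    have "\<bar>\<sigma>\<bar> *\<^sub>R (normal_density (a * \<sigma>\<^sup>2) \<sigma> (a * \<sigma>\<^sup>2 + \<sigma> * u) *\<^sub>R iexp (b * (a * \<sigma>\<^sup>2 + \<sigma> * u))) =
        iexp (a * b * \<sigma>\<^sup>2) * (std_normal_density u *\<^sub>R iexp (b * \<sigma> * u))" for u
    proof -
      have "\<sigma> * normal_density (a * \<sigma>\<^sup>2) \<sigma> (a * \<sigma>\<^sup>2 + \<sigma> * u) = std_normal_density u"
        using \<sigma> unfolding normal_density_def by (simp add: real_sqrt_mult power_mult_distrib field_simps)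
      moreover have "iexp (b * (a * \<sigma>\<^sup>2 + \<sigma> * u)) = iexp (a * b * \<sigma>\<^sup>2) * iexp (b * \<sigma> * u)"
        by (simp add: exp_add[symmetric] algebra_simps)
      ultimately show ?thesis using \<sigma> by simp
    qed
    then show ?thesis by (subst integral_scaleR_right[symmetric]) (simp only:)
  qed
  also have "\<dots> = iexp (a * b * \<sigma>\<^sup>2) * of_real (exp (- ((b * \<sigma>)\<^sup>2) / 2))"
    by (simp only: integral_mult_right_zero std)
  finally have "(\<integral>x. normal_density 0 \<sigma> x *\<^sub>R exp (z * of_real x) \<partial>lborel) =
      exp (a\<^sup>2 * \<sigma>\<^sup>2 / 2) *\<^sub>R (iexp (a * b * \<sigma>\<^sup>2) * of_real (exp (- ((b * \<sigma>)\<^sup>2) / 2)))"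
    unfolding split integral_scaleR_right by simp
  also have "\<dots> = exp (of_real (a\<^sup>2 * \<sigma>\<^sup>2 / 2) + \<i> * of_real (a * b * \<sigma>\<^sup>2) + of_real (- ((b * \<sigma>)\<^sup>2) / 2))"
    by (simp only: exp_add exp_of_real scaleR_conv_of_real mult.assoc)
  also have "of_real (a\<^sup>2 * \<sigma>\<^sup>2 / 2) + \<i> * of_real (a * b * \<sigma>\<^sup>2) + of_real (- ((b * \<sigma>)\<^sup>2) / 2) = z\<^sup>2 * of_real (\<sigma>\<^sup>2) / 2"
    by (simp add: z complex_eq_iff power2_eq_square field_simps)
  finally show "(\<integral>x. normal_density 0 \<sigma> x *\<^sub>R exp (z * of_real x) \<partial>lborel) = exp (z\<^sup>2 * of_real (\<sigma>\<^sup>2) / 2)" .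
qed

context usual_filtered_prob_space
begin

lemma brownian_motion_distributed:
  "brownian_motion M F W \<Longrightarrow> 0 \<le> s \<Longrightarrow> s < t \<Longrightarrow>
    distributed M lborel (\<lambda>\<omega>. W t \<omega> - W s \<omega>) (normal_density 0 (sqrt (t - s)))"
  by (simp add: brownian_motion_def)

text \<open>The definition provides the law of increments only, so \<open>W t\<close> is replaced by
  \<open>W t - W 0\<close>, which agrees with it almost surely.\<close>

lemma brownian_motion_exponential_moment:
  fixes z :: complex
  assumes W: "brownian_motion M F W" and t: "0 < t"
  shows "integrable M (\<lambda>\<omega>. exp (z * of_real (W t \<omega>)))"
    and "(\<integral>\<omega>. exp (z * of_real (W t \<omega>)) \<partial>M) = exp (z\<^sup>2 * of_real t / 2)"
proof -
  let ?D = "\<lambda>\<omega>. W t \<omega> - W 0 \<omega>" and ?e = "\<lambda>x. exp (z * of_real x)"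
  have D: "distributed M lborel ?D (normal_density 0 (sqrt t))"
    using brownian_motion_distributed[OF W order_refl t] by (simp only: diff_zero)
  have \<sigma>: "0 < sqrt t" using t by simp
  have [measurable]: "?D \<in> borel_measurable M" using distributed_measurable[OF D] by simp
  have [measurable]: "W t \<in> borel_measurable M"
    using t by (intro measurable_F_M[OF brownian_motion_measurable[OF W _ order_refl]]) auto
  have [measurable]: "?e \<in> borel_measurable borel"
    by (intro borel_measurable_continuous_onI continuous_intros)
  have eM: "(\<lambda>\<omega>. ?e (W t \<omega>)) \<in> borel_measurable M" "(\<lambda>\<omega>. ?e (?D \<omega>)) \<in> borel_measurable M"
    by measurable
  have eq: "AE \<omega> in M. ?e (W t \<omega>) = ?e (?D \<omega>)"
    using W unfolding brownian_motion_def by (auto elim!: eventually_mono)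
  have distr: "distr M lborel ?D = density lborel (\<lambda>x. ennreal (normal_density 0 (sqrt t) x))"
    by (rule distributed_distr_eq_density[OF D])
  have "integrable (density lborel (\<lambda>x. ennreal (normal_density 0 (sqrt t) x))) ?e"
    by (subst integrable_density) (auto intro: normal_complex_exponential_moment[OF \<sigma>])
  then have "integrable M (\<lambda>\<omega>. ?e (?D \<omega>))"
    unfolding distr[symmetric] by (subst (asm) integrable_distr_eq) auto
  then show "integrable M (\<lambda>\<omega>. ?e (W t \<omega>))"
    by (simp only: integrable_cong_AE[OF eM eq])
  have "(\<integral>\<omega>. ?e (W t \<omega>) \<partial>M) = (\<integral>\<omega>. ?e (?D \<omega>) \<partial>M)"
    by (rule integral_cong_AE[OF eM eq])
  also have "\<dots> = (\<integral>x. ?e x \<partial>distr M lborel ?D)"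
    by (subst integral_distr) auto
  also have "\<dots> = (\<integral>x. normal_density 0 (sqrt t) x *\<^sub>R ?e x \<partial>lborel)"
    unfolding distr by (subst integral_density) auto
  also have "\<dots> = exp (z\<^sup>2 * of_real t / 2)"
    using t by (simp only: normal_complex_exponential_moment(2)[OF \<sigma>] real_sqrt_pow2 less_imp_le)
  finally show "(\<integral>\<omega>. ?e (W t \<omega>) \<partial>M) = exp (z\<^sup>2 * of_real t / 2)" .
qed

lemma independent_exponential_moment:
  fixes z :: "'l::finite \<Rightarrow> complex"
  assumes W: "independent_brownian_motions M F W" and t: "0 < t"
  shows "integrable M (\<lambda>\<omega>. exp (c + (\<Sum>j\<in>UNIV. z j * of_real (W j t \<omega>))))"
    and "(\<integral>\<omega>. exp (c + (\<Sum>j\<in>UNIV. z j * of_real (W j t \<omega>))) \<partial>M) =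
      exp (c + (\<Sum>j\<in>UNIV. (z j)\<^sup>2) * of_real t / 2)"
proof -
  have bm: "brownian_motion M F (W j)" for j using W by (simp add: independent_brownian_motions_def)
  \<comment> \<open>Independence of the paths passes to their values at time t by composition with
    the evaluation map.\<close>
  have "indep_vars (\<lambda>_. borel) (\<lambda>j \<omega>. exp (z j * of_real ((\<lambda>s\<in>{0..}. W j s \<omega>) t))) UNIV"
  proof (rule indep_vars_compose2[where Y = "\<lambda>j f. exp (z j * of_real (f t))"])
    show "indep_vars (\<lambda>_. PiM {0..} (\<lambda>_. borel)) (\<lambda>j \<omega>. \<lambda>t\<in>{0..}. W j t \<omega>) UNIV"
      using W by (simp add: independent_brownian_motions_def)
    fix j
    have [measurable]: "(\<lambda>x. exp (z j * complex_of_real x)) \<in> borel_measurable borel"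
      by (intro borel_measurable_continuous_onI continuous_intros)
    have [measurable]: "(\<lambda>f. f t) \<in> borel_measurable (PiM {0..} (\<lambda>_. borel :: real measure))"
      using t by (intro measurable_component_singleton) auto
    show "(\<lambda>f. exp (z j * complex_of_real (f t))) \<in> borel_measurable (PiM {0..} (\<lambda>_. borel))" by measurable
  qed
  then have ind: "indep_vars (\<lambda>_. borel) (\<lambda>j \<omega>. exp (z j * of_real (W j t \<omega>))) UNIV" using t by simp
  have eq: "exp (c + (\<Sum>j\<in>UNIV. z j * of_real (W j t \<omega>))) = exp c * (\<Prod>j\<in>UNIV. exp (z j * of_real (W j t \<omega>)))" for \<omega>
    by (simp add: exp_add exp_sum)
  note mom = brownian_motion_exponential_moment[OF bm t]
  show "integrable M (\<lambda>\<omega>. exp (c + (\<Sum>j\<in>UNIV. z j * of_real (W j t \<omega>))))"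
    unfolding eq by (intro integrable_mult_right indep_vars_integrable ind mom(1) finite)
  have "(\<integral>\<omega>. exp (c + (\<Sum>j\<in>UNIV. z j * of_real (W j t \<omega>))) \<partial>M) =
      exp c * (\<Prod>j\<in>UNIV. exp ((z j)\<^sup>2 * of_real t / 2))"
    unfolding eq integral_mult_right_zero
    by (subst indep_vars_lebesgue_integral[OF finite ind mom(1)]) (simp only: mom(2))
  also have "\<dots> = exp (c + (\<Sum>j\<in>UNIV. (z j)\<^sup>2) * of_real t / 2)"
    by (simp add: exp_add exp_sum[symmetric] sum_distrib_right sum_divide_distrib)
  finally show "(\<integral>\<omega>. exp (c + (\<Sum>j\<in>UNIV. z j * of_real (W j t \<omega>))) \<partial>M) =
      exp (c + (\<Sum>j\<in>UNIV. (z j)\<^sup>2) * of_real t / 2)" .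
qed

end

text \<open>The exponent of the mixed moment of components i and k of \<open>P X\<close>: the
  quadratic term comes from the Gaussian moments. Its imaginary part is the frequency of the
  oscillation.\<close>

definition complex_rate :: "('d \<Rightarrow> complex) \<Rightarrow> ('d \<Rightarrow> 'l::finite \<Rightarrow> complex) \<Rightarrow> 'd \<Rightarrow> 'd \<Rightarrow> complex" where
  "complex_rate \<alpha> \<beta> i k = cnj (\<alpha> i) + \<alpha> k + (1/2) * (\<Sum>j\<in>UNIV. (cnj (\<beta> i j) + \<beta> k j)\<^sup>2)"

lemma Re_complex_rate: "Re (complex_rate \<alpha> \<beta> i k) = rate \<alpha> \<beta> i k"
  by (simp add: complex_rate_def rate_def)

section \<open>Algebra in the common eigenbasis\<close>

lemma complex_vec_matrix_vector_mult: "complex_vec (A *v v) = complex_mat A *v complex_vec v"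
  by (simp add: vec_eq_iff complex_vec_def matrix_vector_mult_def map_matrix_def)

lemma matrix_inv_inverse:
  assumes "invertible A"
  shows "A ** matrix_inv A = mat 1" "matrix_inv A ** A = mat 1"
  using someI_ex[OF assms[unfolded invertible_def]] unfolding matrix_inv_def by auto

lemma matrix_inv_mult_vec:
  fixes P :: "complex^'d^'d"
  assumes "invertible P"
  shows "matrix_inv P *v (P *v v) = v"
  using matrix_inv_inverse(2)[OF assms] by (simp add: matrix_vector_mul_assoc)

lemma eigencomponent:
  fixes P :: "complex^'d^'d" and A :: "real^'d^'d"
  assumes P: "invertible P" and diag: "P ** complex_mat A ** matrix_inv P = diag_mat \<alpha>"
  shows "(P *v complex_vec (A *v v)) $ i = \<alpha> i * (P *v complex_vec v) $ i"
proof -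
  have "P *v complex_vec (A *v v) = P *v (complex_mat A *v (matrix_inv P *v (P *v complex_vec v)))"
    by (simp add: complex_vec_matrix_vector_mult matrix_inv_mult_vec[OF P])
  also have "\<dots> = diag_mat \<alpha> *v (P *v complex_vec v)"
    unfolding diag[symmetric] matrix_vector_mul_assoc by (simp only: matrix_mul_assoc)
  also have "\<dots> $ i = \<alpha> i * (P *v complex_vec v) $ i"
    by (simp add: diag_mat_def matrix_vector_mult_def if_distrib[of "\<lambda>x. x * _"] sum.delta cong: if_cong)
  finally show ?thesis .
qed

lemma bounded_linear_component:
  fixes P :: "complex^'d^'d"
  shows "bounded_linear (\<lambda>v. (P *v complex_vec v) $ i)"
proof -
  have eq: "(P *v complex_vec v) $ i = (\<Sum>k\<in>UNIV. P $ i $ k * of_real (v $ k))" for v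
    by (simp add: matrix_vector_mult_def complex_vec_def)
  show ?thesis unfolding eq
    by (intro bounded_linear_sum bounded_linear_const_mult
        bounded_linear_compose[OF bounded_linear_of_real bounded_linear_vec_nth])
qed

text \<open>\<open>v\<close> is the image of \<open>P v\<close> under the inverse of P, and
  \<open>Gram P\<close> collects the inner products of the columns of that inverse.\<close>

lemma norm_square_Gram:
  fixes P :: "complex^'d^'d"
  assumes P: "invertible P"
  shows "complex_of_real ((norm v)\<^sup>2) = (\<Sum>i\<in>UNIV. \<Sum>k\<in>UNIV. pair_coeff P v i k)"
proof -
  let ?Q = "matrix_inv P" and ?y = "P *v complex_vec v"
  have comp: "complex_of_real (v $ l) = (\<Sum>i\<in>UNIV. ?Q $ l $ i * ?y $ i)" for l
    using arg_cong[OF matrix_inv_mult_vec[OF P, of "complex_vec v"], of "\<lambda>u. u $ l"]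
    by (simp add: matrix_vector_mult_def[of ?Q] complex_vec_def[of v])
  have "complex_of_real ((norm v)\<^sup>2) = (\<Sum>l\<in>UNIV. cnj (complex_of_real (v $ l)) * complex_of_real (v $ l))"
    by (simp add: power2_norm_eq_inner inner_vec_def)
  also have "\<dots> = (\<Sum>l\<in>UNIV. \<Sum>i\<in>UNIV. \<Sum>k\<in>UNIV. cnj (?Q $ l $ i) * cnj (?y $ i) * (?Q $ l $ k * ?y $ k))"
    unfolding comp by (simp add: sum_product)
  also have "\<dots> = (\<Sum>i\<in>UNIV. \<Sum>k\<in>UNIV. \<Sum>l\<in>UNIV. cnj (?Q $ l $ i) * cnj (?y $ i) * (?Q $ l $ k * ?y $ k))"
    by (subst sum.swap) (intro sum.cong refl sum.swap)
  also have "\<dots> = (\<Sum>i\<in>UNIV. \<Sum>k\<in>UNIV. pair_coeff P v i k)"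
    by (intro sum.cong refl) (simp add: pair_coeff_def Let_def Gram_def conjugate_transpose_def
        matrix_matrix_mult_def sum_distrib_left sum_distrib_right mult_ac)
  finally show ?thesis .
qed

lemma pair_coeff_swap: "pair_coeff P x k i = cnj (pair_coeff P x i k)"
  by (simp add: pair_coeff_def Let_def Gram_def conjugate_transpose_def matrix_matrix_mult_def
      cnj_sum mult_ac)

lemma rate_swap: "rate \<alpha> \<beta> k i = rate \<alpha> \<beta> i k"
proof -
  have "(cnj (\<beta> k j) + \<beta> i j)\<^sup>2 = cnj ((cnj (\<beta> i j) + \<beta> k j)\<^sup>2)" for j by (simp add: add.commute)
  then have "(\<Sum>j\<in>UNIV. (cnj (\<beta> k j) + \<beta> i j)\<^sup>2) = cnj (\<Sum>j\<in>UNIV. (cnj (\<beta> i j) + \<beta> k j)\<^sup>2)"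
    by (simp only: cnj_sum)
  moreover have "Re (u + v + 1 / 2 * s) = Re u + Re v + Re s / 2" for u v s :: complex by simp
  ultimately show ?thesis
    unfolding rate_def by (simp only: cnj.simps add.commute)
qed

text \<open>The drift parts on both sides agree. For each j the difference of the squares is a sum
  of squares of Re u - Re v and Im u - Im v. This is what forces the slowest rate to occur on the
  diagonal.\<close>

lemma rate_le_diagonal: "2 * rate \<alpha> \<beta> i k \<le> rate \<alpha> \<beta> i i + rate \<alpha> \<beta> k k"
proof -
  have pt: "2 * Re ((cnj u + v)\<^sup>2) \<le> Re ((cnj u + u)\<^sup>2) + Re ((cnj v + v)\<^sup>2)" for u v :: complex
    using zero_le_power2[of "Re u - Re v"] zero_le_power2[of "Im u - Im v"]
    by (simp add: power2_eq_square algebra_simps)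
  have "(\<Sum>j\<in>UNIV. 2 * Re ((cnj (\<beta> i j) + \<beta> k j)\<^sup>2)) \<le>
      (\<Sum>j\<in>UNIV. Re ((cnj (\<beta> i j) + \<beta> i j)\<^sup>2) + Re ((cnj (\<beta> k j) + \<beta> k j)\<^sup>2))"
    by (intro sum_mono pt)
  then show ?thesis by (simp add: rate_def sum.distrib sum_distrib_left[symmetric])
qed

text \<open>The diagonal entry of the Gram matrix is the squared length of a column of an invertible
  matrix.\<close>

lemma pair_coeff_diagonal_nonzero:
  fixes P :: "complex^'d^'d"
  assumes P: "invertible P" and y: "(P *v complex_vec x) $ i \<noteq> 0"
  shows "pair_coeff P x i i \<noteq> 0"
proof -
  let ?Q = "matrix_inv P"
  have "Gram P $ i $ i = of_real (\<Sum>l\<in>UNIV. (cmod (?Q $ l $ i))\<^sup>2)"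
    unfolding of_real_sum complex_norm_square
    by (simp add: Gram_def conjugate_transpose_def matrix_matrix_mult_def mult.commute)
  moreover have "(\<Sum>l\<in>UNIV. (cmod (?Q $ l $ i))\<^sup>2) \<noteq> 0"
  proof
    assume "(\<Sum>l\<in>UNIV. (cmod (?Q $ l $ i))\<^sup>2) = 0"
    then have z: "?Q $ l $ i = 0" for l by (simp add: sum_nonneg_eq_0_iff)
    have "(P ** ?Q) $ i $ i = 0" unfolding matrix_matrix_mult_def by (simp add: z)
    then show False using matrix_inv_inverse(1)[OF P] by (simp add: mat_def)
  qed
  ultimately have "Gram P $ i $ i \<noteq> 0" by (simp only: of_real_eq_0_iff not_False_eq_True)
  then show ?thesis using y by (simp add: pair_coeff_def Let_def)
qed

context usual_filtered_prob_space
begin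

text \<open>The first two parts come from the explicit components and the Gram expansion of the
  norm. The third keeps a single component, dominated by the norm of X: it excludes that the
  oscillating terms cancel in the long run.\<close>

lemma second_moment:
  fixes W :: "'l::finite \<Rightarrow> real \<Rightarrow> 'a \<Rightarrow> real" and A :: "real^'d^'d" and P :: "complex^'d^'d"
  assumes W: "independent_brownian_motions M F W" and X: "stratonovich_solution M F W A B x X"
    and P: "invertible P" and A: "P ** complex_mat A ** matrix_inv P = diag_mat \<alpha>"
    and B: "\<And>j. P ** complex_mat (B j) ** matrix_inv P = diag_mat (\<lambda>i. \<beta> i j)"
  shows "0 < t \<Longrightarrow> integrable M (\<lambda>\<omega>. (norm (X t \<omega>))\<^sup>2)"
    and "0 < t \<Longrightarrow> complex_of_real (\<integral>\<omega>. (norm (X t \<omega>))\<^sup>2 \<partial>M) =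
      (\<Sum>i\<in>UNIV. \<Sum>k\<in>UNIV. pair_coeff P x i k * exp (complex_rate \<alpha> \<beta> i k * of_real t))"
    and "\<exists>C>0. \<forall>t>0. C * (cmod ((P *v complex_vec x) $ i))\<^sup>2 * exp (rate \<alpha> \<beta> i i * t)
      \<le> (\<integral>\<omega>. (norm (X t \<omega>))\<^sup>2 \<partial>M)"
proof -
  have bm: "brownian_motion M F (W j)" for j using W by (simp add: independent_brownian_motions_def)
  let ?y = "P *v complex_vec x"
  let ?Y = "\<lambda>t i \<omega>. (P *v complex_vec (X t \<omega>)) $ i"
  let ?E = "\<lambda>t i k \<omega>. exp ((cnj (\<alpha> i) + \<alpha> k) * of_real t + (\<Sum>j\<in>UNIV. (cnj (\<beta> i j) + \<beta> k j) * of_real (W j t \<omega>)))"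
  have Y: "AE \<omega> in M. ?Y t i \<omega> = ?y $ i * exp (\<alpha> i * of_real t + (\<Sum>j\<in>UNIV. \<beta> i j * of_real (W j t \<omega>)))"
    if "0 < t" for i t
    by (rule eigenfunctional_of_solution[OF bm X bounded_linear_component eigencomponent[OF P A] eigencomponent[OF P B] that])
  have YY: "AE \<omega> in M. \<forall>i\<in>UNIV. \<forall>k\<in>UNIV. cnj (?Y t i \<omega>) * ?Y t k \<omega> = cnj (?y $ i) * ?y $ k * ?E t i k \<omega>"
    if t: "0 < t" for t
  proof -
    have "AE \<omega> in M. \<forall>i\<in>UNIV. ?Y t i \<omega> = ?y $ i * exp (\<alpha> i * of_real t + (\<Sum>j\<in>UNIV. \<beta> i j * of_real (W j t \<omega>)))"
      by (intro AE_finite_allI Y t) simp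
    then show ?thesis
    proof eventually_elim
      case (elim \<omega>)
      show ?case
      proof (intro ballI)
        fix i k
        have E: "?E t i k \<omega> = exp (cnj (\<alpha> i * of_real t + (\<Sum>j\<in>UNIV. \<beta> i j * of_real (W j t \<omega>))))
            * exp (\<alpha> k * of_real t + (\<Sum>j\<in>UNIV. \<beta> k j * of_real (W j t \<omega>)))"
          unfolding exp_add[symmetric] by (simp add: cnj_sum distrib_right sum.distrib add_ac)
        show "cnj (?Y t i \<omega>) * ?Y t k \<omega> = cnj (?y $ i) * ?y $ k * ?E t i k \<omega>"
          using elim unfolding E by (simp only: complex_cnj_mult exp_cnj UNIV_I) (simp add: mult_ac)
      qed
    qed
  qed
  have E_int: "integrable M (?E t i k)" and E_val: "(\<integral>\<omega>. ?E t i k \<omega> \<partial>M) = exp (complex_rate \<alpha> \<beta> i k * of_real t)"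
    if t: "0 < t" for t i k
  proof -
    note mom = independent_exponential_moment[OF W t, of "(cnj (\<alpha> i) + \<alpha> k) * of_real t" "\<lambda>j. cnj (\<beta> i j) + \<beta> k j"]
    show "integrable M (?E t i k)" by (rule mom(1))
    have "(cnj (\<alpha> i) + \<alpha> k) * of_real t + (\<Sum>j\<in>UNIV. (cnj (\<beta> i j) + \<beta> k j)\<^sup>2) * of_real t / 2 =
        complex_rate \<alpha> \<beta> i k * of_real t"
      unfolding complex_rate_def distrib_right by simp
    then show "(\<integral>\<omega>. ?E t i k \<omega> \<partial>M) = exp (complex_rate \<alpha> \<beta> i k * of_real t)"
      using mom(2) by (simp only:)
  qed
  have pc: "pair_coeff P v i k = Gram P $ i $ k * (cnj ((P *v complex_vec v) $ i) * (P *v complex_vec v) $ k)" for v i k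
    by (simp add: pair_coeff_def Let_def mult_ac)
  have [measurable]: "X t \<in> borel_measurable M" if "0 < t" for t
  proof (rule measurable_F_M)
    show "X t \<in> borel_measurable (F t)" using X that by (simp add: stratonovich_solution_def adapted_def)
  qed
  have norm_eq: "AE \<omega> in M. complex_of_real ((norm (X t \<omega>))\<^sup>2) =
      (\<Sum>i\<in>UNIV. \<Sum>k\<in>UNIV. pair_coeff P x i k * ?E t i k \<omega>)" if t: "0 < t" for t
    using YY[OF t]
  proof eventually_elim
    case (elim \<omega>)
    have "pair_coeff P (X t \<omega>) i k = pair_coeff P x i k * ?E t i k \<omega>" for i k
      using elim unfolding pc by (simp only: UNIV_I mult.assoc)
    then show ?case unfolding norm_square_Gram[OF P] by (intro sum.cong refl)
  qed
  have sum_int: "integrable M (\<lambda>\<omega>. \<Sum>i\<in>UNIV. \<Sum>k\<in>UNIV. pair_coeff P x i k * ?E t i k \<omega>)" if "0 < t" for t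
    by (intro Bochner_Integration.integrable_sum integrable_mult_right E_int that)
  have cint: "integrable M (\<lambda>\<omega>. complex_of_real ((norm (X t \<omega>))\<^sup>2))" if t: "0 < t" for t
    using sum_int[OF t] integrable_cong_AE[OF _ borel_measurable_integrable[OF sum_int[OF t]] norm_eq[OF t]] t
    by simp
  then have nint: "integrable M (\<lambda>\<omega>. (norm (X t \<omega>))\<^sup>2)" if t: "0 < t" for t
    using that by (simp only: complex_of_real_integrable_eq)
  show "0 < t \<Longrightarrow> integrable M (\<lambda>\<omega>. (norm (X t \<omega>))\<^sup>2)" by (rule nint)
  show "complex_of_real (\<integral>\<omega>. (norm (X t \<omega>))\<^sup>2 \<partial>M) =
      (\<Sum>i\<in>UNIV. \<Sum>k\<in>UNIV. pair_coeff P x i k * exp (complex_rate \<alpha> \<beta> i k * of_real t))" if t: "0 < t"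
  proof -
    have "complex_of_real (\<integral>\<omega>. (norm (X t \<omega>))\<^sup>2 \<partial>M) = (\<integral>\<omega>. complex_of_real ((norm (X t \<omega>))\<^sup>2) \<partial>M)"
      by (rule integral_complex_of_real[symmetric])
    also have "\<dots> = (\<integral>\<omega>. (\<Sum>i\<in>UNIV. \<Sum>k\<in>UNIV. pair_coeff P x i k * ?E t i k \<omega>) \<partial>M)"
      using t by (intro integral_cong_AE[OF _ borel_measurable_integrable[OF sum_int[OF t]] norm_eq[OF t]]) simp
    also have "\<dots> = (\<Sum>i\<in>UNIV. \<Sum>k\<in>UNIV. pair_coeff P x i k * exp (complex_rate \<alpha> \<beta> i k * of_real t))"
      by (simp only: Bochner_Integration.integral_sum Bochner_Integration.integrable_sum integrable_mult_right E_int[OF t]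
          integral_mult_right_zero E_val[OF t])
    finally show ?thesis .
  qed
  obtain K where K: "0 < K" "\<And>v. cmod ((P *v complex_vec v) $ i) \<le> norm v * K"
    using bounded_linear.pos_bounded[OF bounded_linear_component[of P i]] by blast
  show "\<exists>C>0. \<forall>t>0. C * (cmod (?y $ i))\<^sup>2 * exp (rate \<alpha> \<beta> i i * t) \<le> (\<integral>\<omega>. (norm (X t \<omega>))\<^sup>2 \<partial>M)"
  proof (intro exI[of _ "1 / K\<^sup>2"] conjI allI impI)
    fix t :: real assume t: "0 < t"
    \<comment> \<open>Diagonal exponents are real, so the second moment of one component is a pure
      exponential without oscillation.\<close>
    have real: "complex_rate \<alpha> \<beta> i i = of_real (rate \<alpha> \<beta> i i)"
      by (simp add: complex_eq_iff Re_complex_rate) (simp add: complex_rate_def power2_eq_square)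
    have int: "integrable M (\<lambda>\<omega>. cnj (?y $ i) * ?y $ i * ?E t i i \<omega>)" by (intro integrable_mult_right E_int t)
    have eq: "AE \<omega> in M. complex_of_real ((cmod (?Y t i \<omega>))\<^sup>2) = cnj (?y $ i) * ?y $ i * ?E t i i \<omega>"
      using YY[OF t] by eventually_elim (simp add: complex_norm_square mult.commute del: of_real_power)
    have cont: "continuous_on UNIV (\<lambda>v. (P *v complex_vec v) $ i)"
      by (rule linear_continuous_on[OF bounded_linear_component])
    note [measurable] = borel_measurable_continuous_onI[OF cont]
    have YM[measurable]: "?Y t i \<in> borel_measurable M" using t by measurable
    have Yint: "integrable M (\<lambda>\<omega>. complex_of_real ((cmod (?Y t i \<omega>))\<^sup>2))"
      using int integrable_cong_AE[OF _ borel_measurable_integrable[OF int] eq] by simp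
    have "complex_of_real (\<integral>\<omega>. (cmod (?Y t i \<omega>))\<^sup>2 \<partial>M) = (\<integral>\<omega>. complex_of_real ((cmod (?Y t i \<omega>))\<^sup>2) \<partial>M)"
      by (rule integral_complex_of_real[symmetric])
    also have "\<dots> = (\<integral>\<omega>. cnj (?y $ i) * ?y $ i * ?E t i i \<omega> \<partial>M)"
      by (intro integral_cong_AE[OF _ borel_measurable_integrable[OF int] eq]) simp
    also have "\<dots> = cnj (?y $ i) * ?y $ i * exp (complex_rate \<alpha> \<beta> i i * of_real t)"
      by (simp only: integral_mult_right_zero E_val[OF t])
    also have "\<dots> = complex_of_real ((cmod (?y $ i))\<^sup>2 * exp (rate \<alpha> \<beta> i i * t))"
      unfolding real of_real_mult complex_norm_square by (simp add: mult_ac exp_of_real flip: of_real_mult)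
    finally have val: "(\<integral>\<omega>. (cmod (?Y t i \<omega>))\<^sup>2 \<partial>M) = (cmod (?y $ i))\<^sup>2 * exp (rate \<alpha> \<beta> i i * t)"
      by (simp only: of_real_eq_iff)
    have "(\<integral>\<omega>. (cmod (?Y t i \<omega>))\<^sup>2 \<partial>M) \<le> (\<integral>\<omega>. K\<^sup>2 * (norm (X t \<omega>))\<^sup>2 \<partial>M)"
    proof (rule integral_mono)
      show "integrable M (\<lambda>\<omega>. (cmod (?Y t i \<omega>))\<^sup>2)" using Yint by (simp only: complex_of_real_integrable_eq)
      show "integrable M (\<lambda>\<omega>. K\<^sup>2 * (norm (X t \<omega>))\<^sup>2)" by (intro integrable_mult_right nint t)
      show "(cmod (?Y t i \<omega>))\<^sup>2 \<le> K\<^sup>2 * (norm (X t \<omega>))\<^sup>2" for \<omega>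
        using power_mono[OF K(2)[of "X t \<omega>"], of 2] by (simp add: power_mult_distrib mult.commute)
    qed
    then show "1 / K\<^sup>2 * (cmod (?y $ i))\<^sup>2 * exp (rate \<alpha> \<beta> i i * t) \<le> (\<integral>\<omega>. (norm (X t \<omega>))\<^sup>2 \<partial>M)"
      using K(1) unfolding val by (simp add: field_simps)
  qed (use K in simp)
qed

end

section \<open>Limits of exponential sums\<close>

lemma Liminf_filtermap:
  fixes g :: "_ \<Rightarrow> 'b :: complete_linorder"
  shows "Liminf (filtermap f F) g = Liminf F (\<lambda>x. g (f x))"
proof -
  have "C \<le> Liminf (filtermap f F) g \<longleftrightarrow> C \<le> Liminf F (\<lambda>x. g (f x))" for C
    by (simp add: le_Liminf_iff eventually_filtermap)
  then show ?thesis by (meson order_antisym order_refl)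
qed

lemma Liminf_le_if_diff_vanishes:
  fixes f g :: "'a \<Rightarrow> real"
  assumes "((\<lambda>x. f x - g x) \<longlongrightarrow> 0) F"
  shows "Liminf F (\<lambda>x. ereal (g x)) \<le> Liminf F (\<lambda>x. ereal (f x))"
  unfolding le_Liminf_iff
proof (intro allI impI)
  fix y assume "y < Liminf F (\<lambda>x. ereal (g x))"
  then obtain z2 where z2: "y < ereal z2" "ereal z2 < Liminf F (\<lambda>x. ereal (g x))" using ereal_dense2 by blast
  \<comment> \<open>Two reals are squeezed in below the lower limit; the gap between them absorbs
    the vanishing difference.\<close>
  then obtain z1 where z1: "y < ereal z1" "ereal z1 < ereal z2" using ereal_dense2 by blast
  then have "0 < z2 - z1" by simp
  from less_LiminfD[OF z2(2)] tendstoD[OF assms this]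
  show "\<forall>\<^sub>F x in F. y < ereal (f x)"
  proof eventually_elim
    case (elim x)
    then have "z1 < f x" by (auto simp: dist_real_def abs_if split: if_splits)
    then show ?case using z1(1) by (metis less_ereal.simps(1) order_less_trans)
  qed
qed

lemma Liminf_eq_if_diff_vanishes:
  fixes f g :: "'a \<Rightarrow> real"
  assumes "((\<lambda>x. f x - g x) \<longlongrightarrow> 0) F"
  shows "Liminf F (\<lambda>x. ereal (f x)) = Liminf F (\<lambda>x. ereal (g x))"
proof (rule antisym)
  have "((\<lambda>x. - (f x - g x)) \<longlongrightarrow> - 0) F" by (rule tendsto_minus[OF assms])
  then show "Liminf F (\<lambda>x. ereal (f x)) \<le> Liminf F (\<lambda>x. ereal (g x))"
    by (intro Liminf_le_if_diff_vanishes) simp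
qed (rule Liminf_le_if_diff_vanishes[OF assms])

text \<open>An equality of filters rather than a mere limit, so lower limits are transferred
  exactly. It holds for every shift s, which is why the oscillation has the same limits for all
  r.\<close>

lemma filtermap_time_scale:
  assumes q: "0 < q"
  shows "filtermap (\<lambda>\<epsilon>. time_scale q \<epsilon> + s) (at_right 0) = at_top"
proof (rule filtermap_fun_inverse)
  show "filterlim (\<lambda>t. exp (- q * (t - s))) (at_right 0) at_top"
    using q by real_asymp
  show "filterlim (\<lambda>\<epsilon>. time_scale q \<epsilon> + s) at_top (at_right 0)"
    unfolding time_scale_def using q by real_asymp
  show "\<forall>\<^sub>F t in at_top. time_scale q (exp (- q * (t - s))) + s = t"
  proof (intro always_eventually allI)
    fix t
    have "1 / exp (- q * (t - s)) = exp (q * (t - s))" by (simp add: exp_minus inverse_eq_divide)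
    then show "time_scale q (exp (- q * (t - s))) + s = t" using q by (simp only: time_scale_def ln_exp) simp
  qed
qed

text \<open>One common angle is enough: each phase first turns its coefficient to the positive axis
  and then rotates it by \<open>arccos s\<close>, so that every term is the fraction s of its
  maximum.\<close>

lemma phases_realize_value:
  fixes c :: "'d::finite \<Rightarrow> 'd \<Rightarrow> complex"
  assumes v: "0 \<le> v" "v \<le> 2 * (\<Sum>(i, k)\<in>J. cmod (c i k))"
  shows "\<exists>\<phi>. (\<Sum>(i, k)\<in>J. 2 * Re (c i k * exp (\<i> * complex_of_real (\<phi> i k)))) = v"
proof -
  define S where "S = 2 * (\<Sum>(i, k)\<in>J. cmod (c i k))"
  \<comment> \<open>If S = 0, then v = 0 too, and division by zero gives the appropriate s =
    0.\<close>
  define s where "s = v / S"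
  have s: "0 \<le> s" "s \<le> 1" "s * S = v"
    using v by (auto simp: s_def S_def divide_le_eq_1)
  define \<phi> where "\<phi> i k = arccos s - Arg (c i k)" for i k
  have "Re (c i k * exp (\<i> * complex_of_real (\<phi> i k))) = cmod (c i k) * s" for i k
  proof (cases "c i k = 0")
    case False
    have "c i k * exp (\<i> * complex_of_real (\<phi> i k)) =
        of_real (cmod (c i k)) * (exp (\<i> * Arg (c i k)) * exp (\<i> * complex_of_real (\<phi> i k)))"
      using Arg_eq[OF False] by (metis mult.assoc)
    also have "exp (\<i> * Arg (c i k)) * exp (\<i> * complex_of_real (\<phi> i k)) = exp (\<i> * complex_of_real (arccos s))"
      by (simp add: \<phi>_def exp_add[symmetric] algebra_simps)
    finally show ?thesis using s by (simp add: Re_exp)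
  qed simp
  then have "(\<Sum>(i, k)\<in>J. 2 * Re (c i k * exp (\<i> * complex_of_real (\<phi> i k)))) = s * S"
    by (simp add: S_def sum_distrib_left case_prod_unfold mult_ac)
  with s show ?thesis by blast
qed

text \<open>After multiplication by \<open>exp (q * t)\<close> the function m differs from a finite
  trigonometric sum g by a vanishing term, and lo and up are the limits of g at infinity. They are
  fixed before r and w, so one choice of phases will serve all of these. Positivity of lo comes from
  the bound \<open>lower\<close>, finiteness from the moduli of the coefficients.\<close>

proposition exponential_sum_limits:
  fixes c \<Lambda> :: "'d::finite \<Rightarrow> 'd \<Rightarrow> complex" and m :: "real \<Rightarrow> real"
  assumes m: "\<And>t. 0 < t \<Longrightarrow> complex_of_real (m t) = (\<Sum>i\<in>UNIV. \<Sum>k\<in>UNIV. c i k * exp (\<Lambda> i k * of_real t))"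
    and q: "0 < q" and rates: "\<And>i k. c i k \<noteq> 0 \<Longrightarrow> Re (\<Lambda> i k) \<le> - q"
    and C: "0 < C" and lower: "\<And>t. 0 < t \<Longrightarrow> C * exp (- q * t) \<le> m t"
  defines "I \<equiv> {(i, k). - Re (\<Lambda> i k) = q \<and> c i k \<noteq> 0}"
  shows "\<exists>lo up. 0 < lo \<and> lo \<le> (\<Sum>(i, k)\<in>I. cmod (c i k)) \<and> 0 < up \<and> up \<le> (\<Sum>(i, k)\<in>I. cmod (c i k)) \<and>
    (\<forall>r w w\<^sub>0. (w \<longlongrightarrow> w\<^sub>0) (at_right 0) \<longrightarrow>
      Liminf (at_right 0) (\<lambda>\<epsilon>. ereal (m (time_scale q \<epsilon> + r * w \<epsilon>) / \<epsilon>)) = ereal (exp (- q * r * w\<^sub>0) * lo) \<and>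
      Limsup (at_right 0) (\<lambda>\<epsilon>. ereal (m (time_scale q \<epsilon> + r * w \<epsilon>) / \<epsilon>)) = ereal (exp (- q * r * w\<^sub>0) * up))"
proof -
  define h where "h t = exp (q * t) * m t" for t
  define g where "g t = (\<Sum>(i, k)\<in>I. Re (c i k * iexp (Im (\<Lambda> i k) * t)))" for t
  define S where "S = (\<Sum>(i, k)\<in>I. cmod (c i k))"
  have hg_eq: "h t - g t = (\<Sum>(i, k)\<in>- I. Re (c i k * exp ((\<Lambda> i k + of_real q) * of_real t)))" if t: "0 < t" for t
  proof -
    have e: "exp ((\<Lambda> i k + of_real q) * of_real t) = of_real (exp (q * t)) * exp (\<Lambda> i k * of_real t)" for i k
      unfolding distrib_right exp_add of_real_mult[symmetric] exp_of_real by (rule mult.commute)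
    have "complex_of_real (h t) = (\<Sum>i\<in>UNIV. \<Sum>k\<in>UNIV. c i k * exp ((\<Lambda> i k + of_real q) * of_real t))"
      unfolding h_def of_real_mult m[OF t] sum_distrib_left
      unfolding e by (simp add: mult_ac)
    also have "\<dots> = (\<Sum>(i, k)\<in>UNIV. c i k * exp ((\<Lambda> i k + of_real q) * of_real t))"
      by (simp add: sum.cartesian_product)
    finally have "h t = (\<Sum>(i, k)\<in>UNIV. Re (c i k * exp ((\<Lambda> i k + of_real q) * of_real t)))"
      by (metis (mono_tags, lifting) Re_complex_of_real Re_sum split_def sum.cong)
    also have "\<dots> = (\<Sum>(i, k)\<in>- I. Re (c i k * exp ((\<Lambda> i k + of_real q) * of_real t)))
        + (\<Sum>(i, k)\<in>I. Re (c i k * exp ((\<Lambda> i k + of_real q) * of_real t)))"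
      by (subst sum.subset_diff[of I UNIV]) (auto simp: Compl_eq_Diff_UNIV)
    also have "(\<Sum>(i, k)\<in>I. Re (c i k * exp ((\<Lambda> i k + of_real q) * of_real t))) = g t"
      unfolding g_def
    proof (intro sum.cong refl, clarify)
      fix i k assume "(i, k) \<in> I"
      then have "\<Lambda> i k + of_real q = \<i> * of_real (Im (\<Lambda> i k))" by (auto simp: I_def complex_eq_iff)
      then show "Re (c i k * exp ((\<Lambda> i k + of_real q) * of_real t)) = Re (c i k * iexp (Im (\<Lambda> i k) * t))"
        by (simp add: mult.assoc)
    qed
    finally show ?thesis by simp
  qed
  have hg: "((\<lambda>t. h t - g t) \<longlongrightarrow> 0) at_top"
  proof (rule Lim_transform_eventually)
    show "\<forall>\<^sub>F t in at_top. (\<Sum>(i, k)\<in>- I. Re (c i k * exp ((\<Lambda> i k + of_real q) * of_real t))) = h t - g t"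
      using eventually_gt_at_top[of 0] by eventually_elim (simp only: hg_eq)
    show "((\<lambda>t. \<Sum>(i, k)\<in>- I. Re (c i k * exp ((\<Lambda> i k + of_real q) * of_real t))) \<longlongrightarrow> 0) at_top"
    proof (rule tendsto_null_sum, clarify)
      fix i k assume ik: "(i, k) \<notin> I"
      show "((\<lambda>t. Re (c i k * exp ((\<Lambda> i k + of_real q) * of_real t))) \<longlongrightarrow> 0) at_top"
      proof (cases "c i k = 0")
        case False
        then have "Re (\<Lambda> i k) + q < 0" using ik rates[OF False] by (auto simp: I_def)
        then have lim: "((\<lambda>t. cmod (c i k) * exp ((Re (\<Lambda> i k) + q) * t)) \<longlongrightarrow> 0) at_top"
          by real_asymp
        show ?thesis
        proof (rule Lim_null_comparison[OF always_eventually lim], intro allI)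
          fix t :: real
          have "\<bar>Re (c i k * exp ((\<Lambda> i k + of_real q) * of_real t))\<bar> \<le> cmod (c i k * exp ((\<Lambda> i k + of_real q) * of_real t))"
            by (rule abs_Re_le_cmod)
          then show "norm (Re (c i k * exp ((\<Lambda> i k + of_real q) * of_real t))) \<le> cmod (c i k) * exp ((Re (\<Lambda> i k) + q) * t)"
            by (simp add: norm_mult)
        qed
      qed simp
    qed
  qed
  have g_bound: "\<bar>g t\<bar> \<le> S" for t
    unfolding g_def S_def
  proof (rule order_trans[OF sum_abs], intro sum_mono, clarify)
    show "\<bar>Re (c i k * iexp (Im (\<Lambda> i k) * t))\<bar> \<le> cmod (c i k)" for i k
      using abs_Re_le_cmod[of "c i k * iexp (Im (\<Lambda> i k) * t)"] by (simp add: norm_mult)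
  qed
  define Lo where "Lo = Liminf at_top (\<lambda>t. ereal (g t))"
  define Up where "Up = Limsup at_top (\<lambda>t. ereal (g t))"
  have "ereal C \<le> Lo"
  proof -
    have "\<forall>\<^sub>F t in at_top. ereal C \<le> ereal (h t)"
      using eventually_gt_at_top[of 0]
    proof eventually_elim
      case (elim t)
      have "exp (q * t) * (C * exp (- q * t)) \<le> h t"
        unfolding h_def using lower[OF elim] by (intro mult_left_mono) auto
      then show ?case by (simp add: exp_minus field_simps)
    qed
    then have "ereal C \<le> Liminf at_top (\<lambda>t. ereal (h t))" by (rule Liminf_bounded)
    then show ?thesis using Liminf_eq_if_diff_vanishes[OF hg] by (simp add: Lo_def)
  qed
  moreover have "Lo \<le> Up" unfolding Lo_def Up_def by (intro Liminf_le_Limsup) simp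
  moreover have "Up \<le> ereal S"
    unfolding Up_def using g_bound by (intro Limsup_bounded always_eventually) (auto intro: order_trans[OF abs_ge_self])
  ultimately obtain lo up where lo: "Lo = ereal lo" and up: "Up = ereal up" and
    bounds: "0 < lo" "lo \<le> S" "0 < up" "up \<le> S"
    using C by (cases Lo; cases Up) auto
  have main: "Liminf (at_right 0) (\<lambda>\<epsilon>. ereal (m (time_scale q \<epsilon> + r * w \<epsilon>) / \<epsilon>)) = ereal (exp (- q * r * w\<^sub>0) * lo) \<and>
      Limsup (at_right 0) (\<lambda>\<epsilon>. ereal (m (time_scale q \<epsilon> + r * w \<epsilon>) / \<epsilon>)) = ereal (exp (- q * r * w\<^sub>0) * up)"
    if w: "(w \<longlongrightarrow> w\<^sub>0) (at_right 0)" for r w w\<^sub>0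
  proof -
    let ?\<tau> = "\<lambda>\<epsilon>. time_scale q \<epsilon>"
    let ?E0 = "exp (- q * r * w\<^sub>0)"
    have \<tau>: "filterlim ?\<tau> at_top (at_right 0)"
      using filtermap_time_scale[OF q, of 0] by (simp add: filterlim_def)
    \<comment> \<open>The time scale is made so that
      \<open>exp (q * time_scale q \<epsilon>) = 1 / \<epsilon>\<close>; what remains of the shift
      is the factor with r and w.\<close>
    have ratio: "\<forall>\<^sub>F \<epsilon> in at_right 0. m (?\<tau> \<epsilon> + r * w \<epsilon>) / \<epsilon> = exp (- q * r * w \<epsilon>) * h (?\<tau> \<epsilon> + r * w \<epsilon>)"
      using eventually_at_right_less[of 0]
    proof eventually_elim
      case (elim \<epsilon>)
      have "exp (q * ?\<tau> \<epsilon>) = 1 / \<epsilon>" using q elim by (simp add: time_scale_def)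
      moreover have "exp (- q * r * w \<epsilon>) * exp (q * (?\<tau> \<epsilon> + r * w \<epsilon>)) = exp (q * ?\<tau> \<epsilon>)"
        by (simp add: exp_add[symmetric] algebra_simps)
      ultimately show ?case unfolding h_def by (simp add: mult.assoc[symmetric])
    qed
    have lim1: "((\<lambda>\<epsilon>. h (?\<tau> \<epsilon> + r * w \<epsilon>) - g (?\<tau> \<epsilon> + r * w \<epsilon>)) \<longlongrightarrow> 0) (at_right 0)"
    proof (rule filterlim_compose[OF hg])
      have "((\<lambda>\<epsilon>. r * w \<epsilon>) \<longlongrightarrow> r * w\<^sub>0) (at_right 0)" by (intro tendsto_intros w)
      from filterlim_tendsto_add_at_top[OF this \<tau>]
      show "filterlim (\<lambda>\<epsilon>. ?\<tau> \<epsilon> + r * w \<epsilon>) at_top (at_right 0)" by (simp add: add.commute)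
    qed
    \<comment> \<open>Uniform continuity of g: replacing w by its limit rotates each term by an
      angle that does not involve the time scale.\<close>
    have lim2: "((\<lambda>\<epsilon>. g (?\<tau> \<epsilon> + r * w \<epsilon>) - g (?\<tau> \<epsilon> + r * w\<^sub>0)) \<longlongrightarrow> 0) (at_right 0)"
    proof (rule Lim_null_comparison[OF always_eventually])
      let ?b = "\<lambda>\<epsilon>. \<Sum>(i, k)\<in>I. cmod (c i k) * cmod (iexp (Im (\<Lambda> i k) * (r * w \<epsilon> - r * w\<^sub>0)) - 1)"
      show "\<forall>\<epsilon>. norm (g (?\<tau> \<epsilon> + r * w \<epsilon>) - g (?\<tau> \<epsilon> + r * w\<^sub>0)) \<le> ?b \<epsilon>"
      proof
        fix \<epsilon>
        have g_diff: "g (?\<tau> \<epsilon> + r * w \<epsilon>) - g (?\<tau> \<epsilon> + r * w\<^sub>0) = (\<Sum>(i, k)\<in>I. Re (c i k * iexp (Im (\<Lambda> i k) * (?\<tau> \<epsilon> + r * w\<^sub>0))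
            * (iexp (Im (\<Lambda> i k) * (r * w \<epsilon> - r * w\<^sub>0)) - 1)))"
          unfolding g_def sum_subtractf[symmetric]
        proof (intro sum.cong refl, clarify)
          fix i k
          have "iexp (Im (\<Lambda> i k) * (?\<tau> \<epsilon> + r * w \<epsilon>)) =
              iexp (Im (\<Lambda> i k) * (?\<tau> \<epsilon> + r * w\<^sub>0)) * iexp (Im (\<Lambda> i k) * (r * w \<epsilon> - r * w\<^sub>0))"
            by (simp add: exp_add[symmetric] algebra_simps)
          then show "Re (c i k * iexp (Im (\<Lambda> i k) * (?\<tau> \<epsilon> + r * w \<epsilon>))) - Re (c i k * iexp (Im (\<Lambda> i k) * (?\<tau> \<epsilon> + r * w\<^sub>0))) =
              Re (c i k * iexp (Im (\<Lambda> i k) * (?\<tau> \<epsilon> + r * w\<^sub>0)) * (iexp (Im (\<Lambda> i k) * (r * w \<epsilon> - r * w\<^sub>0)) - 1))"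
            by (simp only: minus_complex.simps(1)[symmetric] right_diff_distrib mult_1_right mult.assoc)
        qed
        show "norm (g (?\<tau> \<epsilon> + r * w \<epsilon>) - g (?\<tau> \<epsilon> + r * w\<^sub>0)) \<le> ?b \<epsilon>"
          unfolding g_diff
        proof (rule order_trans[OF norm_sum], intro sum_mono, clarify)
          fix i k
          show "norm (Re (c i k * iexp (Im (\<Lambda> i k) * (?\<tau> \<epsilon> + r * w\<^sub>0)) * (iexp (Im (\<Lambda> i k) * (r * w \<epsilon> - r * w\<^sub>0)) - 1)))
              \<le> cmod (c i k) * cmod (iexp (Im (\<Lambda> i k) * (r * w \<epsilon> - r * w\<^sub>0)) - 1)"
            using abs_Re_le_cmod[of "c i k * iexp (Im (\<Lambda> i k) * (?\<tau> \<epsilon> + r * w\<^sub>0)) * (iexp (Im (\<Lambda> i k) * (r * w \<epsilon> - r * w\<^sub>0)) - 1)"]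
            by (simp only: norm_mult norm_exp_i_times mult_1_right real_norm_def)
        qed
      qed
      show "(?b \<longlongrightarrow> 0) (at_right 0)"
      proof (rule tendsto_null_sum, clarify)
        fix i k
        have "((\<lambda>\<epsilon>. cmod (c i k) * cmod (iexp (Im (\<Lambda> i k) * (r * w \<epsilon> - r * w\<^sub>0)) - 1)) \<longlongrightarrow>
            cmod (c i k) * cmod (iexp (Im (\<Lambda> i k) * (r * w\<^sub>0 - r * w\<^sub>0)) - 1)) (at_right 0)"
          by (intro tendsto_intros w)
        then show "((\<lambda>\<epsilon>. cmod (c i k) * cmod (iexp (Im (\<Lambda> i k) * (r * w \<epsilon> - r * w\<^sub>0)) - 1)) \<longlongrightarrow> 0) (at_right 0)"
          by simp
      qed
    qed
    have E: "((\<lambda>\<epsilon>. exp (- q * r * w \<epsilon>)) \<longlongrightarrow> ?E0) (at_right 0)" by (intro tendsto_intros w)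
    have lim3: "((\<lambda>\<epsilon>. (exp (- q * r * w \<epsilon>) - ?E0) * g (?\<tau> \<epsilon> + r * w\<^sub>0)) \<longlongrightarrow> 0) (at_right 0)"
    proof (rule Lim_null_comparison[OF always_eventually])
      show "\<forall>\<epsilon>. norm ((exp (- q * r * w \<epsilon>) - ?E0) * g (?\<tau> \<epsilon> + r * w\<^sub>0)) \<le> \<bar>exp (- q * r * w \<epsilon>) - ?E0\<bar> * S"
        using g_bound by (auto simp: abs_mult intro!: mult_left_mono)
      have "((\<lambda>\<epsilon>. \<bar>exp (- q * r * w \<epsilon>) - ?E0\<bar> * S) \<longlongrightarrow> \<bar>?E0 - ?E0\<bar> * S) (at_right 0)"
        by (intro tendsto_intros E)
      then show "((\<lambda>\<epsilon>. \<bar>exp (- q * r * w \<epsilon>) - ?E0\<bar> * S) \<longlongrightarrow> 0) (at_right 0)" by simp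
    qed
    have diff: "((\<lambda>\<epsilon>. m (?\<tau> \<epsilon> + r * w \<epsilon>) / \<epsilon> - ?E0 * g (?\<tau> \<epsilon> + r * w\<^sub>0)) \<longlongrightarrow> 0) (at_right 0)"
    proof (rule Lim_transform_eventually)
      have "((\<lambda>\<epsilon>. exp (- q * r * w \<epsilon>) * ((h (?\<tau> \<epsilon> + r * w \<epsilon>) - g (?\<tau> \<epsilon> + r * w \<epsilon>)) +
          (g (?\<tau> \<epsilon> + r * w \<epsilon>) - g (?\<tau> \<epsilon> + r * w\<^sub>0))) + (exp (- q * r * w \<epsilon>) - ?E0) * g (?\<tau> \<epsilon> + r * w\<^sub>0))
          \<longlongrightarrow> ?E0 * (0 + 0) + 0) (at_right 0)"
        by (intro tendsto_add tendsto_mult E lim1 lim2 lim3)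
      then show "((\<lambda>\<epsilon>. exp (- q * r * w \<epsilon>) * ((h (?\<tau> \<epsilon> + r * w \<epsilon>) - g (?\<tau> \<epsilon> + r * w \<epsilon>)) +
          (g (?\<tau> \<epsilon> + r * w \<epsilon>) - g (?\<tau> \<epsilon> + r * w\<^sub>0))) + (exp (- q * r * w \<epsilon>) - ?E0) * g (?\<tau> \<epsilon> + r * w\<^sub>0))
          \<longlongrightarrow> 0) (at_right 0)" by simp
      show "\<forall>\<^sub>F \<epsilon> in at_right 0. exp (- q * r * w \<epsilon>) * ((h (?\<tau> \<epsilon> + r * w \<epsilon>) - g (?\<tau> \<epsilon> + r * w \<epsilon>)) +
          (g (?\<tau> \<epsilon> + r * w \<epsilon>) - g (?\<tau> \<epsilon> + r * w\<^sub>0))) + (exp (- q * r * w \<epsilon>) - ?E0) * g (?\<tau> \<epsilon> + r * w\<^sub>0)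
          = m (?\<tau> \<epsilon> + r * w \<epsilon>) / \<epsilon> - ?E0 * g (?\<tau> \<epsilon> + r * w\<^sub>0)"
        using ratio by eventually_elim (simp only:, simp add: algebra_simps)
    qed
    \<comment> \<open>The sign s = 1 yields the lower limit, s = -1 the upper one. The time change
      removes r from the argument of g.\<close>
    have liminf: "Liminf (at_right 0) (\<lambda>\<epsilon>. ereal (s * (?E0 * g (?\<tau> \<epsilon> + r * w\<^sub>0)))) =
        ereal ?E0 * Liminf at_top (\<lambda>t. ereal (s * g t))" for s
    proof -
      have "Liminf (at_right 0) (\<lambda>\<epsilon>. ereal (s * (?E0 * g (?\<tau> \<epsilon> + r * w\<^sub>0)))) =
          Liminf (filtermap (\<lambda>\<epsilon>. ?\<tau> \<epsilon> + r * w\<^sub>0) (at_right 0)) (\<lambda>t. ereal ?E0 * ereal (s * g t))"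
        unfolding Liminf_filtermap by (simp add: mult_ac)
      also have "\<dots> = ereal ?E0 * Liminf at_top (\<lambda>t. ereal (s * g t))"
        unfolding filtermap_time_scale[OF q] by (rule Liminf_ereal_mult_left) auto
      finally show ?thesis .
    qed
    have inf: "Liminf (at_right 0) (\<lambda>\<epsilon>. ereal (m (?\<tau> \<epsilon> + r * w \<epsilon>) / \<epsilon>)) = ereal (?E0 * lo)"
      using Liminf_eq_if_diff_vanishes[OF diff] liminf[of 1] lo by (simp add: Lo_def)
    have "((\<lambda>\<epsilon>. - 1 * (m (?\<tau> \<epsilon> + r * w \<epsilon>) / \<epsilon>) - - 1 * (?E0 * g (?\<tau> \<epsilon> + r * w\<^sub>0))) \<longlongrightarrow> - 0) (at_right 0)"
      using tendsto_minus[OF diff] by simp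
    then have "Liminf (at_right 0) (\<lambda>\<epsilon>. ereal (- 1 * (m (?\<tau> \<epsilon> + r * w \<epsilon>) / \<epsilon>))) =
        ereal ?E0 * Liminf at_top (\<lambda>t. ereal (- 1 * g t))"
      unfolding liminf[symmetric] by (intro Liminf_eq_if_diff_vanishes) simp
    then have "- Limsup (at_right 0) (\<lambda>\<epsilon>. ereal (m (?\<tau> \<epsilon> + r * w \<epsilon>) / \<epsilon>)) = ereal ?E0 * - Up"
      unfolding Up_def ereal_Liminf_uminus[symmetric] by simp
    then have "Limsup (at_right 0) (\<lambda>\<epsilon>. ereal (m (?\<tau> \<epsilon> + r * w \<epsilon>) / \<epsilon>)) = ereal (?E0 * up)"
      unfolding up by (simp add: ereal_uminus_eq_reorder)
    with inf show ?thesis by simp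
  qed
  show ?thesis
    by (intro exI[of _ lo] exI[of _ up] conjI allI impI)
      (use bounds main in \<open>simp_all add: S_def\<close>)
qed

text \<open>Swapping sends the leading pairs with i > k injectively to leading pairs with i < k of
  equal modulus. Doubling counts the diagonal twice, hence only an inequality; it places both limits
  within reach of \<open>phases_realize_value\<close>.\<close>

lemma leading_pair_weights:
  fixes P :: "complex^('d::{finite,linorder})^('d::{finite,linorder})"
    and x :: "real^('d::{finite,linorder})"
    and \<alpha> :: "'d \<Rightarrow> complex" and \<beta> :: "'d \<Rightarrow> 'l::finite \<Rightarrow> complex"
  defines "I \<equiv> leading_pairs P \<alpha> \<beta> x"
  shows "(\<Sum>(i, k)\<in>I. cmod (pair_coeff P x i k)) \<le>
    2 * (\<Sum>(i, k)\<in>{(i, k) \<in> I. i \<le> k}. cmod (pair_coeff P x i k))"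
proof -
  let ?f = "\<lambda>(i, k). cmod (pair_coeff P x i k)"
  let ?J = "{(i, k) \<in> I. i \<le> k}" and ?J' = "{(i, k) \<in> I. \<not> i \<le> k}"
  have swap: "prod.swap p \<in> I" if "p \<in> I" for p
  proof (cases p)
    case (Pair i k)
    then show ?thesis
      using that pair_coeff_swap[of P x k i] by (simp add: I_def leading_pairs_def rate_swap[of \<alpha> \<beta> k i])
  qed
  have "sum ?f (?J \<union> ?J') = sum ?f ?J + sum ?f ?J'" by (rule sum.union_disjoint) auto
  moreover have "?J \<union> ?J' = I" by auto
  ultimately have "sum ?f I = sum ?f ?J + sum ?f ?J'" by simp
  also have "sum ?f ?J' = sum ?f (prod.swap ` ?J')"
  proof -
    have "cmod (pair_coeff P x k i) = cmod (pair_coeff P x i k)" for i k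
      by (subst pair_coeff_swap) simp
    then show ?thesis by (subst sum.reindex) (auto simp: inj_on_def intro!: sum.cong)
  qed
  also have "\<dots> \<le> sum ?f ?J"
    using swap by (intro sum_mono2) (auto simp: not_le intro: less_imp_le)
  finally show ?thesis by simp
qed

text \<open>The last part provides a component that starts nonzero and decays in mean square at the
  slowest rate, as the lower bound on the second moment requires.\<close>

lemma decay_rate_facts:
  fixes P :: "complex^('d::{finite,linorder})^('d::{finite,linorder})"
    and \<beta> :: "'d \<Rightarrow> 'l::finite \<Rightarrow> complex"
  assumes P: "invertible P" and x: "x \<noteq> 0"
    and neg: "Max {rate \<alpha> \<beta> i k |i k. i \<le> k} < 0"
  shows "0 < decay_rate P \<alpha> \<beta> x"
    and "pair_coeff P x i k \<noteq> 0 \<Longrightarrow> rate \<alpha> \<beta> i k \<le> - decay_rate P \<alpha> \<beta> x"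
    and "\<exists>i. (P *v complex_vec x) $ i \<noteq> 0 \<and> rate \<alpha> \<beta> i i = - decay_rate P \<alpha> \<beta> x"
proof -
  let ?D = "{- rate \<alpha> \<beta> i k |i k. pair_coeff P x i k \<noteq> 0}"
  let ?q = "decay_rate P \<alpha> \<beta> x"
  have fin: "finite ?D" "finite {rate \<alpha> \<beta> i k |i k. i \<le> k}"
    by (rule finite_subset[of _ "(\<lambda>(i, k). - rate \<alpha> \<beta> i k) ` UNIV"], auto)
      (rule finite_subset[of _ "(\<lambda>(i, k). rate \<alpha> \<beta> i k) ` UNIV"], auto)
  \<comment> \<open>\<open>Min\<close> needs a nonempty set: the pair coefficients sum to the
    squared norm of x and cannot all vanish.\<close>
  have "?D \<noteq> {}"
  proof
    assume "?D = {}"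
    then have "complex_of_real ((norm x)\<^sup>2) = 0" unfolding norm_square_Gram[OF P] by simp
    with x show False by simp
  qed
  then have "?q \<in> ?D" using Min_in[OF fin(1)] by (simp add: decay_rate_def)
  then obtain i k where ik: "?q = - rate \<alpha> \<beta> i k" "pair_coeff P x i k \<noteq> 0" by auto
  have le: "rate \<alpha> \<beta> i k \<le> - ?q" if "pair_coeff P x i k \<noteq> 0" for i k
  proof -
    have "?q \<le> - rate \<alpha> \<beta> i k" unfolding decay_rate_def using fin(1) that by (intro Min_le) auto
    then show ?thesis by simp
  qed
  then show "pair_coeff P x i k \<noteq> 0 \<Longrightarrow> rate \<alpha> \<beta> i k \<le> - ?q" for i k .
  have neg': "rate \<alpha> \<beta> i k < 0" if "i \<le> k" for i k
    using neg that Max_ge[OF fin(2), of "rate \<alpha> \<beta> i k"] by (auto intro: le_less_trans)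
  have "rate \<alpha> \<beta> i k < 0"
    using neg'[of i k] neg'[of k i] rate_swap[of \<alpha> \<beta> k i] by (cases "i \<le> k") auto
  with ik show "0 < ?q" by simp
  have y: "(P *v complex_vec x) $ i \<noteq> 0" "(P *v complex_vec x) $ k \<noteq> 0"
    using ik(2) by (auto simp: pair_coeff_def Let_def)
  \<comment> \<open>Both diagonal coefficients are nonzero, so both diagonal rates are at most -q;
    their sum is at least twice the minimizing rate -q, so each equals -q.\<close>
  have "rate \<alpha> \<beta> i i = - ?q"
    using le[OF pair_coeff_diagonal_nonzero[OF P y(1)]] le[OF pair_coeff_diagonal_nonzero[OF P y(2)]]
      rate_le_diagonal[of \<alpha> \<beta> i k] ik(1) by linarith
  with y show "\<exists>i. (P *v complex_vec x) $ i \<noteq> 0 \<and> rate \<alpha> \<beta> i i = - ?q" by blast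
qed

theorem theorem2p14:
  fixes M :: "'a measure" and F :: "real \<Rightarrow> 'a measure"
    and W :: "'l::finite \<Rightarrow> real \<Rightarrow> 'a \<Rightarrow> real"
    and A :: "real^('d::{finite,linorder})^('d::{finite,linorder})"
    and B :: "'l \<Rightarrow> real^('d::{finite,linorder})^('d::{finite,linorder})"
    and x :: "real^('d::{finite,linorder})"
    and X :: "real \<Rightarrow> 'a \<Rightarrow> real^('d::{finite,linorder})"
    and P :: "complex^('d::{finite,linorder})^('d::{finite,linorder})"
    and \<alpha> :: "'d \<Rightarrow> complex" and \<beta> :: "'d \<Rightarrow> 'l \<Rightarrow> complex"
    and w :: "real \<Rightarrow> real" and w\<^sub>0 :: real
  assumes "usual_filtered_prob_space M F"
    and "independent_brownian_motions M F W"
    and "stratonovich_solution M F W A B x X"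
    and "invertible P"
    and "P ** complex_mat A ** matrix_inv P = diag_mat \<alpha>"
    and "\<And>j. P ** complex_mat (B j) ** matrix_inv P = diag_mat (\<lambda>i. \<beta> i j)"
    and "Max {rate \<alpha> \<beta> i k |i k. i \<le> k} < 0"
    and "x \<noteq> 0"
    and "\<And>\<epsilon>. 0 < \<epsilon> \<Longrightarrow> \<epsilon> \<le> 1 \<Longrightarrow> 0 < w \<epsilon>"
    and "(w \<longlongrightarrow> w\<^sub>0) (at_right 0)"
    and "0 < w\<^sub>0"
  shows "0 < decay_rate P \<alpha> \<beta> x \<and>
    (\<exists>l u. \<forall>r :: real.
      let q = decay_rate P \<alpha> \<beta> x;
          J = {(i, k) \<in> leading_pairs P \<alpha> \<beta> x. i \<le> k};
          ratio = (\<lambda>\<epsilon>. ereal ((\<integral>\<omega>. (norm (X (time_scale q \<epsilon> + r * w \<epsilon>) \<omega>))\<^sup>2 \<partial>M) / \<epsilon>));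
          limval = (\<lambda>\<phi>. exp (- q * r * w\<^sub>0) *
            (\<Sum>(i, k)\<in>J. 2 * Re (pair_coeff P x i k * exp (\<i> * complex_of_real (\<phi> i k)))))
      in Liminf (at_right 0) ratio = ereal (limval l) \<and> 0 < Liminf (at_right 0) ratio \<and>
         Limsup (at_right 0) ratio = ereal (limval u) \<and> Limsup (at_right 0) ratio < \<infinity>)"
proof -
  interpret usual_filtered_prob_space M F by fact
  let ?q = "decay_rate P \<alpha> \<beta> x" and ?c = "pair_coeff P x"
  let ?m = "\<lambda>t. \<integral>\<omega>. (norm (X t \<omega>))\<^sup>2 \<partial>M"
  let ?I = "leading_pairs P \<alpha> \<beta> x"
  let ?J = "{(i, k) \<in> ?I. i \<le> k}"
  note q = decay_rate_facts[OF assms(4,8,7)]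
  note moment = second_moment[OF assms(2-6)]
  from q(3) obtain i where i: "(P *v complex_vec x) $ i \<noteq> 0" "rate \<alpha> \<beta> i i = - ?q" by blast
  from moment(3)[of i] obtain C where C: "0 < C"
    "\<And>t. 0 < t \<Longrightarrow> C * (cmod ((P *v complex_vec x) $ i))\<^sup>2 * exp (rate \<alpha> \<beta> i i * t) \<le> ?m t" by blast
  \<comment> \<open>The constant of the lower bound, taken from the slowest nonzero diagonal
    component.\<close>
  have "0 < C * (cmod ((P *v complex_vec x) $ i))\<^sup>2" using C(1) i(1) by simp
  from exponential_sum_limits[OF moment(2) q(1) _ this C(2)[unfolded i(2)]]
  obtain lo up where bounds: "0 < lo" "lo \<le> (\<Sum>(i, k)\<in>?I. cmod (?c i k))" "0 < up" "up \<le> (\<Sum>(i, k)\<in>?I. cmod (?c i k))"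
    and lim: "\<And>r w w\<^sub>0. (w \<longlongrightarrow> w\<^sub>0) (at_right 0) \<Longrightarrow>
      Liminf (at_right 0) (\<lambda>\<epsilon>. ereal (?m (time_scale ?q \<epsilon> + r * w \<epsilon>) / \<epsilon>)) = ereal (exp (- ?q * r * w\<^sub>0) * lo) \<and>
      Limsup (at_right 0) (\<lambda>\<epsilon>. ereal (?m (time_scale ?q \<epsilon> + r * w \<epsilon>) / \<epsilon>)) = ereal (exp (- ?q * r * w\<^sub>0) * up)"
    using q(2) unfolding Re_complex_rate leading_pairs_def[symmetric] by blast
  note weights = leading_pair_weights[of P x \<alpha> \<beta>]
  \<comment> \<open>The two limits are known at this point and do not depend on r, so the phases
    fitted to them do not either.\<close>
  obtain l where l: "(\<Sum>(i, k)\<in>?J. 2 * Re (?c i k * exp (\<i> * complex_of_real (l i k)))) = lo"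
    using phases_realize_value[of lo ?c ?J] bounds weights by auto
  obtain u where u: "(\<Sum>(i, k)\<in>?J. 2 * Re (?c i k * exp (\<i> * complex_of_real (u i k)))) = up"
    using phases_realize_value[of up ?c ?J] bounds weights by auto
  show ?thesis
    unfolding Let_def
  proof (rule conjI[OF q(1)], rule exI[of _ l], rule exI[of _ u], intro allI conjI)
    fix r :: real
    note lim = lim[OF assms(10), of r]
    show "Liminf (at_right 0) (\<lambda>\<epsilon>. ereal (?m (time_scale ?q \<epsilon> + r * w \<epsilon>) / \<epsilon>)) = ereal (exp (- ?q * r * w\<^sub>0) *
        (\<Sum>(i, k)\<in>?J. 2 * Re (?c i k * exp (\<i> * complex_of_real (l i k)))))"
      unfolding l using lim by blast
    show "Limsup (at_right 0) (\<lambda>\<epsilon>. ereal (?m (time_scale ?q \<epsilon> + r * w \<epsilon>) / \<epsilon>)) = ereal (exp (- ?q * r * w\<^sub>0) *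
        (\<Sum>(i, k)\<in>?J. 2 * Re (?c i k * exp (\<i> * complex_of_real (u i k)))))"
      unfolding u using lim by blast
    show "0 < Liminf (at_right 0) (\<lambda>\<epsilon>. ereal (?m (time_scale ?q \<epsilon> + r * w \<epsilon>) / \<epsilon>))"
      using lim bounds(1) by simp
    show "Limsup (at_right 0) (\<lambda>\<epsilon>. ereal (?m (time_scale ?q \<epsilon> + r * w \<epsilon>) / \<epsilon>)) < \<infinity>"
      using lim by simp
  qed
qed

end
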